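(* Let $K,N\in\mathbb{R}$ with $N\ge 1$. A metric measure space $(M,d,m)$ satisfies $\mathsf{CD}^*_{\mathrm{loc}}(K',N)$ for all $K'<K$ if and only if it satisfies $\mathsf{CD}_{\mathrm{loc}}(K',N)$ for all $K'<K$.
   Context: A metric measure space $(M,d,m)$ consists of a complete separable metric space $(M,d)$ and a locally finite Borel measure $m$ (for every $x\in M$, $m(B_r(x))<\infty$ for all sufficiently small $r>0$). $\mathcal{P}_2(M,d)$ is the space of Borel probability measures with finite second moment, with the $L_2$-Wasserstein distance $d_W(\mu,\nu)=\inf_q\big(\int d^2\,dq\big)^{1/2}$ over couplings $q$ of $\mu,\nu$; optimal couplings are the minimizers. $\mathcal{P}_\infty(M,d,m)$ is the subspace of $m$-absolutely continuous probability measures with bounded support. A geodesic $\Gamma:[0,1]\to\mathcal{P}_\infty(M,d,m)$ is a curve with $d_W(\Gamma(s),\Gamma(t))=|s-t|\,d_W(\Gamma(0),\Gamma(1))$. For $\nu=\rho m$ and $N'\ge 1$, $S_{N'}(\nu|m):=-\int_M\rho^{1-1/N'}\,dm$ (with $0^0=0$ when $N'=1$). For $\theta\ge 0$: $\mathfrak{S}_k(\theta)=\frac{\sin(\sqrt{k}\theta)}{\sqrt{k}\theta}$ if $k>0$, $=1$ if $k=0$, $=\frac{\sinh(\sqrt{-k}\theta)}{\sqrt{-k}\theta}$ if $k<0$ (value $1$ at $\theta=0$). For $t\in[0,1]$: $\sigma^{(t)}_{K,N}(\theta)=\infty$ if $K\theta^2\ge N\pi^2$, and $\sigma^{(t)}_{K,N}(\theta)=t\,\frac{\mathfrak{S}_{K/N}(t\theta)}{\mathfrak{S}_{K/N}(\theta)}$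 otherwise. Further $\tau^{(t)}_{K,N}(\theta):=t^{1/N}\sigma^{(t)}_{K,N-1}(\theta)^{1-1/N}$ for $N>1$; for $N=1$, $\tau^{(t)}_{K,1}(\theta)=t$ if $K\theta^2\le 0$ and $=\infty$ if $K\theta^2>0$. $\mathsf{CD}^*_{\mathrm{loc}}(K,N)$: each $x\in M$ has a neighborhood $M(x)$ such that for all $\nu_0=\rho_0m,\nu_1=\rho_1m\in\mathcal{P}_\infty(M,d,m)$ supported in $M(x)$ there exist an optimal coupling $q$ of $\nu_0,\nu_1$ and a geodesic $\Gamma:[0,1]\to\mathcal{P}_\infty(M,d,m)$ connecting them such that for all $t\in[0,1]$ and all $N'\ge N$, $$S_{N'}(\Gamma(t)|m)\le-\int_{M\times M}\Big[\sigma^{(1-t)}_{K,N'}(d(x_0,x_1))\rho_0^{-1/N'}(x_0)+\sigma^{(t)}_{K,N'}(d(x_0,x_1))\rho_1^{-1/N'}(x_1)\Big]dq(x_0,x_1).$$ ($\Gamma(t)$ need not be supported in $M(x)$ for $0<t<1$.) $\mathsf{CD}_{\mathrm{loc}}(K,N)$: the same condition with $\sigma^{(1-t)}_{K,N'},\sigma^{(t)}_{K,N'}$ replaced by $\tau^{(1-t)}_{K,N'},\tau^{(t)}_{K,N'}$. *)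

theory Defs
  imports "HOL-Analysis.Analysis" "HOL-Probability.Probability"
begin

text \<open>
  The complete separable metric space \<open>(M, d)\<close> is a type of class
  \<^class>\<open>polish_space\<close> with its distance \<^const>\<open>dist\<close>.
  Integrands that may take the value \<open>\<infinity>\<close> are \<^typ>\<open>ennreal\<close>-valued.
\<close>

definition metric_measure_space :: "'a::polish_space measure \<Rightarrow> bool" where
  "metric_measure_space m \<longleftrightarrow>
     sets m = sets borel \<and>
     (\<forall>x. \<exists>r0>0. \<forall>r. 0 < r \<and> r < r0 \<longrightarrow> emeasure m (ball x r) < \<infinity>)"

text \<open>Real powers with \<open>\<infinity> ^ a = \<infinity>\<close>; used only for exponents \<open>a > 0\<close>.\<close>

definition ennreal_powr :: "ennreal \<Rightarrow> real \<Rightarrow> ennreal" where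
  "ennreal_powr x a = (if x = \<infinity> then \<infinity> else ennreal (enn2real x powr a))"


subsection \<open>The Wasserstein space\<close>

definition P2 :: "'a::polish_space measure set" where
  "P2 = {\<mu>. sets \<mu> = sets borel \<and> prob_space \<mu> \<and>
            (\<exists>x0. (\<integral>\<^sup>+ x. ennreal ((dist x0 x)\<^sup>2) \<partial>\<mu>) < \<infinity>)}"

definition couplings :: "'a::polish_space measure \<Rightarrow> 'a measure \<Rightarrow> ('a \<times> 'a) measure set" where
  "couplings \<mu> \<nu> = {q. sets q = sets borel \<and> distr q borel fst = \<mu> \<and> distr q borel snd = \<nu>}"

definition transport_cost :: "('a::polish_space \<times> 'a) measure \<Rightarrow> ennreal" where
  "transport_cost q = (\<integral>\<^sup>+ p. ennreal ((dist (fst p) (snd p))\<^sup>2) \<partial>q)"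

definition wasserstein :: "'a::polish_space measure \<Rightarrow> 'a measure \<Rightarrow> ennreal" where
  "wasserstein \<mu> \<nu> = (INF q \<in> couplings \<mu> \<nu>. ennreal_powr (transport_cost q) (1/2))"

definition optimal_coupling ::
    "'a::polish_space measure \<Rightarrow> 'a measure \<Rightarrow> ('a \<times> 'a) measure \<Rightarrow> bool" where
  "optimal_coupling \<mu> \<nu> q \<longleftrightarrow>
     q \<in> couplings \<mu> \<nu> \<and> (\<forall>q' \<in> couplings \<mu> \<nu>. transport_cost q \<le> transport_cost q')"

definition msupport :: "'a::polish_space measure \<Rightarrow> 'a set" where
  "msupport \<nu> = {x. \<forall>r>0. emeasure \<nu> (ball x r) > 0}"

definition Pinf :: "'a::polish_space measure \<Rightarrow> 'a measure set" where
  "Pinf m = {\<nu> \<in> P2. absolutely_continuous m \<nu> \<and> bounded (msupport \<nu>)}"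

text \<open>Only the values of \<open>\<Gamma>\<close> on \<open>[0,1]\<close> matter.\<close>

definition Pinf_geodesic :: "'a::polish_space measure \<Rightarrow> (real \<Rightarrow> 'a measure) \<Rightarrow> bool" where
  "Pinf_geodesic m \<Gamma> \<longleftrightarrow>
     (\<forall>t\<in>{0..1}. \<Gamma> t \<in> Pinf m) \<and>
     (\<forall>s\<in>{0..1}. \<forall>t\<in>{0..1}.
        wasserstein (\<Gamma> s) (\<Gamma> t) = ennreal \<bar>s - t\<bar> * wasserstein (\<Gamma> 0) (\<Gamma> 1))"


subsection \<open>Entropy\<close>

text \<open>
  The density \<open>\<rho>\<close> with \<open>\<nu> = \<rho> m\<close>. It is determined and finite only up to \<open>m\<close>-null sets;
  it is used below only under integrals with respect to \<open>m\<close> or to a coupling whose marginals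
  are absolutely continuous, so that the choice of representative is immaterial.
\<close>

definition dens :: "'a::polish_space measure \<Rightarrow> 'a measure \<Rightarrow> 'a \<Rightarrow> real" where
  "dens m \<nu> x = enn2real (RN_deriv m \<nu> x)"

text \<open>
  The value \<open>-\<infinity>\<close> is possible, because bounded sets may have infinite \<open>m\<close>-measure.
  For \<open>N' = 1\<close> the convention \<open>0 powr 0 = 0\<close> of the library is the one required.
\<close>

definition renyi_entropy :: "real \<Rightarrow> 'a::polish_space measure \<Rightarrow> 'a measure \<Rightarrow> ereal" where
  "renyi_entropy N' \<nu> m = - enn2ereal (\<integral>\<^sup>+ x. ennreal (dens m \<nu> x powr (1 - 1/N')) \<partial>m)"


subsection \<open>Distortion coefficients\<close>

definition sfun :: "real \<Rightarrow> real \<Rightarrow> real" where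
  "sfun k \<theta> =
     (if \<theta> = 0 \<or> k = 0 then 1
      else if k > 0 then sin (sqrt k * \<theta>) / (sqrt k * \<theta>)
      else sinh (sqrt (- k) * \<theta>) / (sqrt (- k) * \<theta>))"

definition sigma_coeff :: "real \<Rightarrow> real \<Rightarrow> real \<Rightarrow> real \<Rightarrow> ennreal" where
  "sigma_coeff K N t \<theta> =
     (if K * \<theta>\<^sup>2 \<ge> N * pi\<^sup>2 then \<infinity>
      else ennreal (t * (sfun (K/N) (t * \<theta>) / sfun (K/N) \<theta>)))"

text \<open>
  For \<open>N > 1\<close>, \<open>t = 0\<close> and an infinite \<open>\<sigma>\<close>-coefficient the product below is \<open>0 * \<infinity> = 0\<close>.
  In the curvature-dimension condition the other coefficient, at \<open>1 - t = 1\<close>, is then \<open>\<infinity>\<close>, and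
  it is multiplied by a positive number almost everywhere, so the value chosen here is immaterial.
\<close>

definition tau_coeff :: "real \<Rightarrow> real \<Rightarrow> real \<Rightarrow> real \<Rightarrow> ennreal" where
  "tau_coeff K N t \<theta> =
     (if N = 1 then (if K * \<theta>\<^sup>2 \<le> 0 then ennreal t else \<infinity>)
      else ennreal (t powr (1/N)) * ennreal_powr (sigma_coeff K (N - 1) t \<theta>) (1 - 1/N))"


subsection \<open>Local curvature-dimension conditions\<close>

text \<open>
  The parameter \<open>\<beta>\<close> is the family of distortion coefficients, with arguments \<open>K\<close>, \<open>N'\<close>,
  \<open>t\<close>, \<open>\<theta>\<close>. The densities are positive almost everywhere with respect to the corresponding
  marginals of \<open>q\<close>, so the value of \<open>0 powr (- 1/N')\<close> is immaterial.
\<close>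

definition CD_loc_with ::
    "(real \<Rightarrow> real \<Rightarrow> real \<Rightarrow> real \<Rightarrow> ennreal) \<Rightarrow> 'a::polish_space measure \<Rightarrow> real \<Rightarrow> real \<Rightarrow> bool"
where
  "CD_loc_with \<beta> m K N \<longleftrightarrow>
     (\<forall>x. \<exists>U. x \<in> interior U \<and>
       (\<forall>\<nu>0 \<in> Pinf m. \<forall>\<nu>1 \<in> Pinf m. msupport \<nu>0 \<subseteq> U \<and> msupport \<nu>1 \<subseteq> U \<longrightarrow>
         (\<exists>q \<Gamma>. optimal_coupling \<nu>0 \<nu>1 q \<and> Pinf_geodesic m \<Gamma> \<and> \<Gamma> 0 = \<nu>0 \<and> \<Gamma> 1 = \<nu>1 \<and>
           (\<forall>t\<in>{0..1}. \<forall>N'\<ge>N.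
              renyi_entropy N' (\<Gamma> t) m \<le>
                - enn2ereal (\<integral>\<^sup>+ (x0, x1).
                     (\<beta> K N' (1 - t) (dist x0 x1) * ennreal (dens m \<nu>0 x0 powr (- 1/N'))
                      + \<beta> K N' t (dist x0 x1) * ennreal (dens m \<nu>1 x1 powr (- 1/N'))) \<partial>q)))))"

definition CD_star_loc :: "'a::polish_space measure \<Rightarrow> real \<Rightarrow> real \<Rightarrow> bool" where
  "CD_star_loc = CD_loc_with sigma_coeff"

definition CD_loc :: "'a::polish_space measure \<Rightarrow> real \<Rightarrow> real \<Rightarrow> bool" where
  "CD_loc = CD_loc_with tau_coeff"

end

theory Submission
  imports Defs
begin

text \<open>
  For \<open>N > 1\<close>, \<open>K' < K\<close> and small \<open>\<theta>\<close> the coefficients satisfy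
  \<open>\<sigma>\<^bsub>K'\<^esub> \<le> \<tau>\<^bsub>K\<^esub>\<close> and \<open>\<tau>\<^bsub>K'\<^esub> \<le> \<sigma>\<^bsub>K\<^esub>\<close>, uniformly in \<open>N' \<ge> N\<close> and \<open>t\<close>, because both
  \<open>ln (\<sigma>/t)\<close> and \<open>ln (\<tau>/t)\<close> equal \<open>K \<theta>\<^sup>2 (1 - t\<^sup>2) / (6 N')\<close> up to terms of fourth order in \<open>\<theta>\<close>;
  so both conditions hold with the same coupling and geodesic on smaller neighborhoods.

  For \<open>N = 1\<close> the second comparison fails: \<open>\<tau>\<^bsub>K',1\<^esub>\<close> is \<open>t\<close> or \<open>\<infinity>\<close>. Here the condition with \<open>\<sigma>\<close> and
  \<open>N' = 1\<close> is a Brunn-Minkowski inequality: contracting a set by the factor \<open>l\<close> towards a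
  point multiplies its measure by at least \<open>l (1 - O(d\<^sup>2))\<close>, where \<open>d\<close> is the distance. Hence \<open>m (B\<^sub>r) / r\<close> is almost
  decreasing, so that no point of the support has three transversal directions, and the
  support is near each of its points a single point or an interval. On an interval the contraction
  property in both directions makes the second differences of the distribution function of
  \<open>m\<close> cubically small, so \<open>m\<close> is a multiple of the length. If \<open>K > 0\<close>, strict expansion excludes
  intervals; if \<open>K \<le> 0\<close>, monotone rearrangement gives the condition with the
  coefficient \<open>t \<ge> \<tau>\<^bsub>K',N'\<^esub>\<close>.
\<close>


section \<open>Comparison of the distortion coefficients\<close>

text \<open>At exponent one no enlargement of the curvature bound can help: for K < 0 and 0 < t < 1
  the coefficient \<open>sigma_coeff K 1 t\<close> stays below t at every positive distance, while
  \<open>tau_coeff K' 1 t\<close> is t for all K' < K. In the estimates this shows as a distance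
  threshold of order sqrt (N - 1), which comes from the index N - 1 inside tau and collapses as N
  tends to 1. So the space itself has to be identified. Only the information at N' = 1 is used for
  that, yet the conclusion is required for all N' >= 1 with one coupling and one geodesic. This
  works because on a segment with constant density the condition with the linear coefficient t holds
  for all N' simultaneously, by concavity of the powers 1/N'. Existence of midpoints, compactness of
  small balls of the support and absence of atoms are all read off from the contraction estimate;
  this is why contraction is formulated with approximate intermediate points.\<close>

lemma nonneg_if_deriv_nonneg:
  fixes f f' :: "real \<Rightarrow> real"
  assumes "f 0 = 0" "0 \<le> x"
    and "\<And>y. 0 \<le> y \<Longrightarrow> y \<le> x \<Longrightarrow> (f has_real_derivative f' y) (at y)"
    and "\<And>y. 0 \<le> y \<Longrightarrow> y \<le> x \<Longrightarrow> 0 \<le> f' y"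
  shows "0 \<le> f x"
proof -
  have "f 0 \<le> f x"
    by (rule DERIV_nonneg_imp_nondecreasing) (use assms in auto)
  then show ?thesis using assms(1) by simp
qed

section \<open>Logarithmic derivatives of sin x / x and sinh x / x\<close>

lemma sin_minus_mult_cos_nonneg:
  fixes x :: real assumes "0 \<le> x" "x \<le> pi" shows "0 \<le> sin x - x * cos x"
proof (rule nonneg_if_deriv_nonneg[where f = "\<lambda>x. sin x - x * cos x" and f' = "\<lambda>x. x * sin x"])
  show "((\<lambda>x. sin x - x * cos x) has_real_derivative y * sin y) (at y)" for y :: real
    by (auto intro!: derivative_eq_intros)
  show "0 \<le> y * sin y" if "0 \<le> y" "y \<le> x" for y
    using that assms by (simp add: sin_ge_zero)
qed (use assms in auto)

text \<open>The logarithmic derivative of sin x / x is - (sin x - x cos x) / (x sin x), so this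
  bounds it above by - x/3, the first term of its expansion. With the denominator cleared both sides
  vanish at 0 and differentiation is enough.\<close>

lemma sin_minus_mult_cos_ge:
  fixes x :: real assumes "0 \<le> x" "x \<le> pi" shows "x\<^sup>2 / 3 * sin x \<le> sin x - x * cos x"
proof -
  have "0 \<le> sin x - x * cos x - x\<^sup>2 / 3 * sin x"
  proof (rule nonneg_if_deriv_nonneg[where f = "\<lambda>x. sin x - x * cos x - x\<^sup>2 / 3 * sin x"
        and f' = "\<lambda>x. x / 3 * (sin x - x * cos x)"])
    show "((\<lambda>x. sin x - x * cos x - x\<^sup>2 / 3 * sin x) has_real_derivative
        y / 3 * (sin y - y * cos y)) (at y)" for y :: real
      by (auto intro!: derivative_eq_intros simp: field_simps power2_eq_square)
    show "0 \<le> y / 3 * (sin y - y * cos y)" if "0 \<le> y" "y \<le> x" for y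
      using that assms sin_minus_mult_cos_nonneg[of y] by (intro mult_nonneg_nonneg) auto
  qed (use assms in auto)
  then show ?thesis by simp
qed

lemma sin_minus_mult_cos_le_aux:
  fixes x :: real assumes "0 \<le> x" "x \<le> 1" shows "0 \<le> x\<^sup>2 * sin x - (sin x - x * cos x)"
proof (rule nonneg_if_deriv_nonneg[where f = "\<lambda>x. x\<^sup>2 * sin x - (sin x - x * cos x)"
      and f' = "\<lambda>x. x * sin x + x\<^sup>2 * cos x"])
  show "((\<lambda>x. x\<^sup>2 * sin x - (sin x - x * cos x)) has_real_derivative
      y * sin y + y\<^sup>2 * cos y) (at y)" for y :: real
    by (auto intro!: derivative_eq_intros simp: field_simps power2_eq_square)
  show "0 \<le> y * sin y + y\<^sup>2 * cos y" if "0 \<le> y" "y \<le> x" for y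
    using that assms pi_ge_two
    by (intro add_nonneg_nonneg mult_nonneg_nonneg sin_ge_zero cos_ge_zero) auto
qed (use assms in auto)

text \<open>The matching bound from the other side. The expansion of the logarithmic derivative
  continues with - x^3/45; taking 1/3 in place of 1/45 is generous and makes the derivative of the
  difference split into terms that are visibly nonnegative on [0,1].\<close>

lemma sin_minus_mult_cos_le:
  fixes x :: real assumes "0 \<le> x" "x \<le> 1"
  shows "sin x - x * cos x \<le> (x\<^sup>2 / 3 + x ^ 4 / 3) * sin x"
proof -
  have "0 \<le> (x\<^sup>2 / 3 + x ^ 4 / 3) * sin x - (sin x - x * cos x)"
  proof (rule nonneg_if_deriv_nonneg[where f = "\<lambda>x. (x\<^sup>2 / 3 + x ^ 4 / 3) * sin x - (sin x - x * cos x)"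
        and f' = "\<lambda>x. x / 3 * ((x\<^sup>2 * sin x - (sin x - x * cos x)) + 3 * x\<^sup>2 * sin x + x ^ 3 * cos x)"])
    show "((\<lambda>x. (x\<^sup>2 / 3 + x ^ 4 / 3) * sin x - (sin x - x * cos x)) has_real_derivative
        y / 3 * ((y\<^sup>2 * sin y - (sin y - y * cos y)) + 3 * y\<^sup>2 * sin y + y ^ 3 * cos y)) (at y)" for y :: real
      by (auto intro!: derivative_eq_intros simp: field_simps power2_eq_square power3_eq_cube power4_eq_xxxx)
    show "0 \<le> y / 3 * ((y\<^sup>2 * sin y - (sin y - y * cos y)) + 3 * y\<^sup>2 * sin y + y ^ 3 * cos y)"
      if "0 \<le> y" "y \<le> x" for y
      using that assms pi_ge_two sin_minus_mult_cos_le_aux[of y]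
      by (intro add_nonneg_nonneg mult_nonneg_nonneg sin_ge_zero cos_ge_zero) auto
  qed (use assms in auto)
  then show ?thesis by simp
qed

lemma mult_cosh_minus_sinh_nonneg:
  fixes x :: real assumes "0 \<le> x" shows "0 \<le> x * cosh x - sinh x"
proof (rule nonneg_if_deriv_nonneg[where f = "\<lambda>x. x * cosh x - sinh x" and f' = "\<lambda>x. x * sinh x"])
  show "((\<lambda>x. x * cosh x - sinh x) has_real_derivative y * sinh y) (at y)" for y :: real
    by (auto intro!: derivative_eq_intros)
qed (use assms in auto)

lemma mult_cosh_minus_sinh_le:
  fixes x :: real assumes "0 \<le> x" shows "x * cosh x - sinh x \<le> x\<^sup>2 / 3 * sinh x"
proof -
  have "0 \<le> x\<^sup>2 / 3 * sinh x - (x * cosh x - sinh x)"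
  proof (rule nonneg_if_deriv_nonneg[where f = "\<lambda>x. x\<^sup>2 / 3 * sinh x - (x * cosh x - sinh x)"
        and f' = "\<lambda>x. x / 3 * (x * cosh x - sinh x)"])
    show "((\<lambda>x. x\<^sup>2 / 3 * sinh x - (x * cosh x - sinh x)) has_real_derivative
        y / 3 * (y * cosh y - sinh y)) (at y)" for y :: real
      by (auto intro!: derivative_eq_intros simp: field_simps power2_eq_square)
    show "0 \<le> y / 3 * (y * cosh y - sinh y)" if "0 \<le> y" "y \<le> x" for y
      using that mult_cosh_minus_sinh_nonneg[of y] by simp
  qed (use assms in auto)
  then show ?thesis by simp
qed

lemma mult_cosh_minus_sinh_le_aux:
  fixes x :: real assumes "0 \<le> x" shows "0 \<le> x\<^sup>2 * sinh x - (x * cosh x - sinh x)"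
proof -
  have "x\<^sup>2 / 3 * sinh x \<le> x\<^sup>2 * sinh x"
    using assms by (intro mult_right_mono) auto
  then show ?thesis using mult_cosh_minus_sinh_le[OF assms] by linarith
qed

text \<open>For sinh the signs alternate, coth x - 1/x = x/3 - x^3/45 + ..., so the cubic correction
  now appears in the lower bound.\<close>

lemma mult_cosh_minus_sinh_ge:
  fixes x :: real assumes "0 \<le> x"
  shows "(x\<^sup>2 / 3 - x ^ 4 / 3) * sinh x \<le> x * cosh x - sinh x"
proof -
  have "0 \<le> x * cosh x - sinh x - (x\<^sup>2 / 3 - x ^ 4 / 3) * sinh x"
  proof (rule nonneg_if_deriv_nonneg[where f = "\<lambda>x. x * cosh x - sinh x - (x\<^sup>2 / 3 - x ^ 4 / 3) * sinh x"
        and f' = "\<lambda>x. x / 3 * ((x\<^sup>2 * sinh x - (x * cosh x - sinh x)) + 3 * x\<^sup>2 * sinh x + x ^ 3 * cosh x)"])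
    show "((\<lambda>x. x * cosh x - sinh x - (x\<^sup>2 / 3 - x ^ 4 / 3) * sinh x) has_real_derivative
        y / 3 * ((y\<^sup>2 * sinh y - (y * cosh y - sinh y)) + 3 * y\<^sup>2 * sinh y + y ^ 3 * cosh y)) (at y)" for y :: real
      by (auto intro!: derivative_eq_intros simp: field_simps power2_eq_square power3_eq_cube power4_eq_xxxx)
    show "0 \<le> y / 3 * ((y\<^sup>2 * sinh y - (y * cosh y - sinh y)) + 3 * y\<^sup>2 * sinh y + y ^ 3 * cosh y)"
      if "0 \<le> y" "y \<le> x" for y
      using that assms mult_cosh_minus_sinh_le_aux[of y]
      by (intro add_nonneg_nonneg mult_nonneg_nonneg) auto
  qed (use assms in auto)
  then show ?thesis by simp
qed

text \<open>The bound on the logarithmic derivative, integrated from a to b: adding x^2/6 to ln (sin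
  x / x) makes it nonincreasing.\<close>

lemma ln_sin_ratio_ge:
  fixes a b :: real
  assumes "0 < a" "a \<le> b" "b < pi"
  shows "(b\<^sup>2 - a\<^sup>2) / 6 \<le> ln (sin a / a) - ln (sin b / b)"
proof -
  have "ln (sin b / b) + b\<^sup>2 / 6 \<le> ln (sin a / a) + a\<^sup>2 / 6"
  proof (rule DERIV_nonpos_imp_nonincreasing[where f = "\<lambda>x. ln (sin x / x) + x\<^sup>2 / 6"])
    fix x assume x: "a \<le> x" "x \<le> b"
    have s: "0 < sin x" using x assms by (intro sin_gt_zero) auto
    have "((\<lambda>x. ln (sin x / x) + x\<^sup>2 / 6) has_real_derivative
        (x\<^sup>2 / 3 * sin x - (sin x - x * cos x)) / (x * sin x)) (at x)"
      using s x assms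
      by (auto intro!: derivative_eq_intros simp: field_simps power2_eq_square)
    moreover have "(x\<^sup>2 / 3 * sin x - (sin x - x * cos x)) / (x * sin x) \<le> 0"
      using s x assms sin_minus_mult_cos_ge[of x] by (intro divide_nonpos_nonneg) auto
    ultimately show "\<exists>y. ((\<lambda>x. ln (sin x / x) + x\<^sup>2 / 6) has_real_derivative y) (at x) \<and> y \<le> 0"
      by blast
  qed (use assms in auto)
  then show ?thesis by (simp add: field_simps)
qed

lemma ln_sin_ratio_le:
  fixes a b :: real
  assumes "0 < a" "a \<le> b" "b \<le> 1"
  shows "ln (sin a / a) - ln (sin b / b) \<le> (b\<^sup>2 - a\<^sup>2) / 6 + (b ^ 4 - a ^ 4) / 12"
proof -
  have "ln (sin a / a) + a\<^sup>2 / 6 + a ^ 4 / 12 \<le> ln (sin b / b) + b\<^sup>2 / 6 + b ^ 4 / 12"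
  proof (rule DERIV_nonneg_imp_nondecreasing[where f = "\<lambda>x. ln (sin x / x) + x\<^sup>2 / 6 + x ^ 4 / 12"])
    fix x assume x: "a \<le> x" "x \<le> b"
    have s: "0 < sin x" using x assms pi_ge_two by (intro sin_gt_zero) auto
    have "((\<lambda>x. ln (sin x / x) + x\<^sup>2 / 6 + x ^ 4 / 12) has_real_derivative
        ((x\<^sup>2 / 3 + x ^ 4 / 3) * sin x - (sin x - x * cos x)) / (x * sin x)) (at x)"
      using s x assms
      by (auto intro!: derivative_eq_intros simp: field_simps power2_eq_square power3_eq_cube power4_eq_xxxx)
    moreover have "0 \<le> ((x\<^sup>2 / 3 + x ^ 4 / 3) * sin x - (sin x - x * cos x)) / (x * sin x)"
      using s x assms sin_minus_mult_cos_le[of x] by (intro divide_nonneg_nonneg) auto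
    ultimately show "\<exists>y. ((\<lambda>x. ln (sin x / x) + x\<^sup>2 / 6 + x ^ 4 / 12) has_real_derivative y) (at x) \<and> 0 \<le> y"
      by blast
  qed (use assms in auto)
  then show ?thesis by (simp add: field_simps)
qed

lemma ln_sinh_ratio_ge:
  fixes a b :: real
  assumes "0 < a" "a \<le> b"
  shows "- (b\<^sup>2 - a\<^sup>2) / 6 \<le> ln (sinh a / a) - ln (sinh b / b)"
proof -
  have "ln (sinh b / b) - b\<^sup>2 / 6 \<le> ln (sinh a / a) - a\<^sup>2 / 6"
  proof (rule DERIV_nonpos_imp_nonincreasing[where f = "\<lambda>x. ln (sinh x / x) - x\<^sup>2 / 6"])
    fix x assume x: "a \<le> x" "x \<le> b"
    have s: "0 < sinh x" using x assms by simp
    have "((\<lambda>x. ln (sinh x / x) - x\<^sup>2 / 6) has_real_derivative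
        ((x * cosh x - sinh x) - x\<^sup>2 / 3 * sinh x) / (x * sinh x)) (at x)"
      using s x assms
      by (auto intro!: derivative_eq_intros simp: field_simps power2_eq_square)
    moreover have "((x * cosh x - sinh x) - x\<^sup>2 / 3 * sinh x) / (x * sinh x) \<le> 0"
      using s x assms mult_cosh_minus_sinh_le[of x] by (intro divide_nonpos_nonneg) auto
    ultimately show "\<exists>y. ((\<lambda>x. ln (sinh x / x) - x\<^sup>2 / 6) has_real_derivative y) (at x) \<and> y \<le> 0"
      by blast
  qed (use assms in auto)
  then show ?thesis by (simp add: field_simps)
qed

lemma ln_sinh_ratio_le:
  fixes a b :: real
  assumes "0 < a" "a \<le> b"
  shows "ln (sinh a / a) - ln (sinh b / b) \<le> - (b\<^sup>2 - a\<^sup>2) / 6 + (b ^ 4 - a ^ 4) / 12"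
proof -
  have "ln (sinh a / a) - a\<^sup>2 / 6 + a ^ 4 / 12 \<le> ln (sinh b / b) - b\<^sup>2 / 6 + b ^ 4 / 12"
  proof (rule DERIV_nonneg_imp_nondecreasing[where f = "\<lambda>x. ln (sinh x / x) - x\<^sup>2 / 6 + x ^ 4 / 12"])
    fix x assume x: "a \<le> x" "x \<le> b"
    have s: "0 < sinh x" using x assms by simp
    have "((\<lambda>x. ln (sinh x / x) - x\<^sup>2 / 6 + x ^ 4 / 12) has_real_derivative
        ((x * cosh x - sinh x) - (x\<^sup>2 / 3 - x ^ 4 / 3) * sinh x) / (x * sinh x)) (at x)"
      using s x assms
      by (auto intro!: derivative_eq_intros simp: field_simps power2_eq_square power3_eq_cube power4_eq_xxxx)
    moreover have "0 \<le> ((x * cosh x - sinh x) - (x\<^sup>2 / 3 - x ^ 4 / 3) * sinh x) / (x * sinh x)"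
      using s x assms mult_cosh_minus_sinh_ge[of x] by (intro divide_nonneg_nonneg) auto
    ultimately show "\<exists>y. ((\<lambda>x. ln (sinh x / x) - x\<^sup>2 / 6 + x ^ 4 / 12) has_real_derivative y) (at x) \<and> 0 \<le> y"
      by blast
  qed (use assms in auto)
  then show ?thesis by (simp add: field_simps)
qed

section \<open>Exponential bounds for quotients of \<open>sfun\<close>\<close>

lemma sfun_pos:
  assumes "0 \<le> \<theta>" "k * \<theta>\<^sup>2 < pi\<^sup>2" shows "0 < sfun k \<theta>"
proof -
  have "0 < sin (sqrt k * \<theta>)" if "0 < k" "0 < \<theta>"
  proof (rule sin_gt_zero)
    have "(sqrt k * \<theta>)\<^sup>2 < pi\<^sup>2" using that assms by (simp add: power_mult_distrib)
    then show "sqrt k * \<theta> < pi" using power2_less_imp_less pi_ge_zero by blast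
  qed (use that in auto)
  then show ?thesis using assms by (auto simp: sfun_def zero_less_divide_iff zero_less_mult_iff)
qed

text \<open>With x = sqrt |k| * \<theta> the sine and the sinh case lead to the same exponent,
  because x^2 is k * \<theta>^2 in the first and - k * \<theta>^2 in the second.\<close>

lemma sfun_ratio_ge:
  assumes "0 \<le> \<theta>" "k * \<theta>\<^sup>2 < pi\<^sup>2" "0 < t" "t \<le> 1"
  shows "exp (k * \<theta>\<^sup>2 * (1 - t\<^sup>2) / 6) \<le> sfun k (t * \<theta>) / sfun k \<theta>"
proof -
  have t\<theta>: "t * \<theta> \<le> \<theta>" using assms by (simp add: mult_left_le_one_le)
  have t2: "k * (t * \<theta>)\<^sup>2 < pi\<^sup>2"
  proof (cases "0 \<le> k")
    case True
    then have "k * (t * \<theta>)\<^sup>2 \<le> k * \<theta>\<^sup>2"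
      using t\<theta> assms by (intro mult_left_mono power_mono) auto
    then show ?thesis using assms by linarith
  next
    case False
    then have "k * (t * \<theta>)\<^sup>2 \<le> 0" by (intro mult_nonpos_nonneg) auto
    also have "0 < pi\<^sup>2" by simp
    finally show ?thesis .
  qed
  have pos: "0 < sfun k (t * \<theta>)" "0 < sfun k \<theta>"
    using sfun_pos assms t2 by auto
  consider "\<theta> = 0 \<or> k = 0" | "0 < \<theta>" "0 < k" | "0 < \<theta>" "k < 0"
    using assms by fastforce
  then have "k * \<theta>\<^sup>2 * (1 - t\<^sup>2) / 6 \<le> ln (sfun k (t * \<theta>)) - ln (sfun k \<theta>)"
  proof cases
    case 1 then show ?thesis by (auto simp: sfun_def)
  next
    case 2
    have "(sqrt k * \<theta>)\<^sup>2 < pi\<^sup>2" using 2 assms by (simp add: power_mult_distrib)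
    then have "sqrt k * \<theta> < pi" using power2_less_imp_less pi_ge_zero by blast
    then show ?thesis
      using ln_sin_ratio_ge[of "sqrt k * (t * \<theta>)" "sqrt k * \<theta>"] 2 assms t\<theta>
      by (simp add: sfun_def power_mult_distrib algebra_simps)
  next
    case 3
    then show ?thesis
      using ln_sinh_ratio_ge[of "sqrt (-k) * (t * \<theta>)" "sqrt (-k) * \<theta>"] assms t\<theta>
      by (simp add: sfun_def power_mult_distrib algebra_simps)
  qed
  then have "k * \<theta>\<^sup>2 * (1 - t\<^sup>2) / 6 \<le> ln (sfun k (t * \<theta>) / sfun k \<theta>)"
    using pos by (simp add: ln_div)
  then show ?thesis using pos by (metis divide_pos_pos exp_le_cancel_iff exp_ln)
qed

text \<open>The error is of fourth order in sqrt |k| * \<theta>, hence of the form k^2 * \<theta>^4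
  and with the same sign for both signs of k. The condition on |k| is the range of validity of
  \<open>ln_sin_ratio_le\<close>.\<close>

lemma sfun_ratio_le:
  assumes "0 \<le> \<theta>" "\<bar>k\<bar> * \<theta>\<^sup>2 \<le> 1" "0 < t" "t \<le> 1"
  shows "sfun k (t * \<theta>) / sfun k \<theta> \<le> exp (k * \<theta>\<^sup>2 * (1 - t\<^sup>2) / 6 + k\<^sup>2 * \<theta> ^ 4 * (1 - t ^ 4) / 12)"
proof -
  have t\<theta>: "t * \<theta> \<le> \<theta>" "0 \<le> t * \<theta>" using assms by (simp_all add: mult_left_le_one_le)
  have pi1: "1 < pi\<^sup>2" using pi_ge_two by (simp add: one_less_power)
  have k1: "\<bar>k * x\<^sup>2\<bar> \<le> 1" if "0 \<le> x" "x \<le> \<theta>" for x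
  proof -
    have "\<bar>k * x\<^sup>2\<bar> \<le> \<bar>k\<bar> * \<theta>\<^sup>2"
      unfolding abs_mult using that by (intro mult_mono) (auto intro!: power_mono)
    then show ?thesis using assms by simp
  qed
  have pos: "0 < sfun k (t * \<theta>)" "0 < sfun k \<theta>"
    using sfun_pos[of "t*\<theta>" k] sfun_pos[of \<theta> k] assms t\<theta> k1[of \<theta>] k1[of "t * \<theta>"] pi1 by auto
  consider "\<theta> = 0 \<or> k = 0" | "0 < \<theta>" "0 < k" | "0 < \<theta>" "k < 0"
    using assms by fastforce
  then have "ln (sfun k (t * \<theta>)) - ln (sfun k \<theta>) \<le> k * \<theta>\<^sup>2 * (1 - t\<^sup>2) / 6 + k\<^sup>2 * \<theta> ^ 4 * (1 - t ^ 4) / 12"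
  proof cases
    case 1 then show ?thesis by (auto simp: sfun_def)
  next
    case 2
    have "(sqrt k * \<theta>)\<^sup>2 \<le> 1\<^sup>2" using 2 assms by (simp add: power_mult_distrib)
    then have "sqrt k * \<theta> \<le> 1" using power2_le_imp_le[of "sqrt k * \<theta>" 1] by simp
    moreover have "sqrt k ^ 4 = k\<^sup>2"
      using 2 power_mult[of "sqrt k" 2 2] by simp
    ultimately show ?thesis
      using ln_sin_ratio_le[of "sqrt k * (t * \<theta>)" "sqrt k * \<theta>"] 2 assms t\<theta>
      by (simp add: sfun_def power_mult_distrib algebra_simps)
  next
    case 3
    moreover have "sqrt (-k) ^ 4 = k\<^sup>2"
      using 3 power_mult[of "sqrt (-k)" 2 2] by simp
    ultimately show ?thesis
      using ln_sinh_ratio_le[of "sqrt (-k) * (t * \<theta>)" "sqrt (-k) * \<theta>"] assms t\<theta>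
      by (simp add: sfun_def power_mult_distrib algebra_simps)
  qed
  then have "ln (sfun k (t * \<theta>) / sfun k \<theta>) \<le> k * \<theta>\<^sup>2 * (1 - t\<^sup>2) / 6 + k\<^sup>2 * \<theta> ^ 4 * (1 - t ^ 4) / 12"
    using pos by (simp add: ln_div)
  then show ?thesis using pos by (metis divide_pos_pos exp_le_cancel_iff exp_ln)
qed


section \<open>The coefficients \<sigma> and \<tau> compared with one exponential\<close>

lemma sigma_coeff_zero: "1 \<le> N \<Longrightarrow> sigma_coeff K N t 0 = ennreal t"
  by (simp add: sigma_coeff_def sfun_def not_le)

lemma tau_coeff_zero:
  assumes "1 \<le> N" "0 \<le> t" shows "tau_coeff K N t 0 = ennreal t"
proof (cases "N = 1")
  case False
  then have "t powr (1/N) * t powr (1 - 1/N) = t"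
    using assms by (simp flip: powr_add)
  moreover have "sigma_coeff K (N - 1) t 0 = ennreal t"
    using False assms by (simp add: sigma_coeff_def sfun_def not_le)
  ultimately show ?thesis
    using False assms by (simp add: tau_coeff_def ennreal_powr_def flip: ennreal_mult)
qed (simp add: tau_coeff_def)

text \<open>An infinite coefficient satisfies any lower bound, so lower bounds hold at all
  distances. Only the upper bounds force small neighborhoods.\<close>

lemma sigma_coeff_ge:
  assumes "0 \<le> \<theta>" "0 < t" "t \<le> 1" "0 < N"
  shows "ennreal (t * exp (K / N * \<theta>\<^sup>2 * (1 - t\<^sup>2) / 6)) \<le> sigma_coeff K N t \<theta>"
proof (cases "K * \<theta>\<^sup>2 \<ge> N * pi\<^sup>2")
  case False
  then have "K / N * \<theta>\<^sup>2 < pi\<^sup>2" using assms by (simp add: field_simps)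
  then have "t * exp (K / N * \<theta>\<^sup>2 * (1 - t\<^sup>2) / 6) \<le> t * (sfun (K / N) (t * \<theta>) / sfun (K / N) \<theta>)"
    using sfun_ratio_ge[of \<theta> "K/N" t] assms by (intro mult_left_mono) auto
  then show ?thesis
    unfolding sigma_coeff_def if_not_P[OF False] by (rule ennreal_leI)
qed (simp add: sigma_coeff_def)

lemma sigma_coeff_le:
  assumes "0 \<le> \<theta>" "0 < t" "t \<le> 1" "0 < N" "\<bar>K / N\<bar> * \<theta>\<^sup>2 \<le> 1"
  shows "sigma_coeff K N t \<theta>
    \<le> ennreal (t * exp (K / N * \<theta>\<^sup>2 * (1 - t\<^sup>2) / 6 + (K / N)\<^sup>2 * \<theta> ^ 4 * (1 - t ^ 4) / 12))"
proof -
  have "1 < pi\<^sup>2" using pi_ge_two by (simp add: one_less_power)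
  moreover have "K / N * \<theta>\<^sup>2 \<le> \<bar>K / N\<bar> * \<theta>\<^sup>2" by (intro mult_right_mono abs_ge_self) auto
  ultimately have "K / N * \<theta>\<^sup>2 < pi\<^sup>2" using assms by linarith
  then have fin: "\<not> K * \<theta>\<^sup>2 \<ge> N * pi\<^sup>2" using assms by (simp add: field_simps)
  have "t * (sfun (K / N) (t * \<theta>) / sfun (K / N) \<theta>)
      \<le> t * exp (K / N * \<theta>\<^sup>2 * (1 - t\<^sup>2) / 6 + (K / N)\<^sup>2 * \<theta> ^ 4 * (1 - t ^ 4) / 12)"
    using sfun_ratio_le[of \<theta> "K/N" t] assms by (intro mult_left_mono) auto
  then show ?thesis
    unfolding sigma_coeff_def if_not_P[OF fin] by (rule ennreal_leI)
qed

text \<open>Enlarging \<open>K'\<close> to \<open>K\<close> absorbs the fourth order error of \<open>sigma_coeff_le\<close>.\<close>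

lemma sigma_coeff_le_exp:
  assumes "0 \<le> \<theta>" "0 < t" "t \<le> 1" "0 < N" "\<bar>K'\<bar> * \<theta>\<^sup>2 \<le> N" "K'\<^sup>2 * \<theta>\<^sup>2 \<le> N * (K - K')"
  shows "sigma_coeff K' N t \<theta> \<le> ennreal (t * exp (K / N * \<theta>\<^sup>2 * (1 - t\<^sup>2) / 6))"
proof -
  have "0 \<le> N * (K - K')" using assms(6) by (rule order_trans[rotated]) simp
  then have K: "0 \<le> K - K'" using assms by (simp add: zero_le_mult_iff)
  have "(K' / N)\<^sup>2 * \<theta>\<^sup>2 \<le> (K - K') / N"
    using assms by (simp add: power_divide field_simps power2_eq_square)
  \<comment> \<open>The error carries the factor 1 - t^4 and the gain from K' < K the factor 1 -
    t^2. Both vanish at t = 1, and this comparison makes the absorption uniform in t.\<close>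
  moreover have "1 - t ^ 4 \<le> (1 - t\<^sup>2) * 2"
  proof -
    have "1 - t ^ 4 = (1 - t\<^sup>2) * (1 + t\<^sup>2)" by (simp add: algebra_simps flip: power_add)
    also have "\<dots> \<le> (1 - t\<^sup>2) * 2"
      using assms by (intro mult_left_mono) (auto simp: power_le_one)
    finally show ?thesis .
  qed
  moreover have "0 \<le> 1 - t\<^sup>2" using assms by (simp add: power_le_one)
  ultimately have "((K' / N)\<^sup>2 * \<theta>\<^sup>2) * \<theta>\<^sup>2 * (1 - t ^ 4) \<le> ((K - K') / N) * \<theta>\<^sup>2 * ((1 - t\<^sup>2) * 2)"
    using assms K by (intro mult_mono) (auto simp: power_le_one)
  moreover have "b * x * c / 6 + b\<^sup>2 * x\<^sup>2 * d / 12 \<le> a * x * c / 6"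
    if "(b\<^sup>2 * x) * x * d \<le> (a - b) * x * (c * 2)" for a b c d x :: real
    using that by (simp add: algebra_simps power2_eq_square)
  moreover have "(\<theta>\<^sup>2)\<^sup>2 = \<theta> ^ 4" by simp
  ultimately have "K' / N * \<theta>\<^sup>2 * (1 - t\<^sup>2) / 6 + (K' / N)\<^sup>2 * \<theta> ^ 4 * (1 - t ^ 4) / 12
      \<le> K / N * \<theta>\<^sup>2 * (1 - t\<^sup>2) / 6"
    unfolding diff_divide_distrib by metis
  moreover have "\<bar>K' / N\<bar> * \<theta>\<^sup>2 \<le> 1" using assms by (simp add: field_simps)
  ultimately show ?thesis
    using assms by (intro order_trans[OF sigma_coeff_le[of \<theta> t N K']]) (auto intro!: ennreal_leI mult_left_mono)
qed

lemma ennreal_powr_mono: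
  assumes "x \<le> y" "0 \<le> a" shows "ennreal_powr x a \<le> ennreal_powr y a"
proof (cases "y = \<infinity>")
  case False
  then have "enn2real x \<le> enn2real y"
    using assms by (intro enn2real_mono) (auto simp: top.not_eq_extremum)
  then have "enn2real x powr a \<le> enn2real y powr a"
    using assms by (intro powr_mono2) auto
  then show ?thesis using False assms by (auto simp: ennreal_powr_def top.extremum_unique intro!: ennreal_leI)
qed (simp add: ennreal_powr_def)

text \<open>The reason why \<sigma> and \<tau> agree to second order: the power 1 - 1/N = (N - 1)/N
  turns the exponent c/(N - 1) into c/N, and the powers of t recombine to t.\<close>

lemma tau_coeff_exp:
  fixes t N c :: real
  assumes "0 < t" "1 < N"
  shows "ennreal (t powr (1/N)) * ennreal_powr (ennreal (t * exp (c / (N - 1)))) (1 - 1/N)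
    = ennreal (t * exp (c / N))"
proof -
  have "t powr (1/N) * (t * exp (c / (N - 1))) powr (1 - 1/N)
      = (t powr (1/N) * t powr (1 - 1/N)) * exp (c / (N - 1)) powr (1 - 1/N)"
    using assms by (simp add: powr_mult)
  also have "t powr (1/N) * t powr (1 - 1/N) = t"
    using assms by (simp flip: powr_add)
  also have "exp (c / (N - 1)) powr (1 - 1/N) = exp (c / N)"
    using assms by (simp add: powr_def field_simps)
  finally show ?thesis
    using assms by (simp add: ennreal_powr_def flip: ennreal_mult)
qed

lemma tau_coeff_ge:
  assumes "0 \<le> \<theta>" "0 < t" "t \<le> 1" "1 < N"
  shows "ennreal (t * exp (K / N * \<theta>\<^sup>2 * (1 - t\<^sup>2) / 6)) \<le> tau_coeff K N t \<theta>"
proof -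
  have "ennreal (t * exp ((K * \<theta>\<^sup>2 * (1 - t\<^sup>2) / 6) / (N - 1))) \<le> sigma_coeff K (N - 1) t \<theta>"
    using sigma_coeff_ge[of \<theta> t "N - 1" K] assms by (simp add: mult.commute)
  then have "ennreal (t powr (1/N)) * ennreal_powr (ennreal (t * exp ((K * \<theta>\<^sup>2 * (1 - t\<^sup>2) / 6) / (N - 1)))) (1 - 1/N)
      \<le> tau_coeff K N t \<theta>"
    using assms unfolding tau_coeff_def by (auto intro!: mult_left_mono ennreal_powr_mono)
  then show ?thesis
    by (subst (asm) tau_coeff_exp) (use assms in \<open>auto simp: mult.commute\<close>)
qed

lemma tau_coeff_le_exp:
  assumes "0 \<le> \<theta>" "0 < t" "t \<le> 1" "1 < N" "\<bar>K'\<bar> * \<theta>\<^sup>2 \<le> N - 1" "K'\<^sup>2 * \<theta>\<^sup>2 \<le> (N - 1) * (K - K')"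
  shows "tau_coeff K' N t \<theta> \<le> ennreal (t * exp (K / N * \<theta>\<^sup>2 * (1 - t\<^sup>2) / 6))"
proof -
  have "sigma_coeff K' (N - 1) t \<theta> \<le> ennreal (t * exp ((K * \<theta>\<^sup>2 * (1 - t\<^sup>2) / 6) / (N - 1)))"
    using sigma_coeff_le_exp[of \<theta> t "N - 1" K' K] assms by (simp add: mult.commute)
  then have "tau_coeff K' N t \<theta>
    \<le> ennreal (t powr (1/N)) * ennreal_powr (ennreal (t * exp ((K * \<theta>\<^sup>2 * (1 - t\<^sup>2) / 6) / (N - 1)))) (1 - 1/N)"
    using assms unfolding tau_coeff_def by (auto intro!: mult_left_mono ennreal_powr_mono)
  then show ?thesis
    by (subst (asm) tau_coeff_exp) (use assms in \<open>auto simp: mult.commute\<close>)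
qed

section \<open>Comparison of \<sigma> and \<tau> at small distances\<close>

lemma small_square:
  fixes a c :: real assumes "0 < c" obtains \<theta> where "0 < \<theta>" "\<And>x. 0 \<le> x \<Longrightarrow> x \<le> \<theta> \<Longrightarrow> a * x\<^sup>2 \<le> c"
proof
  show "0 < sqrt (c / (\<bar>a\<bar> + 1))" using assms by simp
  fix x assume x: "0 \<le> x" "x \<le> sqrt (c / (\<bar>a\<bar> + 1))"
  then have "x\<^sup>2 \<le> c / (\<bar>a\<bar> + 1)"
    using real_le_rsqrt[of x] assms by (metis power2_le_iff_abs_le abs_of_nonneg real_sqrt_ge_0_iff real_sqrt_pow2_iff order_trans power_mono)
  then have "(\<bar>a\<bar> + 1) * x\<^sup>2 \<le> c" by (simp add: field_simps)
  moreover have "a * x\<^sup>2 \<le> (\<bar>a\<bar> + 1) * x\<^sup>2" by (intro mult_right_mono) auto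
  ultimately show "a * x\<^sup>2 \<le> c" by linarith
qed

text \<open>The threshold is chosen before N, since the smallness conditions for N = 1 imply those
  for larger N. In this direction N = 1 is harmless: where K * \<theta>^2 > 0 the right-hand side is
  infinite, and elsewhere the exponent bounding the left-hand side is nonpositive, which gives at
  most t.\<close>

lemma sigma_coeff_le_tau_coeff:
  assumes "K' < K"
  obtains \<theta>0 where "0 < \<theta>0" "\<And>\<theta> N t. 0 \<le> \<theta> \<Longrightarrow> \<theta> \<le> \<theta>0 \<Longrightarrow> 1 \<le> N \<Longrightarrow> 0 \<le> t \<Longrightarrow> t \<le> 1 \<Longrightarrow>
    sigma_coeff K' N t \<theta> \<le> tau_coeff K N t \<theta>"
proof -
  obtain \<theta>1 where \<theta>1: "0 < \<theta>1" "\<And>x. 0 \<le> x \<Longrightarrow> x \<le> \<theta>1 \<Longrightarrow> \<bar>K'\<bar> * x\<^sup>2 \<le> 1"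
    using small_square[of 1] by auto
  obtain \<theta>2 where \<theta>2: "0 < \<theta>2" "\<And>x. 0 \<le> x \<Longrightarrow> x \<le> \<theta>2 \<Longrightarrow> K'\<^sup>2 * x\<^sup>2 \<le> K - K'"
    using small_square[of "K - K'"] assms by auto
  show ?thesis
  proof
    show "0 < min \<theta>1 \<theta>2" using \<theta>1 \<theta>2 by simp
    fix \<theta> N t :: real assume a: "0 \<le> \<theta>" "\<theta> \<le> min \<theta>1 \<theta>2" "1 \<le> N" "0 \<le> t" "t \<le> 1"
    have b: "\<bar>K'\<bar> * \<theta>\<^sup>2 \<le> 1" "K'\<^sup>2 * \<theta>\<^sup>2 \<le> K - K'" using \<theta>1(2)[of \<theta>] \<theta>2(2)[of \<theta>] a by auto
    then have b1: "\<bar>K'\<bar> * \<theta>\<^sup>2 \<le> N" using a by linarith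
    have "1 * (K - K') \<le> N * (K - K')" using a assms by (intro mult_right_mono) auto
    then have b2: "K'\<^sup>2 * \<theta>\<^sup>2 \<le> N * (K - K')" using b(2) by simp
    have "K' * \<theta>\<^sup>2 \<le> \<bar>K'\<bar> * \<theta>\<^sup>2" by (intro mult_right_mono) auto
    moreover have "N * 1 < N * pi\<^sup>2" using pi_ge_two a by (intro mult_strict_left_mono) (auto simp: one_less_power)
    ultimately have fin: "\<not> N * pi\<^sup>2 \<le> K' * \<theta>\<^sup>2" using b a by linarith
    consider "t = 0" | "0 < t" "1 < N" | "0 < t" "N = 1" using a by linarith
    then show "sigma_coeff K' N t \<theta> \<le> tau_coeff K N t \<theta>"
    proof cases
      case 1 with fin show ?thesis by (simp add: sigma_coeff_def)
    next
      case 2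
      then show ?thesis using sigma_coeff_le_exp[OF a(1) _ a(5) _ b1 b2] tau_coeff_ge[OF a(1) _ a(5), of N K]
        by (auto intro: order_trans)
    next
      case 3
      have "sigma_coeff K' 1 t \<theta> \<le> ennreal t" if "K * \<theta>\<^sup>2 \<le> 0"
      proof -
        have "sigma_coeff K' 1 t \<theta> \<le> ennreal (t * exp (K / 1 * \<theta>\<^sup>2 * (1 - t\<^sup>2) / 6))"
          using sigma_coeff_le_exp[of \<theta> t 1 K' K] a b 3 by auto
        also have "K / 1 * \<theta>\<^sup>2 * (1 - t\<^sup>2) \<le> 0"
          unfolding div_by_1 by (rule mult_nonpos_nonneg[OF that]) (use a in \<open>simp add: power_le_one\<close>)
        then have "t * exp (K / 1 * \<theta>\<^sup>2 * (1 - t\<^sup>2) / 6) \<le> t * 1"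
          using a by (intro mult_left_mono) auto
        finally show ?thesis by (simp add: ennreal_leI)
      qed
      then show ?thesis using 3 by (simp add: tau_coeff_def)
    qed
  qed
qed

lemma tau_coeff_le_sigma_coeff:
  assumes "K' < K" "1 < N0"
  obtains \<theta>0 where "0 < \<theta>0" "\<And>\<theta> N t. 0 \<le> \<theta> \<Longrightarrow> \<theta> \<le> \<theta>0 \<Longrightarrow> N0 \<le> N \<Longrightarrow> 0 \<le> t \<Longrightarrow> t \<le> 1 \<Longrightarrow>
    tau_coeff K' N t \<theta> \<le> sigma_coeff K N t \<theta>"
proof -
  obtain \<theta>1 where \<theta>1: "0 < \<theta>1" "\<And>x. 0 \<le> x \<Longrightarrow> x \<le> \<theta>1 \<Longrightarrow> \<bar>K'\<bar> * x\<^sup>2 \<le> N0 - 1"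
    using small_square[of "N0 - 1"] assms by auto
  obtain \<theta>2 where \<theta>2: "0 < \<theta>2" "\<And>x. 0 \<le> x \<Longrightarrow> x \<le> \<theta>2 \<Longrightarrow> K'\<^sup>2 * x\<^sup>2 \<le> (N0 - 1) * (K - K')"
    using small_square[of "(N0 - 1) * (K - K')"] assms by auto
  show ?thesis
  proof
    show "0 < min \<theta>1 \<theta>2" using \<theta>1 \<theta>2 by simp
    fix \<theta> N t :: real assume a: "0 \<le> \<theta>" "\<theta> \<le> min \<theta>1 \<theta>2" "N0 \<le> N" "0 \<le> t" "t \<le> 1"
    have b: "\<bar>K'\<bar> * \<theta>\<^sup>2 \<le> N0 - 1" "K'\<^sup>2 * \<theta>\<^sup>2 \<le> (N0 - 1) * (K - K')"
      using \<theta>1(2)[of \<theta>] \<theta>2(2)[of \<theta>] a by auto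
    then have b1: "\<bar>K'\<bar> * \<theta>\<^sup>2 \<le> N - 1" using a by linarith
    have "(N0 - 1) * (K - K') \<le> (N - 1) * (K - K')" using a assms by (intro mult_right_mono) auto
    then have b2: "K'\<^sup>2 * \<theta>\<^sup>2 \<le> (N - 1) * (K - K')" using b by linarith
    show "tau_coeff K' N t \<theta> \<le> sigma_coeff K N t \<theta>"
    proof (cases "t = 0")
      case True
      then show ?thesis using a assms by (simp add: tau_coeff_def)
    next
      case False
      then show ?thesis using tau_coeff_le_exp[OF a(1) _ a(5) _ b1 b2] sigma_coeff_ge[OF a(1) _ a(5), of N K] a assms
        by (auto intro: order_trans)
    qed
  qed
qed

text \<open>Monotonicity of sinh x / x, hence at all distances. Transport on a segment achieves the
  linear coefficient t; this converts it into the condition with \<tau> for every K <= 0.\<close>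

lemma tau_coeff_le_nonpos:
  assumes "K \<le> 0" "1 \<le> N" "0 \<le> t" "t \<le> 1" "0 \<le> \<theta>"
  shows "tau_coeff K N t \<theta> \<le> ennreal t"
proof -
  have K: "K * \<theta>\<^sup>2 \<le> 0" using assms by (intro mult_nonpos_nonneg) auto
  consider "N = 1" | "1 < N" "t = 0" | "1 < N" "0 < t" using assms by linarith
  then show ?thesis
  proof cases
    case 1 then show ?thesis using K by (simp add: tau_coeff_def)
  next
    case 2 then show ?thesis by (simp add: tau_coeff_def)
  next
    case 3
    have t\<theta>: "t * \<theta> \<le> \<theta>" "0 \<le> t * \<theta>" using assms by (simp_all add: mult_left_le_one_le)
    let ?k = "K / (N - 1)"
    have k: "?k \<le> 0" using 3 assms by (simp add: divide_nonpos_nonneg)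
    have "sfun ?k (t * \<theta>) / sfun ?k \<theta> \<le> 1"
    proof (cases "\<theta> = 0 \<or> ?k = 0")
      case True then show ?thesis by (auto simp: sfun_def)
    next
      case False
      let ?x = "sqrt (- ?k) * \<theta>"
      have x: "0 < ?x" using False k assms by (simp add: less_le del: divide_eq_0_iff)
      have "sinh (t * ?x) / (t * ?x) \<le> sinh ?x / ?x"
      proof (rule DERIV_nonneg_imp_nondecreasing[where f = "\<lambda>x. sinh x / x"])
        show "t * ?x \<le> ?x" using x assms by (simp add: mult_left_le_one_le)
        fix y assume y: "t * ?x \<le> y" "y \<le> ?x"
        have "0 < t * ?x" by (rule mult_pos_pos) (use x 3 in blast)+
        then have y0: "0 < y" using y by linarith
        then have "((\<lambda>x. sinh x / x) has_real_derivative (y * cosh y - sinh y) / y\<^sup>2) (at y)"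
          by (auto intro!: derivative_eq_intros simp: power2_eq_square mult.commute)
        moreover have "0 \<le> (y * cosh y - sinh y) / y\<^sup>2"
          using mult_cosh_minus_sinh_nonneg[of y] y0 by simp
        ultimately show "\<exists>d. ((\<lambda>x. sinh x / x) has_real_derivative d) (at y) \<and> 0 \<le> d" by blast
      qed
      moreover have "0 < sinh ?x / ?x" using sinh_real_pos_iff[of ?x] x by (intro divide_pos_pos) blast+
      moreover have "sfun ?k \<theta> = sinh ?x / ?x" "sfun ?k (t * \<theta>) = sinh (t * ?x) / (t * ?x)"
        using False k 3 by (simp_all add: sfun_def algebra_simps)
      ultimately show ?thesis by (metis divide_le_eq_1_pos)
    qed
    then have "t * (sfun ?k (t * \<theta>) / sfun ?k \<theta>) \<le> t * 1"
      using assms by (intro mult_left_mono) auto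
    moreover have "\<not> (N - 1) * pi\<^sup>2 \<le> K * \<theta>\<^sup>2"
    proof -
      have "0 < (N - 1) * pi\<^sup>2" using 3 by simp
      then show ?thesis using K by linarith
    qed
    \<comment> \<open>Writing t as t * exp 0 makes \<open>tau_coeff_exp\<close> applicable with c =
      0.\<close>
    ultimately have "sigma_coeff K (N - 1) t \<theta> \<le> ennreal (t * exp (0 / (N - 1)))"
      by (simp add: sigma_coeff_def ennreal_leI)
    then have "tau_coeff K N t \<theta> \<le> ennreal (t powr (1/N)) * ennreal_powr (ennreal (t * exp (0 / (N - 1)))) (1 - 1/N)"
      using 3 unfolding tau_coeff_def by (auto intro!: mult_left_mono ennreal_powr_mono)
    also have "\<dots> = ennreal (t * exp (0 / N))" using 3 by (intro tau_coeff_exp) auto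
    finally show ?thesis by simp
  qed
qed


section \<open>Supports, couplings and monotonicity of the condition\<close>

lemma emeasure_Union_open_zero:
  fixes M :: "'a::second_countable_topology measure"
  assumes "sets M = sets borel" "\<And>U. U \<in> \<U> \<Longrightarrow> open U" "\<And>U. U \<in> \<U> \<Longrightarrow> emeasure M U = 0"
  shows "emeasure M (\<Union>\<U>) = 0"
proof -
  obtain \<V> where \<V>: "\<V> \<subseteq> \<U>" "countable \<V>" "\<Union>\<V> = \<Union>\<U>"
    using Lindelof[of \<U>] assms by metis
  have "(\<Union>V\<in>\<V>. V) \<in> null_sets M"
    using \<V> assms by (intro null_sets_UN') (auto intro!: null_setsI)
  then show ?thesis using \<V> by auto
qed

lemma Compl_msupport:
  fixes \<nu> :: "'a::polish_space measure"
  assumes "sets \<nu> = sets borel"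
  shows "- msupport \<nu> = \<Union>{U. open U \<and> emeasure \<nu> U = 0}"
proof safe
  fix x assume "x \<notin> msupport \<nu>"
  then obtain r where "0 < r" "emeasure \<nu> (ball x r) = 0"
    by (auto simp: msupport_def not_less zero_less_iff_neq_zero)
  then show "x \<in> \<Union>{U. open U \<and> emeasure \<nu> U = 0}"
    by (intro UnionI[of "ball x r"]) auto
next
  fix x U assume U: "x \<in> U" "open U" "emeasure \<nu> U = 0" "x \<in> msupport \<nu>"
  then obtain r where r: "0 < r" "ball x r \<subseteq> U" by (auto simp: open_contains_ball)
  then have "emeasure \<nu> (ball x r) \<le> emeasure \<nu> U"
    using assms U by (intro emeasure_mono) auto
  then show False using U r by (auto simp: msupport_def)
qed

lemma closed_msupport:
  assumes "sets \<nu> = sets borel" shows "closed (msupport \<nu>)"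
  unfolding closed_def Compl_msupport[OF assms] by auto

lemma AE_msupport:
  assumes "sets \<nu> = sets borel" shows "AE x in \<nu>. x \<in> msupport \<nu>"
proof (rule AE_I')
  have "emeasure \<nu> (- msupport \<nu>) = 0"
    unfolding Compl_msupport[OF assms] by (rule emeasure_Union_open_zero[OF assms]) auto
  moreover have "- msupport \<nu> \<in> sets \<nu>"
    unfolding assms using closed_msupport[OF assms] by (intro borel_open) (simp add: open_Compl)
  ultimately show "- msupport \<nu> \<in> null_sets \<nu>" by (rule null_setsI)
qed auto

lemma msupport_subset_closed:
  fixes \<nu> :: "'a::polish_space measure"
  assumes "sets \<nu> = sets borel" "closed C" "emeasure \<nu> (- C) = 0"
  shows "msupport \<nu> \<subseteq> C"
proof -
  have "- C \<subseteq> \<Union>{U. open U \<and> emeasure \<nu> U = 0}"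
    using assms by (intro Union_upper) (simp add: open_Compl)
  then show ?thesis using Compl_msupport[OF assms(1)] by blast
qed

text \<open>All measures in \<open>Pinf m\<close> live on the support of m. Hence the shape of
  \<open>msupport m\<close> near a point controls every admissible pair of measures there.\<close>

lemma msupport_absolutely_continuous:
  fixes \<nu> :: "'a::polish_space measure"
  assumes "sets m = sets borel" "sets \<nu> = sets borel" "absolutely_continuous m \<nu>"
  shows "msupport \<nu> \<subseteq> msupport m"
proof (rule msupport_subset_closed)
  have "- msupport m \<in> null_sets m"
    using AE_msupport[OF assms(1)] assms closed_msupport[OF assms(1)]
    by (auto simp: AE_iff_null_sets open_Compl)
  then show "emeasure \<nu> (- msupport m) = 0"
    using assms by (auto simp: absolutely_continuous_def)
qed (use assms closed_msupport in auto)

lemma metric_measure_space_sets: "metric_measure_space m \<Longrightarrow> sets m = sets borel"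
  by (simp add: metric_measure_space_def)

lemma metric_measure_space_finite_ball:
  assumes "metric_measure_space m" "0 < e"
  obtains r where "0 < r" "r < e" "emeasure m (ball x r) < \<infinity>"
proof -
  obtain r0 where r0: "0 < r0" "\<And>r. 0 < r \<Longrightarrow> r < r0 \<Longrightarrow> emeasure m (ball x r) < \<infinity>"
    using assms(1) unfolding metric_measure_space_def by blast
  have "0 < min r0 e / 2" "min r0 e / 2 < r0" "min r0 e / 2 < e" using r0 assms by auto
  then show ?thesis using that r0 by blast
qed

lemma metric_measure_space_sigma_finite:
  fixes m :: "'a::polish_space measure"
  assumes "metric_measure_space m"
  shows "sigma_finite_measure m"
proof
  let ?\<U> = "{U. open U \<and> emeasure m U < \<infinity>}"
  obtain \<V> where \<V>: "\<V> \<subseteq> ?\<U>" "countable \<V>" "\<Union>\<V> = \<Union>?\<U>"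
    using Lindelof[of ?\<U>] by auto
  have "x \<in> \<Union>?\<U>" for x
  proof -
    obtain r where "0 < r" "emeasure m (ball x r) < \<infinity>"
      using metric_measure_space_finite_ball[OF assms, of 1] by auto
    then show ?thesis by (intro UnionI[of "ball x r"]) auto
  qed
  then have "\<Union>\<V> = space m"
    using \<V> metric_measure_space_sets[OF assms] by (auto simp: sets_eq_imp_space_eq)
  moreover have "\<V> \<subseteq> sets m" using \<V> metric_measure_space_sets[OF assms] by auto
  ultimately show "\<exists>A. countable A \<and> A \<subseteq> sets m \<and> \<Union>A = space m \<and> (\<forall>a\<in>A. emeasure m a \<noteq> \<infinity>)"
    using \<V>(1,2) by (intro exI[of _ \<V>]) (blast dest: less_imp_neq)
qed

section \<open>Couplings and the condition for one pair of measures\<close>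

lemma couplings_sets: "q \<in> couplings \<mu> \<nu> \<Longrightarrow> sets q = sets borel"
  by (simp add: couplings_def)

lemma couplings_measurable:
  fixes q :: "('a::polish_space \<times> 'a) measure"
  assumes "q \<in> couplings \<mu> \<nu>" "f \<in> borel_measurable borel"
  shows "f \<in> borel_measurable q"
  using assms measurable_cong_sets[OF couplings_sets[OF assms(1)] refl] by blast

lemma fst_snd_borel_measurable [measurable]:
  "(fst :: 'a::second_countable_topology \<times> 'b::second_countable_topology \<Rightarrow> 'a) \<in> borel_measurable borel"
  "(snd :: 'a::second_countable_topology \<times> 'b::second_countable_topology \<Rightarrow> 'b) \<in> borel_measurable borel"
  by (auto intro!: borel_measurable_continuous_onI continuous_intros)

lemma couplings_AE:
  assumes q: "q \<in> couplings \<mu> \<nu>"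
  shows "AE x in \<mu>. P x \<Longrightarrow> AE p in q. P (fst p)" "AE y in \<nu>. Q y \<Longrightarrow> AE p in q. Q (snd p)"
proof -
  have "fst \<in> borel_measurable q" "snd \<in> borel_measurable q"
    by (intro couplings_measurable[OF q] fst_snd_borel_measurable)+
  moreover have "\<mu> = distr q borel fst" "\<nu> = distr q borel snd" using q by (auto simp: couplings_def)
  ultimately show "AE x in \<mu>. P x \<Longrightarrow> AE p in q. P (fst p)" "AE y in \<nu>. Q y \<Longrightarrow> AE p in q. Q (snd p)"
    using AE_distrD[of fst q borel P] AE_distrD[of snd q borel Q] by blast+
qed

lemma Pinf_sets: "\<nu> \<in> Pinf m \<Longrightarrow> sets \<nu> = sets borel"
  by (simp add: Pinf_def P2_def)

lemma Pinf_prob_space: "\<nu> \<in> Pinf m \<Longrightarrow> prob_space \<nu>"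
  by (simp add: Pinf_def P2_def)

text \<open>The condition for a single pair of marginals. With \<beta> left free it also covers the
  linear coefficient \<open>ennreal t\<close>, which is not a distortion coefficient of the
  definitions.\<close>

definition CD_pair where
  "CD_pair \<beta> m K N \<nu>0 \<nu>1 \<longleftrightarrow>
     (\<exists>q \<Gamma>. optimal_coupling \<nu>0 \<nu>1 q \<and> Pinf_geodesic m \<Gamma> \<and> \<Gamma> 0 = \<nu>0 \<and> \<Gamma> 1 = \<nu>1 \<and>
        (\<forall>t\<in>{0..1}. \<forall>N'\<ge>N.
           renyi_entropy N' (\<Gamma> t) m \<le>
             - enn2ereal (\<integral>\<^sup>+ (x0, x1).
                  (\<beta> K N' (1 - t) (dist x0 x1) * ennreal (dens m \<nu>0 x0 powr (- 1/N'))
                   + \<beta> K N' t (dist x0 x1) * ennreal (dens m \<nu>1 x1 powr (- 1/N'))) \<partial>q)))"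

lemma CD_loc_with_iff:
  "CD_loc_with \<beta> m K N \<longleftrightarrow> (\<forall>x. \<exists>U. x \<in> interior U \<and>
     (\<forall>\<nu>0 \<in> Pinf m. \<forall>\<nu>1 \<in> Pinf m. msupport \<nu>0 \<subseteq> U \<and> msupport \<nu>1 \<subseteq> U \<longrightarrow> CD_pair \<beta> m K N \<nu>0 \<nu>1))"
  unfolding CD_loc_with_def CD_pair_def ..

lemma CD_loc_withD:
  assumes "CD_loc_with \<beta> m K N"
  obtains r where "0 < r" "\<And>\<nu>0 \<nu>1. \<nu>0 \<in> Pinf m \<Longrightarrow> \<nu>1 \<in> Pinf m \<Longrightarrow>
    msupport \<nu>0 \<subseteq> ball x r \<Longrightarrow> msupport \<nu>1 \<subseteq> ball x r \<Longrightarrow> CD_pair \<beta> m K N \<nu>0 \<nu>1"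
proof -
  obtain U where U: "x \<in> interior U" "\<forall>\<nu>0 \<in> Pinf m. \<forall>\<nu>1 \<in> Pinf m. msupport \<nu>0 \<subseteq> U \<and> msupport \<nu>1 \<subseteq> U \<longrightarrow> CD_pair \<beta> m K N \<nu>0 \<nu>1"
    using assms unfolding CD_loc_with_iff by blast
  obtain r where "0 < r" "ball x r \<subseteq> U" using U(1) by (auto simp: mem_interior)
  then show ?thesis using U(2) by (intro that[of r]) blast+
qed

lemma CD_loc_withI:
  assumes "\<And>x. \<exists>r>0. \<forall>\<nu>0 \<in> Pinf m. \<forall>\<nu>1 \<in> Pinf m. msupport \<nu>0 \<subseteq> ball x r \<longrightarrow> msupport \<nu>1 \<subseteq> ball x r \<longrightarrow>
    CD_pair \<beta> m K N \<nu>0 \<nu>1"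
  shows "CD_loc_with \<beta> m K N"
  unfolding CD_loc_with_iff
proof
  fix x
  obtain r where "0 < r" "\<forall>\<nu>0 \<in> Pinf m. \<forall>\<nu>1 \<in> Pinf m. msupport \<nu>0 \<subseteq> ball x r \<longrightarrow> msupport \<nu>1 \<subseteq> ball x r \<longrightarrow>
    CD_pair \<beta> m K N \<nu>0 \<nu>1" using assms by blast
  then show "\<exists>U. x \<in> interior U \<and> (\<forall>\<nu>0 \<in> Pinf m. \<forall>\<nu>1 \<in> Pinf m. msupport \<nu>0 \<subseteq> U \<and> msupport \<nu>1 \<subseteq> U \<longrightarrow>
      CD_pair \<beta> m K N \<nu>0 \<nu>1)"
    by (intro exI[of _ "ball x r"]) (auto simp: interior_open)
qed

text \<open>Smaller coefficients only enlarge the upper bound on the entropy, so the same coupling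
  and the same geodesic serve. Distances between points of the two supports are enough, because q is
  concentrated on their product.\<close>

lemma CD_pair_mono:
  assumes "\<nu>0 \<in> Pinf m" "\<nu>1 \<in> Pinf m" "CD_pair \<beta> m K N \<nu>0 \<nu>1"
    and "\<And>x0 x1 t N'. x0 \<in> msupport \<nu>0 \<Longrightarrow> x1 \<in> msupport \<nu>1 \<Longrightarrow> 0 \<le> t \<Longrightarrow> t \<le> 1 \<Longrightarrow> N \<le> N' \<Longrightarrow>
      \<beta>' K' N' t (dist x0 x1) \<le> \<beta> K N' t (dist x0 x1)"
  shows "CD_pair \<beta>' m K' N \<nu>0 \<nu>1"
proof -
  obtain q \<Gamma> where q\<Gamma>: "optimal_coupling \<nu>0 \<nu>1 q" "Pinf_geodesic m \<Gamma>" "\<Gamma> 0 = \<nu>0" "\<Gamma> 1 = \<nu>1"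
    and le: "\<And>t N'. t \<in> {0..1} \<Longrightarrow> N \<le> N' \<Longrightarrow> renyi_entropy N' (\<Gamma> t) m \<le>
             - enn2ereal (\<integral>\<^sup>+ (x0, x1).
                  (\<beta> K N' (1 - t) (dist x0 x1) * ennreal (dens m \<nu>0 x0 powr (- 1/N'))
                   + \<beta> K N' t (dist x0 x1) * ennreal (dens m \<nu>1 x1 powr (- 1/N'))) \<partial>q)"
    using assms(3) unfolding CD_pair_def by blast
  have q: "q \<in> couplings \<nu>0 \<nu>1" using q\<Gamma> by (simp add: optimal_coupling_def)
  show ?thesis
    unfolding CD_pair_def
  proof (intro exI conjI ballI allI impI)
    fix t :: real and N' assume t: "t \<in> {0..1}" "N \<le> N'"
    have "(\<integral>\<^sup>+ (x0, x1). (\<beta>' K' N' (1 - t) (dist x0 x1) * ennreal (dens m \<nu>0 x0 powr (- 1/N'))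
                   + \<beta>' K' N' t (dist x0 x1) * ennreal (dens m \<nu>1 x1 powr (- 1/N'))) \<partial>q)
      \<le> (\<integral>\<^sup>+ (x0, x1). (\<beta> K N' (1 - t) (dist x0 x1) * ennreal (dens m \<nu>0 x0 powr (- 1/N'))
                   + \<beta> K N' t (dist x0 x1) * ennreal (dens m \<nu>1 x1 powr (- 1/N'))) \<partial>q)"
    proof (rule nn_integral_mono_AE)
      have "AE p in q. fst p \<in> msupport \<nu>0" "AE p in q. snd p \<in> msupport \<nu>1"
        using couplings_AE[OF q] AE_msupport[OF Pinf_sets] assms(1,2) by blast+
      then show "AE p in q. (case p of (x0, x1) \<Rightarrow> \<beta>' K' N' (1 - t) (dist x0 x1) * ennreal (dens m \<nu>0 x0 powr (- 1/N'))
                   + \<beta>' K' N' t (dist x0 x1) * ennreal (dens m \<nu>1 x1 powr (- 1/N')))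
         \<le> (case p of (x0, x1) \<Rightarrow> \<beta> K N' (1 - t) (dist x0 x1) * ennreal (dens m \<nu>0 x0 powr (- 1/N'))
                   + \<beta> K N' t (dist x0 x1) * ennreal (dens m \<nu>1 x1 powr (- 1/N')))"
        by eventually_elim (use t assms(4) in \<open>auto intro!: add_mono mult_right_mono\<close>)
    qed
    then show "renyi_entropy N' (\<Gamma> t) m \<le>
             - enn2ereal (\<integral>\<^sup>+ (x0, x1).
                  (\<beta>' K' N' (1 - t) (dist x0 x1) * ennreal (dens m \<nu>0 x0 powr (- 1/N'))
                   + \<beta>' K' N' t (dist x0 x1) * ennreal (dens m \<nu>1 x1 powr (- 1/N'))) \<partial>q)"
      by (intro order_trans[OF le[OF t]]) (simp add: less_eq_ennreal.rep_eq)
  qed (use q\<Gamma> in auto)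
qed

lemma CD_loc_with_mono:
  fixes m :: "'a::polish_space measure"
  assumes "CD_loc_with \<beta> m K N" "0 < \<theta>0"
    and "\<And>N' t \<theta>. N \<le> N' \<Longrightarrow> 0 \<le> t \<Longrightarrow> t \<le> 1 \<Longrightarrow> 0 \<le> \<theta> \<Longrightarrow> \<theta> \<le> \<theta>0 \<Longrightarrow> \<beta>' K' N' t \<theta> \<le> \<beta> K N' t \<theta>"
  shows "CD_loc_with \<beta>' m K' N"
proof (rule CD_loc_withI)
  fix x :: 'a
  obtain r where r: "0 < r" "\<And>\<nu>0 \<nu>1. \<nu>0 \<in> Pinf m \<Longrightarrow> \<nu>1 \<in> Pinf m \<Longrightarrow>
    msupport \<nu>0 \<subseteq> ball x r \<Longrightarrow> msupport \<nu>1 \<subseteq> ball x r \<Longrightarrow> CD_pair \<beta> m K N \<nu>0 \<nu>1"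
    using CD_loc_withD[OF assms(1)] by blast
  let ?r = "min r (\<theta>0 / 2)"
  have d: "dist y z \<le> \<theta>0" if "y \<in> ball x ?r" "z \<in> ball x ?r" for y z
    using dist_triangle[of y z x] that by (simp add: dist_commute)
  show "\<exists>r>0. \<forall>\<nu>0 \<in> Pinf m. \<forall>\<nu>1 \<in> Pinf m. msupport \<nu>0 \<subseteq> ball x r \<longrightarrow> msupport \<nu>1 \<subseteq> ball x r \<longrightarrow>
    CD_pair \<beta>' m K' N \<nu>0 \<nu>1"
  proof (intro exI[of _ ?r] conjI ballI impI)
    fix \<nu>0 \<nu>1 assume a: "\<nu>0 \<in> Pinf m" "\<nu>1 \<in> Pinf m" "msupport \<nu>0 \<subseteq> ball x ?r" "msupport \<nu>1 \<subseteq> ball x ?r"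
    have "ball x ?r \<subseteq> ball x r" by (intro subset_ball) simp
    then have "CD_pair \<beta> m K N \<nu>0 \<nu>1"
      using a by (intro r(2)) blast+
    then show "CD_pair \<beta>' m K' N \<nu>0 \<nu>1"
    proof (rule CD_pair_mono[OF a(1,2)])
      fix x0 x1 :: 'a and t N' :: real
      assume b: "x0 \<in> msupport \<nu>0" "x1 \<in> msupport \<nu>1" "0 \<le> t" "t \<le> 1" "N \<le> N'"
      have "dist x0 x1 \<le> \<theta>0" using d a(3,4) b(1,2) by blast
      then show "\<beta>' K' N' t (dist x0 x1) \<le> \<beta> K N' t (dist x0 x1)"
        using assms(3)[OF b(5,3,4) zero_le_dist] by blast
    qed
  qed (use r assms in auto)
qed


section \<open>Gluing and concentration of Wasserstein geodesics\<close>

text \<open>Cut the space into countably many cells of diameter less than e and make the two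
  couplings conditionally independent given the cell of the middle point: the product measure
  receives the density 1/\<nu>(cell) where both middle points share a cell, and 0 elsewhere. The
  marginals q1 and q2 come out exactly; only the middle points are identified up to e. No
  disintegration enters.\<close>

lemma approximate_gluing:
  fixes \<mu> \<nu> \<omega> :: "'a::polish_space measure"
  assumes \<nu>: "prob_space \<nu>" and q1: "q1 \<in> couplings \<mu> \<nu>" and q2: "q2 \<in> couplings \<nu> \<omega>" and "0 < e"
  obtains Q :: "(('a \<times> 'a) \<times> ('a \<times> 'a)) measure" where
    "sets Q = sets borel" "distr Q borel fst = q1" "distr Q borel snd = q2"
    "AE p in Q. dist (snd (fst p)) (fst (snd p)) < e"
proof -
  obtain D :: "'a set" where D: "countable D" "\<And>X. open X \<Longrightarrow> X \<noteq> {} \<Longrightarrow> \<exists>d\<in>D. d \<in> X"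
    using countable_dense_exists by blast
  then have "D \<noteq> {}" using D(2)[of UNIV] by auto
  define d where "d = from_nat_into D"
  have ex: "\<exists>n. dist (d n) z < e/2" for z
  proof -
    obtain y where "y \<in> D" "y \<in> ball z (e/2)" using D(2)[of "ball z (e/2)"] \<open>0 < e\<close> by auto
    then show ?thesis
      using from_nat_into_surj[OF D(1), of y] by (auto simp: d_def dist_commute)
  qed
  define idx where "idx z = (LEAST n. dist (d n) z < e/2)" for z
  have [measurable]: "idx \<in> borel \<rightarrow>\<^sub>M count_space UNIV"
    unfolding idx_def by measurable
  have close: "dist z z' < e" if "idx z = idx z'" for z z'
  proof -
    have "dist (d (idx z)) z < e/2" "dist (d (idx z)) z' < e/2"
      using LeastI_ex[OF ex, of z] LeastI_ex[OF ex, of z'] that unfolding idx_def by auto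
    then show ?thesis using dist_triangle_half_r[of "d (idx z)" z e z'] by simp
  qed
  define c where "c n = emeasure \<nu> {z. idx z = n}" for n
  have s1: "sets q1 = sets borel" and s2: "sets q2 = sets borel"
    using q1 q2 by (auto simp: couplings_def)
  have fs: "fst \<in> borel_measurable q2" "snd \<in> borel_measurable q1"
    by (rule couplings_measurable[OF q2] couplings_measurable[OF q1]; measurable)+
  have d1: "distr q1 borel snd = \<nu>" and d2: "distr q2 borel fst = \<nu>"
    using q1 q2 by (auto simp: couplings_def)
  have sn: "sets \<nu> = sets borel" using d1 by auto
  have p1: "prob_space q1" and p2: "prob_space q2"
    using prob_space_distrD[OF fs(2)] prob_space_distrD[OF fs(1)] d1 d2 \<nu> by auto
  interpret q1: prob_space q1 by fact
  interpret q2: prob_space q2 by fact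
  interpret \<nu>: prob_space \<nu> by fact
  interpret P: pair_sigma_finite q1 q2 ..
  have sp: "sets (q1 \<Otimes>\<^sub>M q2) = sets (borel :: (('a \<times> 'a) \<times> ('a \<times> 'a)) measure)"
    using sets_pair_measure_cong[OF s1 s2] unfolding borel_prod .
  have [measurable_cong]: "sets q1 = sets borel" "sets q2 = sets borel" "sets \<nu> = sets borel"
    by (fact s1 s2 sn)+
  define f :: "('a \<times> 'a) \<times> ('a \<times> 'a) \<Rightarrow> ennreal"
    where "f p = indicator {n. n = idx (fst (snd p))} (idx (snd (fst p))) / c (idx (snd (fst p)))" for p
  have f_eq: "f p = (if idx (snd (fst p)) = idx (fst (snd p)) then 1 else 0) / c (idx (snd (fst p)))" for p
    by (auto simp: f_def indicator_def)
  have [measurable]: "(\<lambda>z. c (idx z)) \<in> borel_measurable borel"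
    by (rule measurable_compose[of idx borel "count_space UNIV"]) auto
  have "Measurable.pred (q1 \<Otimes>\<^sub>M q2) (\<lambda>p. \<exists>n. idx (snd (fst p)) = n \<and> idx (fst (snd p)) = n)"
    by measurable
  then have [measurable]: "Measurable.pred (q1 \<Otimes>\<^sub>M q2) (\<lambda>p. idx (snd (fst p)) = idx (fst (snd p)))"
    by (simp add: eq_commute)
  have [measurable]: "f \<in> borel_measurable (q1 \<Otimes>\<^sub>M q2)"
    unfolding f_eq[abs_def] by measurable
  define Q where "Q = density (q1 \<Otimes>\<^sub>M q2) f"
  have sQ: "sets Q = sets borel" by (simp add: Q_def sp)
  \<comment> \<open>Cells of measure 0 would make the density divide by 0. There are only countably
    many cells, so together these are negligible.\<close>
  have pos: "AE z in \<nu>. c (idx z) \<noteq> 0"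
  proof -
    have "(\<Union>n\<in>{n. c n = 0}. {z. idx z = n}) \<in> null_sets \<nu>"
      by (intro null_sets_UN') (auto intro!: null_setsI simp: c_def)
    then show ?thesis by (rule AE_I') auto
  qed
  have cfin: "c n \<noteq> \<infinity>" for n by (simp add: c_def \<nu>.emeasure_eq_measure)
  have cq1: "emeasure q1 {p. idx (snd p) = n} = c n" for n
    unfolding c_def d1[symmetric] by (subst emeasure_distr) (auto simp: s1 sets_eq_imp_space_eq[OF s1] intro!: arg_cong[where f = "emeasure q1"])
  have cq2: "emeasure q2 {p. idx (fst p) = n} = c n" for n
    unfolding c_def d2[symmetric] by (subst emeasure_distr) (auto simp: s2 sets_eq_imp_space_eq[OF s2] intro!: arg_cong[where f = "emeasure q2"])
  have pos1: "AE p in q1. c (idx (snd p)) \<noteq> 0" using couplings_AE(2)[OF q1 pos] .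
  have pos2: "AE p in q2. c (idx (fst p)) \<noteq> 0" using couplings_AE(1)[OF q2 pos] .
  have i1: "AE p in q1. (\<integral>\<^sup>+ p'. f (p, p') \<partial>q2) = 1"
    using pos1
  proof eventually_elim
    case (elim p)
    have "(\<integral>\<^sup>+ p'. f (p, p') \<partial>q2) = (\<integral>\<^sup>+ p'. indicator {p'. idx (fst p') = idx (snd p)} p' / c (idx (snd p)) \<partial>q2)"
      by (intro nn_integral_cong) (auto simp: f_eq indicator_def)
    also have "\<dots> = c (idx (snd p)) / c (idx (snd p))"
      by (subst nn_integral_divide) (auto simp: cq2)
    also have "\<dots> = 1" using elim cfin by (simp add: ennreal_divide_self top.not_eq_extremum)
    finally show ?case .
  qed
  have i2: "AE p' in q2. (\<integral>\<^sup>+ p. f (p, p') \<partial>q1) = 1"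
    using pos2
  proof eventually_elim
    case (elim p)
    have "(\<integral>\<^sup>+ p'. f (p', p) \<partial>q1) = (\<integral>\<^sup>+ p'. indicator {p'. idx (snd p') = idx (fst p)} p' / c (idx (fst p)) \<partial>q1)"
      by (intro nn_integral_cong) (auto simp: f_eq indicator_def)
    also have "\<dots> = c (idx (fst p)) / c (idx (fst p))"
      by (subst nn_integral_divide) (auto simp: cq1)
    also have "\<dots> = 1" using elim cfin by (simp add: ennreal_divide_self top.not_eq_extremum)
    finally show ?case .
  qed
  have [measurable]: "fst \<in> Q \<rightarrow>\<^sub>M borel" "snd \<in> Q \<rightarrow>\<^sub>M borel"
    by (auto simp: measurable_cong_sets[OF sQ refl])
  show ?thesis
  proof
    show "sets Q = sets borel" by fact
    show "distr Q borel fst = q1"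
    proof (rule measure_eqI)
      fix A assume "A \<in> sets (distr Q borel fst)"
      then have A[measurable]: "A \<in> sets borel" by simp
      have "emeasure (distr Q borel fst) A = emeasure Q (fst -` A \<inter> space Q)"
        by (simp add: emeasure_distr)
      also have "\<dots> = (\<integral>\<^sup>+ p. f p * indicator A (fst p) \<partial>(q1 \<Otimes>\<^sub>M q2))"
        unfolding Q_def
        by (subst emeasure_density) (auto intro!: nn_integral_cong simp: indicator_def space_pair_measure split: if_splits)
      also have "\<dots> = (\<integral>\<^sup>+ p. \<integral>\<^sup>+ p'. f (p, p') * indicator A p \<partial>q2 \<partial>q1)"
        by (subst q2.nn_integral_fst[symmetric]) (auto)
      also have "\<dots> = (\<integral>\<^sup>+ p. (\<integral>\<^sup>+ p'. f (p, p') \<partial>q2) * indicator A p \<partial>q1)"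
        by (intro nn_integral_cong nn_integral_multc) measurable
      also have "\<dots> = (\<integral>\<^sup>+ p. indicator A p \<partial>q1)"
        by (intro nn_integral_cong_AE) (use i1 in \<open>eventually_elim, simp\<close>)
      also have "\<dots> = emeasure q1 A" by simp
      finally show "emeasure (distr Q borel fst) A = emeasure q1 A" .
    qed (simp add: s1)
    show "distr Q borel snd = q2"
    proof (rule measure_eqI)
      fix A assume "A \<in> sets (distr Q borel snd)"
      then have A[measurable]: "A \<in> sets borel" by simp
      have "emeasure (distr Q borel snd) A = emeasure Q (snd -` A \<inter> space Q)"
        by (simp add: emeasure_distr)
      also have "\<dots> = (\<integral>\<^sup>+ p. f p * indicator A (snd p) \<partial>(q1 \<Otimes>\<^sub>M q2))"
        unfolding Q_def
        by (subst emeasure_density) (auto intro!: nn_integral_cong simp: indicator_def space_pair_measure split: if_splits)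
      also have "\<dots> = (\<integral>\<^sup>+ p'. \<integral>\<^sup>+ p. f (p, p') * indicator A p' \<partial>q1 \<partial>q2)"
        by (subst P.nn_integral_snd[symmetric]) (auto)
      also have "\<dots> = (\<integral>\<^sup>+ p'. (\<integral>\<^sup>+ p. f (p, p') \<partial>q1) * indicator A p' \<partial>q2)"
        by (intro nn_integral_cong nn_integral_multc) measurable
      also have "\<dots> = (\<integral>\<^sup>+ p. indicator A p \<partial>q2)"
        by (intro nn_integral_cong_AE) (use i2 in \<open>eventually_elim, simp\<close>)
      also have "\<dots> = emeasure q2 A" by simp
      finally show "emeasure (distr Q borel snd) A = emeasure q2 A" .
    qed (simp add: s2)
    show "AE p in Q. dist (snd (fst p)) (fst (snd p)) < e"
      unfolding Q_def by (subst AE_density) (auto simp: f_eq intro!: AE_I2 close)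
  qed
qed

lemma ennreal_powr_half_power2: "(ennreal_powr x (1/2))\<^sup>2 = x"
proof (cases "x = \<infinity>")
  case False
  then obtain r where "x = ennreal r" "0 \<le> r" by (cases x) auto
  then show ?thesis by (simp add: ennreal_powr_def powr_half_sqrt ennreal_power)
qed (simp add: ennreal_powr_def power2_eq_square)

lemma wasserstein_power2_le:
  assumes "q \<in> couplings \<mu> \<nu>" shows "(wasserstein \<mu> \<nu>)\<^sup>2 \<le> transport_cost q"
proof -
  have "wasserstein \<mu> \<nu> \<le> ennreal_powr (transport_cost q) (1/2)"
    unfolding wasserstein_def by (rule INF_lower[OF assms])
  then have "(wasserstein \<mu> \<nu>)\<^sup>2 \<le> (ennreal_powr (transport_cost q) (1/2))\<^sup>2"
    by (intro power_mono) auto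
  then show ?thesis by (simp add: ennreal_powr_half_power2)
qed

text \<open>Near-optimal couplings suffice for all estimates along geodesics, so attainment of the
  infimum is not invoked.\<close>

lemma wasserstein_near:
  assumes "wasserstein \<mu> \<nu> \<le> ennreal w" "0 \<le> w" "0 < e"
  obtains q where "q \<in> couplings \<mu> \<nu>" "transport_cost q \<le> ennreal ((w + e)\<^sup>2)"
proof -
  have "ennreal w < ennreal (w + e)" using assms by (simp add: ennreal_less_iff)
  then have "wasserstein \<mu> \<nu> < ennreal (w + e)" using assms by (simp add: le_less_trans)
  then obtain q where q: "q \<in> couplings \<mu> \<nu>" "ennreal_powr (transport_cost q) (1/2) < ennreal (w + e)"
    unfolding wasserstein_def INF_less_iff by blast
  have "(ennreal_powr (transport_cost q) (1/2))\<^sup>2 \<le> (ennreal (w + e))\<^sup>2"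
    using q by (intro power_mono) auto
  then show ?thesis
    using that[OF q(1)] assms by (simp add: ennreal_powr_half_power2 ennreal_power del: ennreal_plus)
qed


text \<open>The defect \<open>a\<^sup>2/t + b\<^sup>2/(1-t) - d\<^sup>2\<close> is nonnegative by the triangle inequality and
  integrates to \<open>0\<close> along a geodesic; couplings are only glued up to \<open>e\<close>, which suffices in the limit.\<close>

lemma geodesic_concentrated:
  fixes \<mu>0 \<mu> \<mu>1 :: "'a::polish_space measure"
  assumes \<mu>: "prob_space \<mu>" "sets \<mu> = sets borel" and t: "0 < t" "t < 1" and "0 \<le> w"
    and w: "wasserstein \<mu>0 \<mu>1 = ennreal w"
    and w0: "wasserstein \<mu>0 \<mu> \<le> ennreal (t * w)" and w1: "wasserstein \<mu> \<mu>1 \<le> ennreal ((1 - t) * w)"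
    and A: "AE x in \<mu>0. x \<in> A" and B: "AE y in \<mu>1. y \<in> B" and "0 < \<eta>"
  shows "AE z in \<mu>. \<exists>x\<in>A. \<exists>y\<in>B. (dist x z)\<^sup>2 / t + (dist z y)\<^sup>2 / (1 - t) < (dist x y)\<^sup>2 + \<eta>"
proof -
  interpret \<mu>: prob_space \<mu> by fact
  \<comment> \<open>As a union of open sets G is open whatever A and B are, so the exceptional set F
    is Borel although A and B need not be.\<close>
  define G where "G = (\<Union>x\<in>A. \<Union>y\<in>B. {z. (dist x z)\<^sup>2 / t + (dist z y)\<^sup>2 / (1 - t) < (dist x y)\<^sup>2 + \<eta>})"
  define F where "F = - G"
  have "open G"
    unfolding G_def by (intro open_UN ballI open_Collect_less continuous_intros) (use t in auto)
  then have F[measurable]: "F \<in> sets borel" by (simp add: F_def)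
  define p where "p = measure \<mu> F"
  have p0: "0 \<le> p" by (simp add: p_def)
  have ineq: "w\<^sup>2 + \<eta> * p \<le> (t * w + e)\<^sup>2 / t + ((1 + e) * ((1 - t) * w + e)\<^sup>2 + (e + e\<^sup>2)) / (1 - t)"
    if e: "0 < e" for e
  proof -
    obtain q1 where q1: "q1 \<in> couplings \<mu>0 \<mu>" "transport_cost q1 \<le> ennreal ((t * w + e)\<^sup>2)"
      using wasserstein_near[OF w0 _ e] t \<open>0 \<le> w\<close> by auto
    obtain q2 where q2: "q2 \<in> couplings \<mu> \<mu>1" "transport_cost q2 \<le> ennreal (((1 - t) * w + e)\<^sup>2)"
      using wasserstein_near[OF w1 _ e] t \<open>0 \<le> w\<close> by auto
    obtain Q :: "(('a \<times> 'a) \<times> ('a \<times> 'a)) measure" where Q: "sets Q = sets borel" "distr Q borel fst = q1" "distr Q borel snd = q2"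
      "AE p in Q. dist (snd (fst p)) (fst (snd p)) < e"
      using approximate_gluing[OF \<mu>(1) q1(1) q2(1) e] by blast
    have Qm: "f \<in> borel_measurable Q" if "f \<in> borel_measurable borel" for f :: "_ \<Rightarrow> 'b::topological_space"
      using that measurable_cong_sets[OF Q(1) refl] by blast
    have [measurable]: "fst \<in> Q \<rightarrow>\<^sub>M borel" "snd \<in> Q \<rightarrow>\<^sub>M borel"
      by (intro Qm fst_snd_borel_measurable)+
    have d0: "\<mu>0 = distr q1 borel fst" "\<mu> = distr q1 borel snd" "\<mu>1 = distr q2 borel snd"
      using q1 q2 by (auto simp: couplings_def)
    have Q0: "\<mu>0 = distr Q borel (\<lambda>p. fst (fst p))"
      by (subst d0, subst Q(2)[symmetric], subst distr_distr) (auto simp: comp_def)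
    have Q1: "\<mu>1 = distr Q borel (\<lambda>p. snd (snd p))"
      by (subst d0, subst Q(3)[symmetric], subst distr_distr) (auto simp: comp_def)
    have Qz: "\<mu> = distr Q borel (\<lambda>p. snd (fst p))"
      by (subst d0, subst Q(2)[symmetric], subst distr_distr) (auto simp: comp_def)
    define q where "q = distr Q borel (\<lambda>p. (fst (fst p), snd (snd p)))"
    have mq[measurable]: "(\<lambda>p. (fst (fst p), snd (snd p))) \<in> Q \<rightarrow>\<^sub>M borel"
      by (intro Qm borel_measurable_continuous_onI continuous_intros)
    have q: "q \<in> couplings \<mu>0 \<mu>1"
      unfolding couplings_def mem_Collect_eq
    proof (intro conjI)
      show "distr q borel fst = \<mu>0"
        unfolding q_def by (subst distr_distr) (simp_all add: comp_def flip: Q0)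
      show "distr q borel snd = \<mu>1"
        unfolding q_def by (subst distr_distr) (simp_all add: comp_def flip: Q1)
    qed (simp add: q_def)
    have Q_AE: "AE p in Q. fst (fst p) \<in> A" "AE p in Q. snd (snd p) \<in> B"
    proof -
      have m: "(\<lambda>p. fst (fst p)) \<in> Q \<rightarrow>\<^sub>M borel" "(\<lambda>p. snd (snd p)) \<in> Q \<rightarrow>\<^sub>M borel" by measurable
      show "AE p in Q. fst (fst p) \<in> A" by (rule AE_distrD[OF m(1)], unfold Q0[symmetric], rule A)
      show "AE p in Q. snd (snd p) \<in> B" by (rule AE_distrD[OF m(2)], unfold Q1[symmetric], rule B)
    qed
    have c1: "(\<integral>\<^sup>+ p. ennreal ((dist (fst (fst p)) (snd (fst p)))\<^sup>2) \<partial>Q) = transport_cost q1"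
      unfolding transport_cost_def by (subst Q(2)[symmetric], subst nn_integral_distr) auto
    have c2: "(\<integral>\<^sup>+ p. ennreal ((dist (fst (snd p)) (snd (snd p)))\<^sup>2) \<partial>Q) = transport_cost q2"
      unfolding transport_cost_def by (subst Q(3)[symmetric], subst nn_integral_distr) auto
    have c: "(\<integral>\<^sup>+ p. ennreal ((dist (fst (fst p)) (snd (snd p)))\<^sup>2) \<partial>Q) = transport_cost q"
      unfolding transport_cost_def q_def by (subst nn_integral_distr) auto
    have cF: "(\<integral>\<^sup>+ p. ennreal \<eta> * indicator F (snd (fst p)) \<partial>Q) = ennreal (\<eta> * p)"
    proof -
      have "(\<integral>\<^sup>+ p. ennreal \<eta> * indicator F (snd (fst p)) \<partial>Q) = (\<integral>\<^sup>+ z. ennreal \<eta> * indicator F z \<partial>\<mu>)"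
        by (subst Qz, subst nn_integral_distr) auto
      also have "\<dots> = ennreal (\<eta> * p)"
        using \<open>0 < \<eta>\<close> p0 \<mu>(2) by (simp add: nn_integral_cmult p_def \<mu>.emeasure_eq_measure ennreal_mult)
      finally show ?thesis .
    qed
    have mz: "(\<lambda>p. snd (fst p)) \<in> Q \<rightarrow>\<^sub>M borel" by measurable
    have "prob_space Q"
      by (rule prob_space_distrD[OF mz], unfold Qz[symmetric], rule \<mu>)
    then have Qp: "emeasure Q (space Q) = 1" by (rule prob_space.emeasure_space_1)
    have pw: "ennreal ((dist x y)\<^sup>2) + ennreal \<eta> * indicator F z
        \<le> ennreal (1/t) * ennreal ((dist x z)\<^sup>2) + (ennreal ((1 + e) / (1 - t)) * ennreal ((dist z' y)\<^sup>2) + ennreal ((e + e\<^sup>2) / (1 - t)))"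
      if x: "x \<in> A" and y: "y \<in> B" and z: "dist z z' < e" for x y z z'
    proof -
      have "(dist z y)\<^sup>2 \<le> (1 + e) * (dist z' y)\<^sup>2 + (e + e\<^sup>2)"
      proof -
        have "(dist z y)\<^sup>2 \<le> (dist z' y + e)\<^sup>2"
          using dist_triangle[of z y z'] z by (intro power_mono) auto
        \<comment> \<open>Trading the cross term of (dist z' y + e)^2 for a multiple of the square
          leaves only quantities controlled by the cost of q2.\<close>
        moreover have "2 * dist z' y \<le> (dist z' y)\<^sup>2 + 1"
          using sum_squares_bound[of "dist z' y" 1] by simp
        then have "e * (2 * dist z' y) \<le> e * ((dist z' y)\<^sup>2 + 1)" using e by (intro mult_left_mono) auto
        ultimately show ?thesis by (simp add: power2_eq_square algebra_simps)
      qed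
      then have *: "(dist z y)\<^sup>2 / (1 - t) \<le> ((1 + e) * (dist z' y)\<^sup>2 + (e + e\<^sup>2)) / (1 - t)"
        using t by (intro divide_right_mono) auto
      \<comment> \<open>Convexity of the square with its explicit defect; equality means a : b = t :
        (1 - t), that is, the division of a geodesic at time t.\<close>
      have sq: "(a + b)\<^sup>2 \<le> a\<^sup>2 / t + b\<^sup>2 / (1 - t)" for a b :: real
      proof -
        have "a\<^sup>2 / t + b\<^sup>2 / (1 - t) - (a + b)\<^sup>2 = ((1 - t) * a - t * b)\<^sup>2 / (t * (1 - t))"
          using t by (simp add: field_simps power2_eq_square)
        also have "\<dots> \<ge> 0" using t by simp
        finally show ?thesis by simp
      qed
      have "(dist x y)\<^sup>2 + \<eta> * indicator F z \<le> (dist x z)\<^sup>2 / t + (dist z y)\<^sup>2 / (1 - t)"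
      proof (cases "z \<in> F")
        case True
        then show ?thesis using x y by (auto simp: F_def G_def not_less)
      next
        case False
        have "(dist x y)\<^sup>2 \<le> (dist x z + dist z y)\<^sup>2"
          by (intro power_mono dist_triangle) auto
        from order_trans[OF this sq] show ?thesis using False by simp
      qed
      also have "\<dots> \<le> 1/t * (dist x z)\<^sup>2 + ((1 + e) / (1 - t) * (dist z' y)\<^sup>2 + (e + e\<^sup>2) / (1 - t))"
        using * by (simp add: add_divide_distrib[of "(1 + e) * (dist z' y)\<^sup>2"])
      finally have "ennreal ((dist x y)\<^sup>2 + \<eta> * indicator F z) \<le> ennreal (1/t * (dist x z)\<^sup>2 + ((1 + e) / (1 - t) * (dist z' y)\<^sup>2 + (e + e\<^sup>2) / (1 - t)))"
        by (rule ennreal_leI)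
      moreover have "ennreal ((dist x y)\<^sup>2 + \<eta> * indicator F z) = ennreal ((dist x y)\<^sup>2) + ennreal \<eta> * indicator F z"
        using \<open>0 < \<eta>\<close> by (cases "z \<in> F") auto
      moreover have "ennreal (1/t * (dist x z)\<^sup>2 + ((1 + e) / (1 - t) * (dist z' y)\<^sup>2 + (e + e\<^sup>2) / (1 - t)))
        = ennreal (1/t) * ennreal ((dist x z)\<^sup>2) + (ennreal ((1 + e) / (1 - t)) * ennreal ((dist z' y)\<^sup>2) + ennreal ((e + e\<^sup>2) / (1 - t)))"
        using t e by (simp add: ennreal_mult'[symmetric] del: times_divide_eq_left)
      ultimately show ?thesis by simp
    qed
    have "ennreal (w\<^sup>2) + ennreal (\<eta> * p) \<le> transport_cost q + ennreal (\<eta> * p)"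
      using wasserstein_power2_le[OF q] \<open>0 \<le> w\<close> by (intro add_right_mono) (simp add: w ennreal_power)
    also have "\<dots> = (\<integral>\<^sup>+ p. ennreal ((dist (fst (fst p)) (snd (snd p)))\<^sup>2) + ennreal \<eta> * indicator F (snd (fst p)) \<partial>Q)"
      by (subst nn_integral_add) (auto simp: c cF)
    also have "\<dots> \<le> (\<integral>\<^sup>+ p. ennreal (1/t) * ennreal ((dist (fst (fst p)) (snd (fst p)))\<^sup>2)
        + (ennreal ((1 + e) / (1 - t)) * ennreal ((dist (fst (snd p)) (snd (snd p)))\<^sup>2) + ennreal ((e + e\<^sup>2) / (1 - t))) \<partial>Q)"
      by (rule nn_integral_mono_AE) (use Q_AE Q(4) in \<open>eventually_elim, intro pw\<close>)
    also have "\<dots> = ennreal (1/t) * transport_cost q1 + (ennreal ((1 + e) / (1 - t)) * transport_cost q2 + ennreal ((e + e\<^sup>2) / (1 - t)))"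
      by (subst nn_integral_add, measurable, subst nn_integral_add, measurable)
        (simp add: nn_integral_cmult c1 c2 Qp)
    also have "\<dots> \<le> ennreal (1/t) * ennreal ((t * w + e)\<^sup>2) + (ennreal ((1 + e) / (1 - t)) * ennreal (((1 - t) * w + e)\<^sup>2) + ennreal ((e + e\<^sup>2) / (1 - t)))"
      by (intro add_mono mult_left_mono q1 q2) auto
    also have "\<dots> = ennreal (1/t * (t * w + e)\<^sup>2 + ((1 + e) / (1 - t) * ((1 - t) * w + e)\<^sup>2 + (e + e\<^sup>2) / (1 - t)))"
      using t e by (simp add: ennreal_mult'[symmetric] del: times_divide_eq_left)
    also have "ennreal (w\<^sup>2) + ennreal (\<eta> * p) = ennreal (w\<^sup>2 + \<eta> * p)"
      using \<open>0 < \<eta>\<close> p0 by simp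
    finally have "w\<^sup>2 + \<eta> * p \<le> 1/t * (t * w + e)\<^sup>2 + ((1 + e) / (1 - t) * ((1 - t) * w + e)\<^sup>2 + (e + e\<^sup>2) / (1 - t))"
      using t e by (subst (asm) ennreal_le_iff) (auto intro!: add_nonneg_nonneg)
    then show ?thesis by (simp add: add_divide_distrib[of "(1 + e) * ((1 - t) * w + e)\<^sup>2"])
  qed
  \<comment> \<open>In the limit the right-hand side becomes t * w^2 + (1 - t) * w^2 = w^2, which
    leaves no room for \<eta> * p.\<close>
  have "((\<lambda>e. (t * w + e)\<^sup>2 / t + ((1 + e) * ((1 - t) * w + e)\<^sup>2 + (e + e\<^sup>2)) / (1 - t)) \<longlongrightarrow>
      (t * w + 0)\<^sup>2 / t + ((1 + 0) * ((1 - t) * w + 0)\<^sup>2 + (0 + 0\<^sup>2)) / (1 - t)) (at_right 0)"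
    using t by (intro tendsto_intros) auto
  then have "w\<^sup>2 + \<eta> * p \<le> (t * w + 0)\<^sup>2 / t + ((1 + 0) * ((1 - t) * w + 0)\<^sup>2 + (0 + 0\<^sup>2)) / (1 - t)"
    by (rule tendsto_lowerbound) (auto simp: eventually_at_right_less intro!: eventually_at_rightI[of 0 1] ineq)
  also have "\<dots> = w\<^sup>2" using t by (simp add: field_simps power2_eq_square)
  finally have "p = 0" using \<open>0 < \<eta>\<close> p0 by (simp add: mult_le_0_iff)
  then have "F \<in> null_sets \<mu>" using \<mu>(2) by (intro null_setsI) (auto simp: p_def \<mu>.emeasure_eq_measure)
  then show ?thesis by (rule AE_I') (auto simp: F_def G_def)
qed


section \<open>Contraction of sets towards a point\<close>

lemma uniform_measure_Pinf:
  fixes m :: "'a::polish_space measure"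
  assumes m: "sets m = sets borel" and A: "A \<in> sets borel" "bounded A" "0 < emeasure m A" "emeasure m A < \<infinity>"
  shows "uniform_measure m A \<in> Pinf m" "msupport (uniform_measure m A) \<subseteq> closure A"
    "AE x in uniform_measure m A. x \<in> A"
proof -
  let ?\<nu> = "uniform_measure m A"
  have s: "sets ?\<nu> = sets borel" using m by (simp add: sets_uniform_measure)
  have Am: "A \<in> sets m" using A m by simp
  show AE: "AE x in ?\<nu>. x \<in> A"
    using A Am by (intro AE_uniform_measureI) auto
  have P: "prob_space ?\<nu>"
    using A by (intro prob_space_uniform_measure) auto
  show sup: "msupport ?\<nu> \<subseteq> closure A"
  proof (rule msupport_subset_closed[OF s])
    have "AE x in ?\<nu>. x \<notin> - closure A"
      using AE by eventually_elim (use closure_subset in blast)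
    then show "emeasure ?\<nu> (- closure A) = 0"
      by (subst (asm) AE_iff_measurable[of "- closure A"]) (auto simp: s sets_eq_imp_space_eq[OF m] m)
  qed simp
  have bs: "bounded (msupport ?\<nu>)" using sup A(2) by (meson bounded_closure bounded_subset)
  have ac: "absolutely_continuous m ?\<nu>"
    unfolding uniform_measure_def using Am by (intro absolutely_continuousI_density) auto
  obtain x0 r where r: "\<And>x. x \<in> A \<Longrightarrow> dist x0 x \<le> r" using A(2) unfolding bounded_def by blast
  have "(\<integral>\<^sup>+ x. ennreal ((dist x0 x)\<^sup>2) \<partial>?\<nu>) \<le> (\<integral>\<^sup>+ x. ennreal (r\<^sup>2) \<partial>?\<nu>)"
    by (rule nn_integral_mono_AE) (use AE in \<open>eventually_elim, auto intro!: ennreal_leI power_mono r\<close>)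
  also have "\<dots> < \<infinity>" using prob_space.emeasure_space_1[OF P] by simp
  finally have "?\<nu> \<in> P2" unfolding P2_def using s P by auto
  with ac bs show "?\<nu> \<in> Pinf m" by (simp add: Pinf_def)
qed

lemma Pinf_density:
  assumes "metric_measure_space m" "\<nu> \<in> Pinf m"
  shows "density m (\<lambda>x. ennreal (dens m \<nu> x)) = \<nu>" "dens m \<nu> \<in> borel_measurable borel"
proof -
  interpret sigma_finite_measure m by (rule metric_measure_space_sigma_finite[OF assms(1)])
  have s: "sets m = sets borel" "sets \<nu> = sets borel"
    using metric_measure_space_sets[OF assms(1)] Pinf_sets[OF assms(2)] by auto
  interpret \<nu>: prob_space \<nu> by (rule Pinf_prob_space[OF assms(2)])
  have ac: "absolutely_continuous m \<nu>" using assms(2) by (simp add: Pinf_def)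
  have "AE x in m. RN_deriv m \<nu> x \<noteq> \<infinity>"
    by (rule RN_deriv_finite[OF _ ac]) (use s in \<open>auto intro: \<nu>.sigma_finite_measure_axioms\<close>)
  then have "AE x in m. ennreal (dens m \<nu> x) = RN_deriv m \<nu> x"
    by eventually_elim (simp add: dens_def top.not_eq_extremum)
  then have "density m (\<lambda>x. ennreal (dens m \<nu> x)) = density m (RN_deriv m \<nu>)"
    by (intro density_cong) (auto simp: dens_def)
  then show "density m (\<lambda>x. ennreal (dens m \<nu> x)) = \<nu>"
    using density_RN_deriv[OF ac] s by simp
  have "dens m \<nu> \<in> borel_measurable m" unfolding dens_def[abs_def] by measurable
  then show "dens m \<nu> \<in> borel_measurable borel" using measurable_cong_sets[OF s(1) refl] by blast
qed

lemma dens_nonneg: "0 \<le> dens m \<nu> x"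
  by (simp add: dens_def)

lemma uniform_measure_dens:
  fixes m :: "'a::polish_space measure"
  assumes mm: "metric_measure_space m" and A: "A \<in> sets borel" "bounded A" "0 < emeasure m A" "emeasure m A < \<infinity>"
  shows "AE x in uniform_measure m A. ennreal (dens m (uniform_measure m A) x powr - 1) = emeasure m A"
proof -
  interpret sigma_finite_measure m by (rule metric_measure_space_sigma_finite[OF mm])
  let ?\<nu> = "uniform_measure m A"
  have Am: "A \<in> sets m" using A metric_measure_space_sets[OF mm] by simp
  note U = uniform_measure_Pinf[OF metric_measure_space_sets[OF mm] A]
  have "AE x in m. indicator A x / emeasure m A = RN_deriv m ?\<nu> x"
    by (rule RN_deriv_unique) (use Am in \<open>auto simp: uniform_measure_def\<close>)
  then have "AE x in ?\<nu>. indicator A x / emeasure m A = RN_deriv m ?\<nu> x"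
    using absolutely_continuous_AE[of ?\<nu> m] U(1) by (auto simp: Pinf_def)
  with U(3) show ?thesis
  proof eventually_elim
    case (elim x)
    obtain a where a: "emeasure m A = ennreal a" "0 \<le> a" using A(4) by (cases "emeasure m A") auto
    have "RN_deriv m ?\<nu> x = ennreal (1 / a)" using elim a A(3) by (simp add: divide_ennreal[symmetric])
    then have "dens m ?\<nu> x = 1 / a" using a by (simp add: dens_def)
    then show ?case using a A(3) by (simp add: powr_minus)
  qed
qed

lemma wasserstein_finite:
  assumes "q \<in> couplings \<mu> \<nu>" "prob_space q" "AE p in q. dist (fst p) (snd p) \<le> D"
  shows "wasserstein \<mu> \<nu> < \<infinity>"
proof -
  have "transport_cost q \<le> (\<integral>\<^sup>+ p. ennreal (D\<^sup>2) \<partial>q)"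
    unfolding transport_cost_def
    by (rule nn_integral_mono_AE) (use assms(3) in \<open>eventually_elim, auto intro!: ennreal_leI power_mono\<close>)
  also have "\<dots> < \<infinity>" using assms(2) by (simp add: prob_space.emeasure_space_1)
  finally have "(wasserstein \<mu> \<nu>)\<^sup>2 < \<infinity>"
    using wasserstein_power2_le[OF assms(1)] by (rule le_less_trans[rotated])
  then show ?thesis by (cases "wasserstein \<mu> \<nu>") (auto simp: power2_eq_square)
qed

lemma couplings_prob_space:
  assumes "q \<in> couplings \<mu> \<nu>" "prob_space \<mu>" shows "prob_space q"
proof -
  have m: "fst \<in> borel_measurable q" by (intro couplings_measurable[OF assms(1)] fst_snd_borel_measurable)
  have "distr q borel fst = \<mu>" using assms by (simp add: couplings_def)
  then show ?thesis using prob_space_distrD[OF m] assms(2) by blast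
qed

text \<open>Only the exponent \<open>N' = 1\<close> of the curvature-dimension condition is used: there the entropy of
  \<open>\<Gamma> t\<close> is the measure of the set where its density is positive.\<close>

lemma brunn_minkowski:
  fixes m :: "'a::polish_space measure"
  assumes mm: "metric_measure_space m"
    and A: "A \<in> sets borel" "bounded A" "0 < emeasure m A" "emeasure m A < \<infinity>"
    and B: "B \<in> sets borel" "bounded B" "0 < emeasure m B" "emeasure m B < \<infinity>"
    and CD: "CD_pair sigma_coeff m K 1 (uniform_measure m A) (uniform_measure m B)"
    and t: "0 < t" "t < 1"
    and Z: "Z \<in> sets borel" "\<And>z. (\<And>\<eta>. 0 < \<eta> \<Longrightarrow>
      \<exists>x\<in>A. \<exists>y\<in>B. (dist x z)\<^sup>2 / t + (dist z y)\<^sup>2 / (1 - t) < (dist x y)\<^sup>2 + \<eta>) \<Longrightarrow> z \<in> Z"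
    and c: "\<And>x y. x \<in> A \<Longrightarrow> y \<in> B \<Longrightarrow> c \<le> sigma_coeff K 1 (1 - t) (dist x y)"
  shows "c * emeasure m A \<le> emeasure m Z"
proof -
  let ?\<nu>0 = "uniform_measure m A" and ?\<nu>1 = "uniform_measure m B"
  have sm: "sets m = sets borel" by (rule metric_measure_space_sets[OF mm])
  note U0 = uniform_measure_Pinf[OF sm A] and U1 = uniform_measure_Pinf[OF sm B]
  obtain q \<Gamma> where q: "optimal_coupling ?\<nu>0 ?\<nu>1 q" and \<Gamma>: "Pinf_geodesic m \<Gamma>" "\<Gamma> 0 = ?\<nu>0" "\<Gamma> 1 = ?\<nu>1"
    and le': "\<forall>t\<in>{0..1}. \<forall>N'\<ge>1. renyi_entropy N' (\<Gamma> t) m \<le>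
             - enn2ereal (\<integral>\<^sup>+ (x0, x1).
                  (sigma_coeff K N' (1 - t) (dist x0 x1) * ennreal (dens m ?\<nu>0 x0 powr (- 1/N'))
                   + sigma_coeff K N' t (dist x0 x1) * ennreal (dens m ?\<nu>1 x1 powr (- 1/N'))) \<partial>q)"
    using CD unfolding CD_pair_def by blast
  have t01: "t \<in> {0..1}" using t by simp
  note le = le'[rule_format, OF t01 order_refl]
  have qc: "q \<in> couplings ?\<nu>0 ?\<nu>1" using q by (simp add: optimal_coupling_def)
  have Pt: "\<Gamma> t \<in> Pinf m" using \<Gamma> t by (simp add: Pinf_geodesic_def)
  note Dt = Pinf_density[OF mm Pt]
  have qA: "AE p in q. fst p \<in> A" and qB: "AE p in q. snd p \<in> B"
    using couplings_AE[OF qc] U0(3) U1(3) by blast+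
  have qp: "prob_space q" by (rule couplings_prob_space[OF qc Pinf_prob_space[OF U0(1)]])
  have "bounded (A \<union> B)" using A B by simp
  then obtain D where D: "\<And>x y. x \<in> A \<union> B \<Longrightarrow> y \<in> A \<union> B \<Longrightarrow> dist x y \<le> D"
    by (meson bounded_two_points)
  have "wasserstein ?\<nu>0 ?\<nu>1 < \<infinity>"
    by (rule wasserstein_finite[OF qc qp]) (use qA qB in \<open>eventually_elim, auto intro!: D\<close>)
  then obtain w where w: "wasserstein ?\<nu>0 ?\<nu>1 = ennreal w" "0 \<le> w"
    by (cases "wasserstein ?\<nu>0 ?\<nu>1") auto
  have geo: "wasserstein (\<Gamma> r) (\<Gamma> s) = ennreal \<bar>r - s\<bar> * ennreal w" if "r \<in> {0..1}" "s \<in> {0..1}" for r s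
    using \<Gamma> that w unfolding Pinf_geodesic_def by simp
  have w0: "wasserstein ?\<nu>0 (\<Gamma> t) \<le> ennreal (t * w)" and w1: "wasserstein (\<Gamma> t) ?\<nu>1 \<le> ennreal ((1 - t) * w)"
    using geo[of 0 t] geo[of t 1] t w(2) \<Gamma> by (simp_all add: ennreal_mult)
  \<comment> \<open>The concentration result gives one null set per tolerance; the tolerances 1/(n +
    1) keep the union of these null sets countable.\<close>
  have "AE z in \<Gamma> t. \<forall>n::nat. \<exists>x\<in>A. \<exists>y\<in>B. (dist x z)\<^sup>2 / t + (dist z y)\<^sup>2 / (1 - t) < (dist x y)\<^sup>2 + 1 / Suc n"
    unfolding AE_all_countable
    by (intro allI geodesic_concentrated[OF Pinf_prob_space[OF Pt] Pinf_sets[OF Pt] t w(2,1) w0 w1 U0(3) U1(3)]) simp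
  then have AEZ: "AE z in \<Gamma> t. z \<in> Z"
  proof eventually_elim
    case (elim z)
    show ?case
    proof (rule Z(2))
      fix \<eta> :: real assume "0 < \<eta>"
      then obtain n :: nat where "1 / Suc n < \<eta>" using nat_approx_posE by blast
      moreover obtain x y where "x \<in> A" "y \<in> B" "(dist x z)\<^sup>2 / t + (dist z y)\<^sup>2 / (1 - t) < (dist x y)\<^sup>2 + 1 / Suc n"
        using elim by blast
      ultimately show "\<exists>x\<in>A. \<exists>y\<in>B. (dist x z)\<^sup>2 / t + (dist z y)\<^sup>2 / (1 - t) < (dist x y)\<^sup>2 + \<eta>"
        by (intro bexI[of _ x] bexI[of _ y]) auto
    qed
  qed
  have dm: "dens m (\<Gamma> t) \<in> borel_measurable m"
    using Dt(2) measurable_cong_sets[OF sm refl] by blast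
  have "AE z in m. 0 < ennreal (dens m (\<Gamma> t) z) \<longrightarrow> z \<in> Z"
    using AEZ dm by (subst (asm) Dt(1)[symmetric], subst (asm) AE_density) auto
  \<comment> \<open>The exponent 1 - 1/1 is 0 and 0 powr 0 = 0, so the integrand is the indicator of
    the set of positive density, which lies in Z up to a null set.\<close>
  then have "(\<integral>\<^sup>+ x. ennreal (dens m (\<Gamma> t) x powr (1 - 1/1)) \<partial>m) \<le> (\<integral>\<^sup>+ x. indicator Z x \<partial>m)"
    by (intro nn_integral_mono_AE, elim eventually_mono) (auto simp: indicator_def dens_nonneg less_le)
  also have "\<dots> = emeasure m Z" using Z(1) sm by simp
  finally have ent: "(\<integral>\<^sup>+ x. ennreal (dens m (\<Gamma> t) x powr (1 - 1/1)) \<partial>m) \<le> emeasure m Z" .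
  \<comment> \<open>Only the term of the first marginal is kept; its inverse density is the constant
    m(A). The term of B is dropped, since B will shrink to a point.\<close>
  have "c * emeasure m A = (\<integral>\<^sup>+ p. c * emeasure m A \<partial>q)"
    using qp by (simp add: prob_space.emeasure_space_1)
  also have "\<dots> \<le> (\<integral>\<^sup>+ (x0, x1). (sigma_coeff K 1 (1 - t) (dist x0 x1) * ennreal (dens m ?\<nu>0 x0 powr (- 1/1))
                   + sigma_coeff K 1 t (dist x0 x1) * ennreal (dens m ?\<nu>1 x1 powr (- 1/1))) \<partial>q)"
  proof (rule nn_integral_mono_AE)
    have "AE p in q. ennreal (dens m ?\<nu>0 (fst p) powr - 1) = emeasure m A"
      by (rule couplings_AE(1)[OF qc uniform_measure_dens[OF mm A]])
    with qA qB show "AE p in q. c * emeasure m A \<le> (case p of (x0, x1) \<Rightarrow>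
        (sigma_coeff K 1 (1 - t) (dist x0 x1) * ennreal (dens m ?\<nu>0 x0 powr (- 1/1))
                   + sigma_coeff K 1 t (dist x0 x1) * ennreal (dens m ?\<nu>1 x1 powr (- 1/1))))"
    proof eventually_elim
      case (elim p)
      have "c * emeasure m A \<le> sigma_coeff K 1 (1 - t) (dist (fst p) (snd p)) * emeasure m A"
        using c elim by (intro mult_right_mono) auto
      then show ?case using elim(3) by (auto simp: case_prod_beta intro: order_trans)
    qed
  qed
  also have "\<dots> \<le> (\<integral>\<^sup>+ x. ennreal (dens m (\<Gamma> t) x powr (1 - 1/1)) \<partial>m)"
    using le unfolding renyi_entropy_def by (simp add: less_eq_ennreal.rep_eq)
  also note ent
  finally show ?thesis .
qed

text \<open>The points at relative distance \<open>l\<close> from \<open>b\<close> on geodesics from \<open>b\<close> to \<open>A\<close>, in an approximate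
  form that needs no existence of geodesics.\<close>

definition contr :: "'a::metric_space \<Rightarrow> real \<Rightarrow> 'a set \<Rightarrow> 'a set" where
  "contr b l A = {z. \<forall>e>0. \<exists>x\<in>A. \<bar>dist z b - l * dist x b\<bar> < e \<and> \<bar>dist x z - (1 - l) * dist x b\<bar> < e}"

text \<open>The tolerances in the definition make the set stable under limits. This gives
  measurability of \<open>contr b l A\<close> for arbitrary A.\<close>

lemma closed_contr: "closed (contr b l A)"
  unfolding closed_sequential_limits
proof (intro allI impI, elim conjE)
  fix f z assume f: "\<forall>n. f n \<in> contr b l A" "f \<longlonglongrightarrow> z"
  show "z \<in> contr b l A"
    unfolding contr_def
  proof safe
    fix e :: real assume "0 < e"
    then obtain n where n: "dist (f n) z < e / 2"
      using f(2) by (metis half_gt_zero lim_sequentially order_refl)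
    obtain x where x: "x \<in> A" "\<bar>dist (f n) b - l * dist x b\<bar> < e/2" "\<bar>dist x (f n) - (1 - l) * dist x b\<bar> < e/2"
      using f(1) \<open>0 < e\<close> unfolding contr_def by (auto dest!: spec[of _ n] spec[of _ "e/2"])
    have "\<bar>dist z b - dist (f n) b\<bar> \<le> dist (f n) z" "\<bar>dist x z - dist x (f n)\<bar> \<le> dist (f n) z"
      using dist_triangle[of z b "f n"] dist_triangle[of "f n" b z] dist_triangle[of x z "f n"] dist_triangle[of x "f n" z]
      by (auto simp: abs_le_iff dist_commute)
    then show "\<exists>x\<in>A. \<bar>dist z b - l * dist x b\<bar> < e \<and> \<bar>dist x z - (1 - l) * dist x b\<bar> < e"
      using n x by (intro bexI[of _ x] conjI) argo+
  qed
qed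

text \<open>Since a^2/t + b^2/(1 - t) = (a + b)^2 + s^2/(t (1 - t)) with s = (1 - t) a - t b, an
  excess of \<delta>^2 over d^2 bounds both the triangle defect a + b - d and |s| by \<delta>. Each
  of the two conclusions adds one error of either kind.\<close>

lemma near_intermediate:
  fixes a b d t \<delta> :: real
  assumes t: "0 < t" "t < 1" and nn: "0 \<le> a" "0 \<le> b" "0 \<le> d" and "0 < \<delta>" and tri: "d \<le> a + b"
    and le: "a\<^sup>2 / t + b\<^sup>2 / (1 - t) < d\<^sup>2 + \<delta>\<^sup>2"
  shows "\<bar>b - (1 - t) * d\<bar> \<le> 2 * \<delta>" "\<bar>a - t * d\<bar> \<le> 2 * \<delta>"
proof -
  define s where "s = (1 - t) * a - t * b"
  have id: "a\<^sup>2 / t + b\<^sup>2 / (1 - t) = (a + b)\<^sup>2 + s\<^sup>2 / (t * (1 - t))"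
    unfolding s_def using t by (simp add: field_simps power2_eq_square)
  have dd: "d\<^sup>2 \<le> (a + b)\<^sup>2" using tri nn by (intro power_mono) auto
  have s0: "0 \<le> s\<^sup>2 / (t * (1 - t))" using t by simp
  have "s\<^sup>2 / (t * (1 - t)) < \<delta>\<^sup>2" using le id dd by linarith
  then have "s\<^sup>2 < \<delta>\<^sup>2 * (t * (1 - t))" using t by (simp add: divide_less_eq)
  also have "\<dots> \<le> \<delta>\<^sup>2 * 1" using t by (intro mult_left_mono) (auto simp: mult_le_one)
  finally have s: "\<bar>s\<bar> < \<delta>" using \<open>0 < \<delta>\<close> by (intro power2_less_imp_less[of "\<bar>s\<bar>"]) auto
  have "(a + b)\<^sup>2 < d\<^sup>2 + \<delta>\<^sup>2" using le id s0 by linarith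
  also have "\<dots> \<le> (d + \<delta>)\<^sup>2" using nn \<open>0 < \<delta>\<close> by (simp add: power2_sum)
  finally have ab: "a + b < d + \<delta>" using nn \<open>0 < \<delta>\<close> by (meson power2_less_imp_less add_nonneg_nonneg less_imp_le)
  have u: "0 \<le> (a + b) - d" "(a + b) - d \<le> \<delta>" using tri ab by auto
  have "(1 - t) * ((a + b) - d) \<le> 1 * \<delta>" "t * ((a + b) - d) \<le> 1 * \<delta>"
    using u t by (intro mult_mono; simp)+
  moreover have "0 \<le> (1 - t) * ((a + b) - d)" "0 \<le> t * ((a + b) - d)" using u t by auto
  moreover have "b - (1 - t) * d = (1 - t) * ((a + b) - d) - s" "a - t * d = t * ((a + b) - d) + s"
    unfolding s_def by (auto simp: algebra_simps)
  ultimately show "\<bar>b - (1 - t) * d\<bar> \<le> 2 * \<delta>" "\<bar>a - t * d\<bar> \<le> 2 * \<delta>"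
    using s by (auto simp: abs_le_iff abs_less_iff)
qed

text \<open>Brunn-Minkowski from A to the balls of radius \<delta> n around b, at time 1 - l, with
  \<delta> n tending to 0. The sets Z n of approximate intermediate points decrease and their
  intersection lies in \<open>contr b l A\<close>. Continuity of m from above needs finite measure;
  the Z n stay in the ball of radius 6 r, because x z is shorter than 4 r and x is within r of p.
  The bound c is assumed for all y near b, so it survives the limit.\<close>

lemma contraction:
  fixes m :: "'a::polish_space measure"
  assumes mm: "metric_measure_space m"
    and CD: "\<And>\<nu>0 \<nu>1. \<nu>0 \<in> Pinf m \<Longrightarrow> \<nu>1 \<in> Pinf m \<Longrightarrow>
      msupport \<nu>0 \<subseteq> ball p r \<Longrightarrow> msupport \<nu>1 \<subseteq> ball p r \<Longrightarrow> CD_pair sigma_coeff m K 1 \<nu>0 \<nu>1"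
    and fin: "emeasure m (ball p (6 * r)) < \<infinity>"
    and A: "A \<in> sets borel" "closure A \<subseteq> ball p r" and b: "b \<in> msupport m" "b \<in> ball p r"
    and l: "0 < l" "l < 1" and "0 < \<delta>0"
    and c: "\<And>x y. x \<in> A \<Longrightarrow> y \<in> ball b \<delta>0 \<Longrightarrow> c \<le> sigma_coeff K 1 l (dist x y)"
  shows "c * emeasure m A \<le> emeasure m (contr b l A)"
proof (cases "emeasure m A = 0")
  case False
  have sm: "sets m = sets borel" by (rule metric_measure_space_sets[OF mm])
  have r: "0 < r" using b(2) by (metis empty_iff ball_eq_empty not_le)
  have finb: "emeasure m B < \<infinity>" if "B \<subseteq> ball p (6 * r)" for B
    by (rule le_less_trans[OF emeasure_mono[OF that] fin]) (simp add: sm)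
  have sub: "ball p r \<subseteq> ball p (6 * r)" using r by (intro subset_ball) simp
  have Ar: "A \<subseteq> ball p r" using A(2) closure_subset by blast
  then have bA: "bounded A" "emeasure m A < \<infinity>" using finb sub bounded_subset[OF bounded_ball] by blast+
  obtain \<rho> where \<rho>: "0 < \<rho>" "cball b \<rho> \<subseteq> ball p r" using b(2) open_contains_cball open_ball by blast
  define \<delta> where "\<delta> n = min (min \<delta>0 \<rho>) r / real (Suc n)" for n
  have \<delta>: "0 < \<delta> n" "\<delta> n \<le> \<delta>0" "\<delta> n \<le> \<rho>" "\<delta> n \<le> r" for n
  proof -
    define k where "k = min (min \<delta>0 \<rho>) r"
    have "0 < k" using \<rho> r \<open>0 < \<delta>0\<close> by (simp add: k_def)
    then have "\<delta> n \<le> k" "0 < \<delta> n" by (auto simp: \<delta>_def k_def[symmetric] divide_le_eq algebra_simps)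
    then show "0 < \<delta> n" "\<delta> n \<le> \<delta>0" "\<delta> n \<le> \<rho>" "\<delta> n \<le> r" by (auto simp: k_def)
  qed
  have \<delta>dec: "\<delta> n \<le> \<delta> k" if "k \<le> n" for k n
    unfolding \<delta>_def using that \<rho> r \<open>0 < \<delta>0\<close> by (intro divide_left_mono) auto
  have \<delta>lim: "\<delta> \<longlonglongrightarrow> 0"
    unfolding \<delta>_def by (intro real_tendsto_divide_at_top[OF tendsto_const] filterlim_compose[OF filterlim_real_sequentially filterlim_Suc])
  define Z where "Z n = (\<Union>x\<in>A. \<Union>y\<in>ball b (\<delta> n).
      {z. (dist x z)\<^sup>2 / (1 - l) + (dist z y)\<^sup>2 / (1 - (1 - l)) < (dist x y)\<^sup>2 + (\<delta> n)\<^sup>2})" for n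
  have Zo: "open (Z n)" for n
    unfolding Z_def by (intro open_UN ballI open_Collect_less continuous_intros) (use l in auto)
  have ZI: "\<exists>x\<in>A. \<exists>y\<in>ball b (\<delta> n). \<bar>dist z y - (1 - (1 - l)) * dist x y\<bar> \<le> 2 * \<delta> n \<and> \<bar>dist x z - (1 - l) * dist x y\<bar> \<le> 2 * \<delta> n"
    if z: "z \<in> Z n" for z n
  proof -
    obtain x y where xy: "x \<in> A" "y \<in> ball b (\<delta> n)"
      "(dist x z)\<^sup>2 / (1 - l) + (dist z y)\<^sup>2 / (1 - (1 - l)) < (dist x y)\<^sup>2 + (\<delta> n)\<^sup>2"
      using z unfolding Z_def by blast
    have "\<bar>dist z y - (1 - (1 - l)) * dist x y\<bar> \<le> 2 * \<delta> n" "\<bar>dist x z - (1 - l) * dist x y\<bar> \<le> 2 * \<delta> n"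
      by (rule near_intermediate[OF _ _ _ _ _ _ _ xy(3)]; use l \<delta>(1) in \<open>simp add: dist_triangle\<close>)+
    then show ?thesis using xy(1,2) by blast
  qed
  have Zr: "Z n \<subseteq> ball p (6 * r)" for n
  proof
    fix z assume "z \<in> Z n"
    then obtain x y where xy: "x \<in> A" "y \<in> ball b (\<delta> n)" "\<bar>dist x z - (1 - l) * dist x y\<bar> \<le> 2 * \<delta> n"
      using ZI by blast
    have "y \<in> cball b \<rho>" using xy(2) \<delta>(3)[of n] by simp
    then have y: "dist p y < r" using \<rho> by auto
    have x: "dist p x < r" using xy(1) Ar by auto
    have d: "dist x y < 2 * r" using dist_triangle[of x y p] x y by (simp add: dist_commute)
    have "(1 - l) * dist x y \<le> 1 * dist x y" using l by (intro mult_right_mono) auto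
    then have "dist x z < 4 * r" using xy(3) d \<delta>(4)[of n] by (auto simp: abs_le_iff)
    then show "z \<in> ball p (6 * r)" using dist_triangle[of p z x] x r by auto
  qed
  have main: "c * emeasure m A \<le> emeasure m (Z n)" for n
  proof (rule brunn_minkowski[OF mm A(1) bA(1) _ bA(2), of "ball b (\<delta> n)" K "1 - l"])
    have Bn: "closure (ball b (\<delta> n)) \<subseteq> ball p r" 
    proof -
      have "closure (ball b (\<delta> n)) \<subseteq> cball b (\<delta> n)" by (intro closure_minimal) auto
      also have "\<dots> \<subseteq> cball b \<rho>" using \<delta>(3)[of n] by (intro subset_cball) auto
      finally show ?thesis using \<rho> by blast
    qed
    show A0: "0 < emeasure m A" using False by (simp add: zero_less_iff_neq_zero)
    show B0: "0 < emeasure m (ball b (\<delta> n))" using b(1) \<delta>(1) by (simp add: msupport_def)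
    show B1: "emeasure m (ball b (\<delta> n)) < \<infinity>" using Bn closure_subset sub by (intro finb) blast
    note UA = uniform_measure_Pinf[OF sm A(1) bA(1) A0 bA(2)]
    have UB: "uniform_measure m (ball b (\<delta> n)) \<in> Pinf m"
      "msupport (uniform_measure m (ball b (\<delta> n))) \<subseteq> closure (ball b (\<delta> n))"
      using uniform_measure_Pinf[OF sm _ _ B0 B1] by simp_all
    show "CD_pair sigma_coeff m K 1 (uniform_measure m A) (uniform_measure m (ball b (\<delta> n)))"
      by (rule CD) (use UA UB A(2) Bn in blast)+
    show "z \<in> Z n" if "\<And>\<eta>. 0 < \<eta> \<Longrightarrow> \<exists>x\<in>A. \<exists>y\<in>ball b (\<delta> n).
        (dist x z)\<^sup>2 / (1 - l) + (dist z y)\<^sup>2 / (1 - (1 - l)) < (dist x y)\<^sup>2 + \<eta>" for z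
      using that[of "(\<delta> n)\<^sup>2"] \<delta>(1)[of n] unfolding Z_def by auto
    show "c \<le> sigma_coeff K 1 (1 - (1 - l)) (dist x y)" if "x \<in> A" "y \<in> ball b (\<delta> n)" for x y
      using c[of x y] that \<delta>(2)[of n] by auto
  qed (use l Zo in auto)
  have dec: "decseq Z"
    unfolding decseq_def
  proof (intro allI impI subsetI)
    fix k n z assume "k \<le> n" "z \<in> Z n"
    then obtain x y where xy: "x \<in> A" "y \<in> ball b (\<delta> n)"
      "(dist x z)\<^sup>2 / (1 - l) + (dist z y)\<^sup>2 / (1 - (1 - l)) < (dist x y)\<^sup>2 + (\<delta> n)\<^sup>2"
      unfolding Z_def by blast
    have "(\<delta> n)\<^sup>2 \<le> (\<delta> k)\<^sup>2" using \<delta>dec[OF \<open>k \<le> n\<close>] \<delta>(1)[of n] by (intro power_mono) auto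
    then show "z \<in> Z k" using xy \<delta>dec[OF \<open>k \<le> n\<close>] unfolding Z_def
      by (intro UN_I[of x] UN_I[of y]) auto
  qed
  have sub2: "(\<Inter>n. Z n) \<subseteq> contr b l A"
    unfolding contr_def
  proof (intro subsetI CollectI allI impI)
    fix z and e :: real assume z: "z \<in> (\<Inter>n. Z n)" and "0 < e"
    have "\<forall>\<^sub>F n in sequentially. \<delta> n < e / 8"
      using \<delta>lim \<open>0 < e\<close> by (intro order_tendstoD) auto
    then obtain n where n: "\<delta> n < e / 8" by (auto simp: eventually_sequentially)
    obtain x y where xy: "x \<in> A" "y \<in> ball b (\<delta> n)"
      "\<bar>dist z y - (1 - (1 - l)) * dist x y\<bar> \<le> 2 * \<delta> n" "\<bar>dist x z - (1 - l) * dist x y\<bar> \<le> 2 * \<delta> n"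
      using ZI[of z n] z by blast
    have zb: "\<bar>dist z y - dist z b\<bar> \<le> \<delta> n" and xb: "\<bar>dist x y - dist x b\<bar> \<le> \<delta> n"
      using xy(2) dist_triangle[of z y b] dist_triangle[of z b y] dist_triangle[of x y b] dist_triangle[of x b y]
      by (auto simp: dist_commute)
    have sc: "\<bar>u * dist x y - u * dist x b\<bar> \<le> \<delta> n" if "0 \<le> u" "u \<le> 1" for u
    proof -
      have "\<bar>u * dist x y - u * dist x b\<bar> = u * \<bar>dist x y - dist x b\<bar>"
        using that by (simp flip: right_diff_distrib add: abs_mult)
      also have "\<dots> \<le> 1 * \<delta> n" using that xb by (intro mult_mono) auto
      finally show ?thesis by simp
    qed
    have "\<bar>dist z b - l * dist x b\<bar> < e"
      using xy(3) zb sc[of l] n l \<delta>(1)[of n] by (simp add: abs_le_iff abs_less_iff)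
    moreover have "\<bar>dist x z - (1 - l) * dist x b\<bar> < e"
      using xy(4) sc[of "1 - l"] n l \<delta>(1)[of n] by (auto simp: abs_le_iff abs_less_iff)
    ultimately show "\<exists>x\<in>A. \<bar>dist z b - l * dist x b\<bar> < e \<and> \<bar>dist x z - (1 - l) * dist x b\<bar> < e"
      using xy(1) by blast
  qed
  have "c * emeasure m A \<le> (INF n. emeasure m (Z n))" by (intro INF_greatest main)
  also have "\<dots> = emeasure m (\<Inter>n. Z n)"
    by (intro INF_emeasure_decseq dec) (use Zo less_imp_neq[OF finb[OF Zr]] sm in auto)
  also have "\<dots> \<le> emeasure m (contr b l A)"
    by (rule emeasure_mono[OF sub2]) (simp add: sm borel_closed closed_contr)
  finally show ?thesis .
qed simp


section \<open>Geodesic spaces without branching\<close>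

definition geodesic_in :: "'a::metric_space set \<Rightarrow> real \<Rightarrow> (real \<Rightarrow> 'a) \<Rightarrow> bool" where
  "geodesic_in E l \<sigma> \<longleftrightarrow> 0 \<le> l \<and> (\<forall>s\<in>{0..l}. \<sigma> s \<in> E) \<and> (\<forall>s\<in>{0..l}. \<forall>t\<in>{0..l}. dist (\<sigma> s) (\<sigma> t) = \<bar>s - t\<bar>)"

lemma geodesic_inD:
  assumes "geodesic_in E l \<sigma>"
  shows "0 \<le> l" "\<And>s. 0 \<le> s \<Longrightarrow> s \<le> l \<Longrightarrow> \<sigma> s \<in> E"
    "\<And>s t. 0 \<le> s \<Longrightarrow> s \<le> l \<Longrightarrow> 0 \<le> t \<Longrightarrow> t \<le> l \<Longrightarrow> dist (\<sigma> s) (\<sigma> t) = \<bar>s - t\<bar>"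
  using assms unfolding geodesic_in_def by auto

lemma geodesic_in_continuous_on:
  assumes "geodesic_in E l \<sigma>" shows "continuous_on {0..l} \<sigma>"
  unfolding continuous_on_iff
  using geodesic_inD(3)[OF assms] by (auto simp: dist_real_def intro!: exI)

lemma geodesic_in_compact: "geodesic_in E l \<sigma> \<Longrightarrow> compact (\<sigma> ` {0..l})"
  by (intro compact_continuous_image geodesic_in_continuous_on) auto

text \<open>A space that is locally geodesic and in which no point has three transversal directions
  is locally an interval. The condition \<open>no_tripod\<close> forces every point close to the interior of a
  geodesic to lie on it, since otherwise its nearest point on the geodesic would be a branch point.\<close>

locale no_branching =
  fixes E :: "'a::metric_space set" and p y :: 'a and l r1 :: real
  assumes geodesics: "\<And>a b. a \<in> E \<Longrightarrow> b \<in> E \<Longrightarrow> dist p a < r1 \<Longrightarrow> dist p b < r1 \<Longrightarrow>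
      \<exists>\<sigma>. geodesic_in E (dist a b) \<sigma> \<and> \<sigma> 0 = a \<and> \<sigma> (dist a b) = b"
    and no_tripod: "\<And>c. c \<in> E \<Longrightarrow> dist p c < r1 \<Longrightarrow> \<exists>s0>0. \<forall>s u v w. 0 < s \<longrightarrow> s < s0 \<longrightarrow>
      u \<in> E \<longrightarrow> v \<in> E \<longrightarrow> w \<in> E \<longrightarrow> dist c u = s \<longrightarrow> dist c v = s \<longrightarrow> dist c w = s \<longrightarrow>
      s \<le> dist u v \<longrightarrow> s \<le> dist u w \<longrightarrow> s \<le> dist v w \<longrightarrow> False"
    and p: "p \<in> E" and y: "y \<in> E" "dist p y = l" and l: "0 < l" "8 * l \<le> r1"
    and compact_E: "compact (E \<inter> cball p (l / 4))"
begin

text \<open>The origin of the factor 8 in the locale: such a geodesic is shorter than 4 l and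
  therefore stays within 6 l of p, where \<open>geodesics\<close> and \<open>no_tripod\<close> are
  available.\<close>

lemma geodesic_bound:
  assumes "geodesic_in E h \<sigma>" "dist p (\<sigma> 0) < 2 * l" "dist p (\<sigma> h) < 2 * l" "0 \<le> s" "s \<le> h"
  shows "dist p (\<sigma> s) < r1"
proof -
  have h: "h = dist (\<sigma> 0) (\<sigma> h)" "dist (\<sigma> 0) (\<sigma> s) = s"
    using geodesic_inD(3)[OF assms(1), of 0 h] geodesic_inD(3)[OF assms(1), of 0 s] geodesic_inD(1)[OF assms(1)] assms by auto
  have "dist (\<sigma> 0) (\<sigma> h) < 4 * l"
    using dist_triangle[of "\<sigma> 0" "\<sigma> h" p] assms by (simp add: dist_commute)
  then show ?thesis
    using dist_triangle[of p "\<sigma> s" "\<sigma> 0"] h assms l by linarith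
qed

text \<open>The factor 2 keeps the foot point away from the ends: it differs from s by at most twice
  the distance of q to \<open>\<sigma> s\<close>. The third leg is transversal because a point of
  \<sigma> closer than \<tau> to \<open>\<beta> \<tau>\<close> would be closer to q than the foot
  point.\<close>

lemma near_interior:
  assumes \<sigma>: "geodesic_in E h \<sigma>" "dist p (\<sigma> 0) < 2 * l" "dist p (\<sigma> h) < 2 * l" and s: "0 < s" "s < h"
    and q: "q \<in> E" "dist p q < r1" "2 * dist q (\<sigma> s) < min s (h - s)"
  shows "q \<in> \<sigma> ` {0..h}"
proof (rule ccontr)
  assume q\<sigma>: "q \<notin> \<sigma> ` {0..h}"
  have "{0..h} \<noteq> {}" using s by auto
  moreover have "continuous_on {0..h} (\<lambda>t. dist q (\<sigma> t))"
    by (intro continuous_intros geodesic_in_continuous_on[OF \<sigma>(1)])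
  ultimately obtain s' where s': "0 \<le> s'" "s' \<le> h" and near: "\<And>t. 0 \<le> t \<Longrightarrow> t \<le> h \<Longrightarrow> dist q (\<sigma> s') \<le> dist q (\<sigma> t)"
    using continuous_attains_inf[of "{0..h}" "\<lambda>t. dist q (\<sigma> t)"] by auto
  let ?c = "\<sigma> s'" and ?\<eta> = "dist (\<sigma> s') q"
  note g = geodesic_inD[OF \<sigma>(1)]
  have "\<bar>s' - s\<bar> = dist ?c (\<sigma> s)" using g(3) s s' by auto
  also have "\<dots> \<le> 2 * dist q (\<sigma> s)"
    using dist_triangle[of ?c "\<sigma> s" q] near[of s] s by (simp add: dist_commute)
  finally have s'i: "0 < s'" "s' < h" using q(3) by auto
  have \<eta>: "0 < ?\<eta>" using q\<sigma> s' by auto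
  have c: "?c \<in> E" "dist p ?c < r1" using g s' geodesic_bound[OF \<sigma>] by auto
  obtain \<beta> where \<beta>: "geodesic_in E ?\<eta> \<beta>" "\<beta> 0 = ?c" "\<beta> ?\<eta> = q"
    using geodesics[OF c(1) q(1) c(2) q(2)] by blast
  note b = geodesic_inD[OF \<beta>(1)]
  obtain s0 where s0: "0 < s0" "\<And>s u v w. 0 < s \<Longrightarrow> s < s0 \<Longrightarrow>
      u \<in> E \<Longrightarrow> v \<in> E \<Longrightarrow> w \<in> E \<Longrightarrow> dist ?c u = s \<Longrightarrow> dist ?c v = s \<Longrightarrow> dist ?c w = s \<Longrightarrow>
      s \<le> dist u v \<Longrightarrow> s \<le> dist u w \<Longrightarrow> s \<le> dist v w \<Longrightarrow> False"
    using no_tripod[OF c] by blast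
  define \<tau> where "\<tau> = min (min s0 ?\<eta>) (min s' (h - s')) / 2"
  have "0 < \<tau> \<and> \<tau> < s0 \<and> \<tau> < ?\<eta> \<and> \<tau> < s' \<and> \<tau> < h - s'"
    using s0(1) \<eta> s'i by (simp add: \<tau>_def min_less_iff_disj)
  then have \<tau>: "0 < \<tau>" "\<tau> < s0" "\<tau> < ?\<eta>" "\<tau> < s'" "\<tau> < h - s'" by blast+
  have w: "\<tau> \<le> dist (\<sigma> t) (\<beta> \<tau>)" if "0 \<le> t" "t \<le> h" for t
    using near[OF that] dist_triangle[of q "\<sigma> t" "\<beta> \<tau>"] b(3)[of \<tau> ?\<eta>] \<beta> \<tau> by (simp add: dist_commute)
  show False
  proof (rule s0(2)[of \<tau> "\<sigma> (s' - \<tau>)" "\<sigma> (s' + \<tau>)" "\<beta> \<tau>"])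
    show "dist ?c (\<beta> \<tau>) = \<tau>" using b(3)[of 0 \<tau>] \<beta> \<tau> by simp
  qed (use \<tau> s'i g(2,3) b(2) w in auto)
qed

text \<open>Connectedness of the parameter interval. The times at which \<omega> lies on \<sigma>
  form a closed set by compactness, and by \<open>near_interior\<close> this set is also open as
  long as \<omega> avoids both ends of \<sigma>.\<close>

lemma geodesic_exits_at_endpoint:
  assumes \<sigma>: "geodesic_in E h \<sigma>" "dist p (\<sigma> 0) < 2 * l" "dist p (\<sigma> h) < 2 * l"
    and \<omega>: "geodesic_in E k \<omega>" "dist p (\<omega> 0) < 2 * l" "dist p (\<omega> k) < 2 * l"
    and s: "\<omega> 0 = \<sigma> s" "0 < s" "s < h"
  shows "\<omega> ` {0..k} \<subseteq> \<sigma> ` {0..h} \<or> \<sigma> 0 \<in> \<omega> ` {0..k} \<or> \<sigma> h \<in> \<omega> ` {0..k}"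
proof (rule ccontr)
  assume "\<not> ?thesis"
  then have no: "\<not> \<omega> ` {0..k} \<subseteq> \<sigma> ` {0..h}" "\<sigma> 0 \<notin> \<omega> ` {0..k}" "\<sigma> h \<notin> \<omega> ` {0..k}" by auto
  define T where "T = {0..k} \<inter> \<omega> -` (\<sigma> ` {0..h})"
  have "closedin (top_of_set {0..k}) T"
    unfolding T_def
    by (intro continuous_closedin_preimage geodesic_in_continuous_on[OF \<omega>(1)] compact_imp_closed geodesic_in_compact[OF \<sigma>(1)])
  moreover have "openin (top_of_set {0..k}) T"
    unfolding openin_euclidean_subtopology_iff
  proof (intro conjI ballI)
    show "T \<subseteq> {0..k}" by (auto simp: T_def)
    fix \<tau> assume "\<tau> \<in> T"
    then obtain s' where s': "0 \<le> s'" "s' \<le> h" "\<omega> \<tau> = \<sigma> s'" and \<tau>: "0 \<le> \<tau>" "\<tau> \<le> k" by (auto simp: T_def)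
    then have "s' \<noteq> 0" "s' \<noteq> h" using no by force+
    then have s'': "0 < s'" "s' < h" using s' by auto
    show "\<exists>e>0. \<forall>x'\<in>{0..k}. dist x' \<tau> < e \<longrightarrow> x' \<in> T"
    proof (intro exI conjI ballI impI)
      show "0 < min s' (h - s') / 2" using s'' by auto
      fix x' assume x': "x' \<in> {0..k}" "dist x' \<tau> < min s' (h - s') / 2"
      have "dist (\<omega> x') (\<sigma> s') = dist x' \<tau>"
        using geodesic_inD(3)[OF \<omega>(1), of x' \<tau>] x' \<tau> s'(3) by (simp add: dist_real_def)
      then have "\<omega> x' \<in> \<sigma> ` {0..h}"
        using x' geodesic_inD(2)[OF \<omega>(1), of x'] geodesic_bound[OF \<omega>, of x']
        by (intro near_interior[OF \<sigma> s'']) auto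
      then show "x' \<in> T" using x' by (simp add: T_def)
    qed
  qed
  ultimately have "T = {} \<or> T = {0..k}"
    using connected_Icc[of 0 k] unfolding connected_clopen by blast
  moreover have "0 \<in> T" using s geodesic_inD(1)[OF \<omega>(1)] by (auto simp: T_def)
  ultimately have "T = {0..k}" by blast
  then show False using no(1) unfolding T_def by blast
qed

text \<open>The coordinate is the signed distance from p, positive along a geodesic \<gamma> from p
  to y and negative off it. Two facts make it an isometry: geodesics from \<gamma> to points off
  \<gamma> pass through p, and the points off \<gamma> all lie in a single direction from p.\<close>

lemma interval:
  obtains \<alpha> \<psi> where "\<alpha> \<le> 0" "\<And>s. s \<in> {\<alpha>..l/4} \<Longrightarrow> \<psi> s \<in> E"
    "\<And>s t. s \<in> {\<alpha>..l/4} \<Longrightarrow> t \<in> {\<alpha>..l/4} \<Longrightarrow> dist (\<psi> s) (\<psi> t) = \<bar>s - t\<bar>"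
    "\<psi> ` {\<alpha>..l/4} = E \<inter> cball p (l/4)" "\<psi> 0 = p"
proof -
  define r where "r = l / 4"
  have r: "0 < r" "r < l / 2" using l by (auto simp: r_def)
  define X where "X = E \<inter> cball p r"
  have X: "q \<in> X \<longleftrightarrow> q \<in> E \<and> dist p q \<le> r" for q by (simp add: X_def)
  obtain \<gamma> where \<gamma>: "geodesic_in E l \<gamma>" "\<gamma> 0 = p" "\<gamma> l = y"
    using geodesics[OF p y(1)] y(2) l by auto
  note g = geodesic_inD[OF \<gamma>(1)]
  have gp: "dist p (\<gamma> s) = s" if "0 \<le> s" "s \<le> l" for s using g(3)[of 0 s] that \<gamma> by simp
  have \<gamma>e: "dist p (\<gamma> 0) < 2 * l" "dist p (\<gamma> l) < 2 * l" using \<gamma> y l by auto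
  have thru: "p \<in> \<omega> ` {0..h}" "dist q (\<gamma> s) = dist q p + s"
    if q: "q \<in> X" "q \<notin> \<gamma> ` {0..l}" and s: "0 < s" "s \<le> l/2"
      and \<omega>: "geodesic_in E h \<omega>" "\<omega> 0 = \<gamma> s" "\<omega> h = q" for q s h \<omega>
  proof -
    note o = geodesic_inD[OF \<omega>(1)]
    have h: "h = dist (\<gamma> s) q" using o(3)[of 0 h] o(1) \<omega> by simp
    have e: "dist p (\<omega> 0) < 2 * l" "dist p (\<omega> h) < 2 * l" using gp[of s] s q X r \<omega> l by (auto simp: r_def)
    have "\<omega> ` {0..h} \<subseteq> \<gamma> ` {0..l} \<or> \<gamma> 0 \<in> \<omega> ` {0..h} \<or> \<gamma> l \<in> \<omega> ` {0..h}"
      by (rule geodesic_exits_at_endpoint[OF \<gamma>(1) \<gamma>e \<omega>(1) e \<omega>(2)]) (use s l in auto)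
    moreover have "q \<in> \<omega> ` {0..h}" using \<omega>(3) o(1) by (intro image_eqI[of _ _ h]) auto
    then have "\<not> \<omega> ` {0..h} \<subseteq> \<gamma> ` {0..l}" using q(2) by blast
    \<comment> \<open>Leaving \<gamma> at the end y would make \<omega> too long: at least (l - s) +
      (l - r), whereas its length is at most s + r, with s <= l/2 and r = l/4.\<close>
    moreover have "\<gamma> l \<notin> \<omega> ` {0..h}"
    proof
      assume "\<gamma> l \<in> \<omega> ` {0..h}"
      then obtain \<tau> where \<tau>: "0 \<le> \<tau>" "\<tau> \<le> h" "\<omega> \<tau> = y" using \<gamma> by auto
      have "\<tau> = l - s" using o(3)[of 0 \<tau>] \<tau> \<omega> g(3)[of s l] s \<gamma> by auto
      moreover have "h - \<tau> = dist y q" using o(3)[of \<tau> h] \<tau> \<omega> by auto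
      moreover have "dist y q \<ge> l - r" using dist_triangle[of p y q] y q X by (auto simp: dist_commute)
      moreover have "h \<le> s + r" using h dist_triangle[of "\<gamma> s" q p] gp[of s] s q X by (auto simp: dist_commute)
      ultimately show False using s r l by (simp add: r_def)
    qed
    ultimately show pin: "p \<in> \<omega> ` {0..h}" using \<gamma> by simp
    then obtain \<tau> where \<tau>: "0 \<le> \<tau>" "\<tau> \<le> h" "\<omega> \<tau> = p" by auto
    have "\<tau> = s" using o(3)[of 0 \<tau>] \<tau> \<omega> gp[of s] s by (auto simp: dist_commute)
    moreover have "h - \<tau> = dist q p" using o(3)[of \<tau> h] \<tau> \<omega> by (auto simp: dist_commute)
    ultimately show "dist q (\<gamma> s) = dist q p + s" using h by (simp add: dist_commute)
  qed
  have off: "dist q (\<gamma> s) = dist q p + s" if q: "q \<in> X" "q \<notin> \<gamma> ` {0..l}" and s: "0 \<le> s" "s \<le> l/2" for q s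
  proof (cases "s = 0")
    case False
    have "dist p q < r1" using q X r l by (auto simp: r_def)
    moreover have "dist p (\<gamma> s) < r1" using gp[of s] s l by auto
    ultimately obtain \<omega> where "geodesic_in E (dist (\<gamma> s) q) \<omega>" "\<omega> 0 = \<gamma> s" "\<omega> (dist (\<gamma> s) q) = q"
      using geodesics[of "\<gamma> s" q] g(2)[of s] q X s l by auto
    then show ?thesis using thru(2)[OF q _ s(2)] False s by auto
  qed (use \<gamma> in simp)
  \<comment> \<open>The point p is only an end of \<gamma>, so the exit lemma is applied to a
    geodesic \<sigma> from \<open>\<gamma> (l/2)\<close> to q, which has p in its interior by
    \<open>thru\<close>. Of the three alternatives, reaching \<open>\<gamma> (l/2)\<close> from p is
    impossible within distance r.\<close>
  have off2: "dist q q' = \<bar>dist p q - dist p q'\<bar>"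
    if q: "q \<in> X" "q \<notin> \<gamma> ` {0..l}" and q': "q' \<in> X" "q' \<notin> \<gamma> ` {0..l}" for q q'
  proof -
    have l2: "0 < l/2" "l/2 \<le> l" using l by auto
    have qr: "dist p q < r1" "dist p q' < r1" "dist p q < 2 * l" "dist p q' < 2 * l"
      using q q' X r l by (auto simp: r_def)
    define h where "h = dist (\<gamma> (l/2)) q"
    obtain \<sigma> where \<sigma>: "geodesic_in E h \<sigma>" "\<sigma> 0 = \<gamma> (l/2)" "\<sigma> h = q"
      using geodesics[of "\<gamma> (l/2)" q] g(2)[of "l/2"] gp[of "l/2"] q X l qr unfolding h_def by auto
    note sg = geodesic_inD[OF \<sigma>(1)]
    have h: "h = dist q p + l/2" using thru(2)[OF q l2(1) order_refl \<sigma>] by (simp add: h_def dist_commute)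
    obtain \<tau> where \<tau>: "0 \<le> \<tau>" "\<tau> \<le> h" "\<sigma> \<tau> = p" using thru(1)[OF q l2(1) order_refl \<sigma>] by auto
    have "\<tau> = l/2" using sg(3)[of 0 \<tau>] \<tau> \<sigma> gp[of "l/2"] l2 by (auto simp: dist_commute)
    then have \<sigma>p: "\<sigma> (l/2) = p" using \<tau>(3) by blast
    have "q \<noteq> p" using q \<gamma>(2) l by force
    then have l2h: "l/2 < h" using h by simp
    obtain \<omega> where \<omega>: "geodesic_in E (dist p q') \<omega>" "\<omega> 0 = p" "\<omega> (dist p q') = q'"
      using geodesics[OF p, of q'] q' X qr l by auto
    note o = geodesic_inD[OF \<omega>(1)]
    have "\<omega> ` {0..dist p q'} \<subseteq> \<sigma> ` {0..h} \<or> \<sigma> 0 \<in> \<omega> ` {0..dist p q'} \<or> \<sigma> h \<in> \<omega> ` {0..dist p q'}"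
      by (rule geodesic_exits_at_endpoint[OF \<sigma>(1) _ _ \<omega>(1), where s = "l/2"]) (use \<sigma>(2,3) \<omega>(2,3) \<sigma>p l2 l2h gp[of "l/2"] qr l in \<open>simp_all\<close>)
    moreover have "q' \<in> \<omega> ` {0..dist p q'}" using \<omega>(3) by (intro image_eqI[of _ _ "dist p q'"]) auto
    ultimately consider "q' \<in> \<sigma> ` {0..h}" | "\<sigma> 0 \<in> \<omega> ` {0..dist p q'}" | "\<sigma> h \<in> \<omega> ` {0..dist p q'}"
      by blast
    then show ?thesis
    proof cases
      case 1
      then obtain \<tau> where \<tau>: "0 \<le> \<tau>" "\<tau> \<le> h" "\<sigma> \<tau> = q'" by auto
      have "dist p q' = \<bar>l/2 - \<tau>\<bar>" "dist q' q = h - \<tau>" "dist (\<gamma> (l/2)) q' = \<tau>"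
        using sg(3)[of "l/2" \<tau>] sg(3)[of \<tau> h] sg(3)[of 0 \<tau>] \<tau> \<sigma> \<sigma>p l2 l2h by auto
      moreover have "dist q' (\<gamma> (l/2)) = dist q' p + l/2" using off[OF q', of "l/2"] l2 by simp
      ultimately show ?thesis using h \<tau>(2) by (simp add: dist_commute)
    next
      case 2
      then obtain \<tau> where \<tau>: "0 \<le> \<tau>" "\<tau> \<le> dist p q'" "\<omega> \<tau> = \<gamma> (l/2)" using \<sigma> by auto
      then have "\<tau> = l/2" using o(3)[of 0 \<tau>] \<omega> gp[of "l/2"] l2 by auto
      then show ?thesis using \<tau> q' X r by auto
    next
      case 3
      then obtain \<tau> where \<tau>: "0 \<le> \<tau>" "\<tau> \<le> dist p q'" "\<omega> \<tau> = q" using \<sigma> by auto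
      then have "dist p q = \<tau>" "dist q q' = dist p q' - \<tau>"
        using o(3)[of 0 \<tau>] o(3)[of \<tau> "dist p q'"] \<omega> by auto
      then show ?thesis using \<tau> by simp
    qed
  qed
  define \<phi> where "\<phi> q = (if q \<in> \<gamma> ` {0..l} then dist p q else - dist p q)" for q
  have on: "\<exists>s. 0 \<le> s \<and> s \<le> r \<and> q = \<gamma> s \<and> \<phi> q = s" if "q \<in> X" "q \<in> \<gamma> ` {0..l}" for q
    using that X gp by (auto simp: \<phi>_def)
  have iso: "dist q q' = \<bar>\<phi> q - \<phi> q'\<bar>" if q: "q \<in> X" and q': "q' \<in> X" for q q'
  proof -
    have mixed: "dist a b = \<bar>\<phi> a - \<phi> b\<bar>" if ab: "a \<in> X" "b \<in> X" "a \<in> \<gamma> ` {0..l}" "b \<notin> \<gamma> ` {0..l}" for a b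
    proof -
      obtain s where s: "0 \<le> s" "s \<le> r" "a = \<gamma> s" "\<phi> a = s" using on ab by blast
      have "dist b a = dist b p + s" using off[OF ab(2,4), of s] s r by simp
      then show ?thesis using ab s by (simp add: \<phi>_def dist_commute)
    qed
    consider "q \<in> \<gamma> ` {0..l}" "q' \<in> \<gamma> ` {0..l}" | "q \<in> \<gamma> ` {0..l}" "q' \<notin> \<gamma> ` {0..l}"
      | "q \<notin> \<gamma> ` {0..l}" "q' \<in> \<gamma> ` {0..l}" | "q \<notin> \<gamma> ` {0..l}" "q' \<notin> \<gamma> ` {0..l}" by blast
    then show ?thesis
    proof cases
      case 1
      then obtain s s' where "0 \<le> s" "s \<le> r" "q = \<gamma> s" "\<phi> q = s" "0 \<le> s'" "s' \<le> r" "q' = \<gamma> s'" "\<phi> q' = s'"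
        using on q q' by metis
      then show ?thesis using g(3)[of s s'] r l by simp
    next
      case 2 then show ?thesis using mixed[of q q'] q q' by simp
    next
      case 3 then show ?thesis using mixed[of q' q] q q' by (simp add: dist_commute abs_minus_commute)
    next
      case 4 then show ?thesis using off2[OF q _ q'] by (simp add: \<phi>_def)
    qed
  qed
  have inj: "inj_on \<phi> X"
    by (rule inj_onI) (use iso in force)
  have "continuous_on X \<phi>"
    unfolding continuous_on_iff dist_real_def using iso by (auto intro!: exI)
  moreover have "compact X" using compact_E by (simp add: X_def r_def)
  ultimately have cJ: "compact (\<phi> ` X)" by (rule compact_continuous_image)
  have pX: "p \<in> X" using p r by (simp add: X)
  have \<phi>p: "\<phi> p = 0" using \<gamma>(2) l by (force simp: \<phi>_def)
  have pos: "s \<in> \<phi> ` X" if "0 \<le> s" "s \<le> r" for s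
  proof -
    have "\<gamma> s \<in> X" "\<phi> (\<gamma> s) = s" using that g(2)[of s] gp[of s] r l by (auto simp: X \<phi>_def)
    then show ?thesis by force
  qed
  \<comment> \<open>The negative side has no gaps: the geodesic from p to a point of it cannot
    return to \<gamma>, because \<open>off\<close> would then add distances where they have to be
    subtracted.\<close>
  have neg: "- \<tau> \<in> \<phi> ` X" if q: "q \<in> X" "\<phi> q < 0" and \<tau>: "0 < \<tau>" "\<tau> \<le> - \<phi> q" for q \<tau>
  proof -
    have q\<gamma>: "q \<notin> \<gamma> ` {0..l}" "\<phi> q = - dist p q" using q by (auto simp: \<phi>_def split: if_splits)
    have "dist p q < r1" using q X r l by (auto simp: r_def)
    then obtain \<omega> where \<omega>: "geodesic_in E (dist p q) \<omega>" "\<omega> 0 = p" "\<omega> (dist p q) = q"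
      using geodesics[OF p, of q] q X l by auto
    note o = geodesic_inD[OF \<omega>(1)]
    have d: "dist p (\<omega> \<tau>) = \<tau>" "dist (\<omega> \<tau>) q = dist p q - \<tau>"
      using o(3)[of 0 \<tau>] o(3)[of \<tau> "dist p q"] \<tau> q\<gamma> \<omega> by auto
    have \<omega>X: "\<omega> \<tau> \<in> X" using o(2)[of \<tau>] d \<tau> q\<gamma> q by (auto simp: X)
    have "\<omega> \<tau> \<notin> \<gamma> ` {0..l}"
    proof
      assume "\<omega> \<tau> \<in> \<gamma> ` {0..l}"
      then obtain s where s: "0 \<le> s" "s \<le> r" "\<omega> \<tau> = \<gamma> s" using on[OF \<omega>X] by blast
      then have "dist q (\<omega> \<tau>) = dist q p + s" using off[OF q(1) q\<gamma>(1), of s] r by simp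
      then show False using d \<tau> s by (simp add: dist_commute)
    qed
    then have "\<phi> (\<omega> \<tau>) = - \<tau>" using d by (simp add: \<phi>_def)
    then show ?thesis using \<omega>X by force
  qed
  obtain q0 where q0: "q0 \<in> X" "\<And>q. q \<in> X \<Longrightarrow> \<phi> q0 \<le> \<phi> q"
    using compact_attains_inf[OF cJ] pX by blast
  define \<alpha> where "\<alpha> = \<phi> q0"
  have \<alpha>: "\<alpha> \<le> 0" using q0(2)[OF pX] \<phi>p by (simp add: \<alpha>_def)
  have J: "\<phi> ` X = {\<alpha>..r}"
  proof
    have "\<phi> q \<le> r" if "q \<in> X" for q
    proof -
      have "- dist p q \<le> r" using zero_le_dist[of p q] r(1) by linarith
      then show ?thesis using that by (simp add: \<phi>_def X)
    qed
    then show "\<phi> ` X \<subseteq> {\<alpha>..r}" using q0(2) unfolding \<alpha>_def by auto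
    show "{\<alpha>..r} \<subseteq> \<phi> ` X"
    proof
      fix s assume s: "s \<in> {\<alpha>..r}"
      show "s \<in> \<phi> ` X"
      proof (cases "0 \<le> s")
        case True then show ?thesis using pos s by auto
      next
        case False
        then show ?thesis using neg[of q0 "- s"] q0(1) s by (auto simp: \<alpha>_def)
      qed
    qed
  qed
  show ?thesis
  proof (rule that[of \<alpha> "inv_into X \<phi>"], unfold r_def[symmetric])
    have *: "inv_into X \<phi> s \<in> X" "\<phi> (inv_into X \<phi> s) = s" if "s \<in> {\<alpha>..r}" for s
      using that J inv_into_into[of s \<phi> X] f_inv_into_f[of s \<phi> X] by auto
    show "inv_into X \<phi> s \<in> E" if "s \<in> {\<alpha>..r}" for s using * that by (simp add: X)
    show "dist (inv_into X \<phi> s) (inv_into X \<phi> t) = \<bar>s - t\<bar>" if "s \<in> {\<alpha>..r}" "t \<in> {\<alpha>..r}" for s t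
      using * iso that by simp
    have "inv_into X \<phi> ` {\<alpha>..r} = X" using inv_into_image_cancel[OF inj order_refl] J by simp
    then show "inv_into X \<phi> ` {\<alpha>..r} = E \<inter> cball p r" by (simp add: X_def)
    show "inv_into X \<phi> 0 = p" using inv_into_f_f[OF inj pX] \<phi>p by simp
  qed (fact \<alpha>)
qed

end


section \<open>The structure of spaces with exponent one\<close>

text \<open>The measure M will be m cut off to a small ball, and k the negative part of the
  curvature bound. The condition on k and R makes the distortion in \<open>ball p R\<close> at most
  one percent, which leaves room for all numerical estimates; the precise quadratic error matters
  only for the constancy of the density.\<close>

locale contracting = finite_measure M for M :: "'a::polish_space measure" +
  fixes p :: 'a and R k :: real
  assumes sets_M [measurable_cong, simp]: "sets M = sets borel"
    and R: "0 < R" and k: "0 \<le> k" "k * (2 * R)\<^sup>2 \<le> 1 / 100"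
    and p: "p \<in> msupport M"
    and contraction_le: "\<And>A b l D. A \<in> sets borel \<Longrightarrow> closure A \<subseteq> ball p R \<Longrightarrow> b \<in> msupport M \<Longrightarrow>
      b \<in> ball p R \<Longrightarrow> 0 < l \<Longrightarrow> l < 1 \<Longrightarrow> 0 < D \<Longrightarrow> (\<And>x. x \<in> A \<Longrightarrow> dist x b \<le> D) \<Longrightarrow>
      l * (1 - k * D\<^sup>2) * measure M A \<le> measure M (contr b l A)"
begin

abbreviation "E \<equiv> msupport M"

lemma closed_E: "closed E"
  by (rule closed_msupport) simp

lemma space_M [simp]: "space M = UNIV"
  using sets_eq_imp_space_eq[OF sets_M] by simp

lemma measure_pos_meets_E:
  assumes "0 < measure M A" obtains z where "z \<in> A" "z \<in> E"
proof -
  have "- E \<in> null_sets M"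
    using AE_msupport[OF sets_M] closed_E by (auto simp: AE_iff_null_sets borel_open open_Compl)
  moreover have "A \<in> sets M" using assms measure_notin_sets[of A M] by (metis less_irrefl)
  ultimately have "measure M A = 0" if "A \<subseteq> - E" using that null_sets_subset
    by (metis measure_eq_0_null_sets)
  then have "\<not> A \<subseteq> - E" using assms by auto
  then show ?thesis using that by blast
qed

lemma measure_ball_pos: "z \<in> E \<Longrightarrow> 0 < r \<Longrightarrow> 0 < measure M (ball z r)"
  by (auto simp: msupport_def emeasure_eq_measure)

lemma contraction_99:
  assumes "A \<in> sets borel" "closure A \<subseteq> ball p R" "b \<in> E" "b \<in> ball p R" "0 < l" "l < 1"
  shows "l * (99 / 100) * measure M A \<le> measure M (contr b l A)"
proof -
  have "dist x b \<le> 2 * R" if "x \<in> A" for x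
  proof -
    have "x \<in> ball p R" using that assms(2) closure_subset by blast
    then show ?thesis using dist_triangle[of x b p] assms(4) by (simp add: dist_commute)
  qed
  then have "l * (1 - k * (2 * R)\<^sup>2) * measure M A \<le> measure M (contr b l A)"
    using R by (intro contraction_le assms) auto
  moreover have "l * (99 / 100) * measure M A \<le> l * (1 - k * (2 * R)\<^sup>2) * measure M A"
    using k assms by (intro mult_right_mono mult_left_mono) auto
  ultimately show ?thesis by linarith
qed

section \<open>Growth of the measure of balls\<close>

lemma closure_ball_subset: "dist p z + r < R \<Longrightarrow> closure (ball z r) \<subseteq> ball p R"
proof -
  assume a: "dist p z + r < R"
  have "closure (ball z r) \<subseteq> cball z r" by (intro closure_minimal) auto
  also have "\<dots> \<subseteq> ball p R"
  proof
    fix w assume "w \<in> cball z r"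
    then show "w \<in> ball p R" using dist_triangle[of p w z] a by simp
  qed
  finally show ?thesis .
qed

text \<open>Contraction by s/r maps the ball of radius r into the closed ball of radius s. Exponent
  one means that measures scale at least like the first power of the radius.\<close>

lemma bishop_gromov:
  assumes "b \<in> E" "dist p b < R / 2" "0 < s" "s < r" "r \<le> R / 2"
  shows "s / r * (99 / 100) * measure M (ball b r) \<le> measure M (cball b s)"
proof -
  have "s / r * (99 / 100) * measure M (ball b r) \<le> measure M (contr b (s / r) (ball b r))"
    by (rule contraction_99) (use assms R in \<open>auto intro!: closure_ball_subset\<close>)
  also have "\<dots> \<le> measure M (cball b s)"
  proof (rule finite_measure_mono)
    show "contr b (s / r) (ball b r) \<subseteq> cball b s"
    proof
      fix z assume z: "z \<in> contr b (s / r) (ball b r)"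
      have "dist z b \<le> s + e" if "0 < e" for e
      proof -
        obtain x where x: "dist b x < r" "\<bar>dist z b - s / r * dist x b\<bar> < e"
          using z[unfolded contr_def, THEN CollectD, rule_format, OF \<open>0 < e\<close>] by auto
        have "s / r * dist x b \<le> s / r * r" using x assms by (intro mult_left_mono) (auto simp: dist_commute)
        then show ?thesis using x assms by auto
      qed
      then show "z \<in> cball b s" using field_le_epsilon by (auto simp: dist_commute)
    qed
  qed auto
  finally show ?thesis .
qed

text \<open>Contracting the ball towards the distant point y by about 1/(2 h) different factors
  between 1/2 and 1 gives sets of comparable measure. Each occupies a range of distances from y of
  width less than the spacing h * d = 4 \<rho>, so they are disjoint and the total measure bounds
  their number times the measure of the ball. The constant 100 is a round bound for about
  43.\<close>

lemma measure_ball_le: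
  assumes y: "y \<in> E" "dist p y = L" and L: "0 < L" "L \<le> R / 4"
    and c: "dist p c < L / 4" and \<rho>: "0 < \<rho>" "\<rho> \<le> L / 16"
  shows "measure M (ball c \<rho>) \<le> 100 * measure M UNIV / L * \<rho>"
proof -
  define d where "d = dist c y"
  have d: "3 / 4 * L \<le> d" "d \<le> 5 / 4 * L"
    using dist_triangle[of p y c] dist_triangle[of c y p] y c by (auto simp: d_def dist_commute)
  define h where "h = 4 * \<rho> / d"
  have d0: "0 < d" using d L by auto
  have h: "0 < h" "h * d = 4 * \<rho>" using \<rho> d0 by (auto simp: h_def)
  have h3: "h \<le> 1 / 3" using d \<rho> d0 by (simp add: h_def divide_le_eq)
  define n where "n = nat \<lfloor>1 / (2 * h)\<rfloor>"
  have n: "real n \<le> 1 / (2 * h)" "1 / (2 * h) < real n + 1"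
    using h by (auto simp: n_def)
  have "1 \<le> 1 / (2 * h)" using h h3 by (simp add: field_simps)
  \<comment> \<open>Rounding down costs at most a factor 2, because 1/(2 h) is at least 1.\<close>
  then have n2: "1 / (4 * h) \<le> real n"
  proof -
    have "1 \<le> real n" using \<open>1 \<le> 1 / (2 * h)\<close> h by (simp add: n_def le_nat_iff le_floor_iff)
    then have "1 / (2 * h) \<le> 2 * real n" using n by linarith
    then show ?thesis by simp
  qed
  define l where "l j = 1 / 2 + real j * h" for j
  have l: "1 / 2 \<le> l j" "l j < 1" if "j < n" for j
  proof -
    have "real j * h < real n * h" using that h by simp
    also have "\<dots> \<le> 1 / (2 * h) * h" using n h by (intro mult_right_mono) auto
    also have "\<dots> = 1 / 2" using h by simp
    finally show "l j < 1" by (simp add: l_def)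
    show "1 / 2 \<le> l j" using h by (simp add: l_def)
  qed
  define Z where "Z j = contr y (l j) (ball c \<rho>)" for j
  have Z: "l j * (d - \<rho>) \<le> dist z y" "dist z y \<le> l j * (d + \<rho>)" if z: "z \<in> Z j" and j: "j < n" for z j
  proof -
    have *: "l j * (d - \<rho>) - e \<le> dist z y \<and> dist z y \<le> l j * (d + \<rho>) + e" if "0 < e" for e
    proof -
      obtain x where x: "dist c x < \<rho>" "\<bar>dist z y - l j * dist x y\<bar> < e"
        using z \<open>0 < e\<close> unfolding Z_def contr_def by auto
      have "d - \<rho> \<le> dist x y" "dist x y \<le> d + \<rho>"
        using dist_triangle[of c y x] dist_triangle[of x y c] x by (auto simp: d_def dist_commute)
      then have "l j * (d - \<rho>) \<le> l j * dist x y" "l j * dist x y \<le> l j * (d + \<rho>)"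
        using l(1)[OF j] by (auto intro!: mult_left_mono)
      then show ?thesis using x(2) by auto
    qed
    show "l j * (d - \<rho>) \<le> dist z y"
      by (rule field_le_epsilon) (use * in force)
    show "dist z y \<le> l j * (d + \<rho>)"
      by (rule field_le_epsilon) (use * in force)
  qed
  have disj: "Z i \<inter> Z j = {}" if "i < j" "j < n" for i j
  proof (rule ccontr)
    assume "Z i \<inter> Z j \<noteq> {}"
    then obtain z where z: "z \<in> Z i" "z \<in> Z j" by blast
    have "l j * (d - \<rho>) \<le> l i * (d + \<rho>)" using Z[OF z(1)] Z[OF z(2)] that by force
    then have "(l j - l i) * d \<le> (l i + l j) * \<rho>" by (simp add: algebra_simps)
    also have "\<dots> < 2 * \<rho>" using l[of i] l[of j] that \<rho> by (intro mult_strict_right_mono) auto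
    finally have "(real j - real i) * (h * d) < 2 * \<rho>" by (simp add: l_def algebra_simps)
    moreover have "1 * (h * d) \<le> (real j - real i) * (h * d)"
      using that h d0 \<rho> by (intro mult_right_mono) auto
    ultimately show False using h(2) \<rho> by linarith
  qed
  have yR: "y \<in> ball p R" using y L by auto
  have cl: "closure (ball c \<rho>) \<subseteq> ball p R" by (rule closure_ball_subset) (use c \<rho> L in linarith)
  have m: "1 / 2 * (99 / 100) * measure M (ball c \<rho>) \<le> measure M (Z j)" if "j < n" for j
  proof -
    have "1 / 2 * (99 / 100) * measure M (ball c \<rho>) \<le> l j * (99 / 100) * measure M (ball c \<rho>)"
      using l[OF that] by (intro mult_right_mono) auto
    also have "\<dots> \<le> measure M (Z j)" unfolding Z_def
      using l[OF that] by (intro contraction_99 y(1) cl yR) auto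
    finally show ?thesis .
  qed
  have "real n * (1 / 2 * (99 / 100) * measure M (ball c \<rho>)) \<le> (\<Sum>j<n. measure M (Z j))"
    using sum_mono[of "{..<n}" "\<lambda>_. 1 / 2 * (99 / 100) * measure M (ball c \<rho>)" "\<lambda>j. measure M (Z j)"] m by simp
  also have "\<dots> = measure M (\<Union>j<n. Z j)"
  proof (rule finite_measure_finite_Union[symmetric])
    show "disjoint_family_on Z {..<n}"
      unfolding disjoint_family_on_def using disj by (metis Int_commute lessThan_iff linorder_neqE_nat)
  qed (auto simp: Z_def borel_closed closed_contr)
  also have "\<dots> \<le> measure M UNIV" by (intro finite_measure_mono) auto
  finally have "real n * (1 / 2 * (99 / 100) * measure M (ball c \<rho>)) \<le> measure M UNIV" .
  moreover have "1 / (4 * h) * (1 / 2 * (99 / 100) * measure M (ball c \<rho>))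
      \<le> real n * (1 / 2 * (99 / 100) * measure M (ball c \<rho>))"
    using n2 by (intro mult_right_mono) auto
  ultimately have "1 / (4 * h) * (1 / 2 * (99 / 100) * measure M (ball c \<rho>)) \<le> measure M UNIV" by linarith
  then have "measure M (ball c \<rho>) * 99 \<le> measure M UNIV * h * 800" using h by (simp add: field_simps)
  moreover have "measure M UNIV * h * 800 \<le> measure M UNIV * (16 / 3 * \<rho> / L) * 800"
  proof (intro mult_right_mono mult_left_mono)
    have "4 * \<rho> / d \<le> 4 * \<rho> / (3 / 4 * L)" using d L \<rho> by (intro divide_left_mono) auto
    then show "h \<le> 16 / 3 * \<rho> / L" by (simp add: h_def)
  qed auto
  ultimately have "measure M (ball c \<rho>) * 99 \<le> measure M UNIV * (16 / 3 * \<rho> / L) * 800" by linarith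
  moreover have "measure M UNIV * (16 / 3 * \<rho> / L) * 800 \<le> 9900 * (measure M UNIV * (\<rho> / L))"
    using L \<rho> by (simp add: field_simps)
  ultimately show ?thesis by (simp add: field_simps)
qed


text \<open>Otherwise \<open>c\<close> and the three points would carry four disjoint balls of radius about \<open>s/2\<close>
  inside a ball of radius \<open>3 s/2\<close>, each of which has by Bishop-Gromov almost the density at \<open>c\<close>.\<close>

lemma no_tripod:
  assumes y: "y \<in> E" "dist p y = L" and L: "0 < L" "L \<le> R / 4" and c: "c \<in> E" "dist p c < L / 4"
  shows "\<exists>s0>0. \<forall>s u v w. 0 < s \<longrightarrow> s < s0 \<longrightarrow>
      u \<in> E \<longrightarrow> v \<in> E \<longrightarrow> w \<in> E \<longrightarrow> dist c u = s \<longrightarrow> dist c v = s \<longrightarrow> dist c w = s \<longrightarrow>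
      s \<le> dist u v \<longrightarrow> s \<le> dist u w \<longrightarrow> s \<le> dist v w \<longrightarrow> False"
proof -
  define f where "f \<rho> = measure M (ball c \<rho>) / \<rho>" for \<rho>
  \<comment> \<open>The supremum is finite by \<open>measure_ball_le\<close>. A radius P attaining
    it up to one percent serves as reference scale: no ball around c is denser than S, and
    Bishop-Gromov from scale P shows that smaller balls are not much thinner.\<close>
  define S where "S = Sup (f ` {0<..L/16})"
  have ne: "f ` {0<..L/16} \<noteq> {}" using L by auto
  have "f \<rho> \<le> 100 * measure M UNIV / L" if "\<rho> \<in> {0<..L/16}" for \<rho>
    using measure_ball_le[OF y L c(2), of \<rho>] that by (simp add: f_def divide_le_eq)
  then have bdd: "bdd_above (f ` {0<..L/16})" by (intro bdd_aboveI2)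
  have fS: "f \<rho> \<le> S" if "0 < \<rho>" "\<rho> \<le> L/16" for \<rho>
    unfolding S_def using that by (intro cSUP_upper bdd) auto
  have "0 < f (L/16)" using measure_ball_pos[OF c(1)] L by (simp add: f_def)
  also have "f (L/16) \<le> S" using fS L by auto
  finally have S: "0 < S" .
  then have "S / (101 / 100) < S" by simp
  then obtain P where P: "0 < P" "P \<le> L / 16" "S / (101 / 100) < f P"
    using less_cSup_iff[OF ne bdd] unfolding S_def by auto
  have Pm: "S * P * 100 \<le> 101 * measure M (ball c P)" using P by (simp add: f_def field_simps)
  show ?thesis
  proof (intro exI[of _ "P / 100"] conjI allI impI)
    fix s u v w
    assume s: "0 < s" "s < P / 100" and uvw: "u \<in> E" "v \<in> E" "w \<in> E" "dist c u = s" "dist c v = s" "dist c w = s"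
      "s \<le> dist u v" "s \<le> dist u w" "s \<le> dist v w"
    \<comment> \<open>A little less than s/2, so that closed balls around points at distance s are
      disjoint. Because s < P/100, enlarging P by one percent covers \<open>ball c P\<close> from
      every center used, and the losses combine to 49 * 99 / 101^2 > 47/100.\<close>
    let ?t = "49 / 100 * s"
    have lower: "47 / 100 * s * S \<le> measure M (cball z ?t)" if z: "z \<in> E" "dist c z \<le> s" for z
    proof -
      let ?r = "101 / 100 * P"
      have "?t / ?r * (99 / 100) * measure M (ball z ?r) \<le> measure M (cball z ?t)"
      proof (rule bishop_gromov[OF z(1)])
        show "dist p z < R / 2" using dist_triangle[of p z c] z(2) c(2) L s P by linarith
      qed (use s P L in linarith)+
      moreover have "measure M (ball c P) \<le> measure M (ball z ?r)"
      proof (rule finite_measure_mono)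
        show "ball c P \<subseteq> ball z ?r"
        proof
          fix q assume "q \<in> ball c P"
          then show "q \<in> ball z ?r" using dist_triangle[of z q c] z(2) s by (simp add: dist_commute)
        qed
      qed simp
      then have "?t / ?r * (99 / 100) * measure M (ball c P) \<le> ?t / ?r * (99 / 100) * measure M (ball z ?r)"
        using s P by (intro mult_left_mono) auto
      moreover have "47 / 100 * s * S \<le> ?t / ?r * (99 / 100) * measure M (ball c P)"
      proof -
        have "47 / 100 * s * S = 47 / 100 * (s * S)" by simp
        also have "\<dots> \<le> (49 * 99 / (101 * 101)) * (s * S)"
          using s S by (intro mult_right_mono) auto
        also have "\<dots> = ?t / ?r * (99 / 100) * (S * P * 100 / 101)"
          using P by (simp add: field_simps)
        also have "\<dots> \<le> ?t / ?r * (99 / 100) * measure M (ball c P)"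
          using Pm s P by (intro mult_left_mono) auto
        finally show ?thesis .
      qed
      ultimately show ?thesis by linarith
    qed
    have sep: "cball a ?t \<inter> cball b ?t = {}" if "s \<le> dist a b" for a b :: 'a
    proof (rule ccontr)
      assume "cball a ?t \<inter> cball b ?t \<noteq> {}"
      then obtain q where "dist a q \<le> ?t" "dist b q \<le> ?t" by auto
      then show False using dist_triangle[of a b q] that s by (simp add: dist_commute)
    qed
    have fm: "cball z ?t \<in> sets M" for z by (simp add: borel_closed)
    have d: "cball c ?t \<inter> cball u ?t = {}" "(cball c ?t \<union> cball u ?t) \<inter> cball v ?t = {}"
      "(cball c ?t \<union> cball u ?t \<union> cball v ?t) \<inter> cball w ?t = {}"
      using sep uvw by (simp_all add: Int_Un_distrib2)
    have "47 / 100 * s * S \<le> measure M (cball c ?t)" "47 / 100 * s * S \<le> measure M (cball u ?t)"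
      "47 / 100 * s * S \<le> measure M (cball v ?t)" "47 / 100 * s * S \<le> measure M (cball w ?t)"
      by (rule lower; use uvw c s in simp)+
    then have "4 * (47 / 100 * s * S) \<le> measure M (cball c ?t) + measure M (cball u ?t) + measure M (cball v ?t) + measure M (cball w ?t)"
      by linarith
    also have "\<dots> = measure M (cball c ?t \<union> cball u ?t \<union> cball v ?t \<union> cball w ?t)"
      using d fm by (simp add: finite_measure_Union)
    also have "\<dots> \<le> measure M (ball c (3 / 2 * s))"
    proof (rule finite_measure_mono)
      have "cball z ?t \<subseteq> ball c (3 / 2 * s)" if "dist c z \<le> s" for z
      proof
        fix q assume "q \<in> cball z ?t"
        then show "q \<in> ball c (3 / 2 * s)" using dist_triangle[of c q z] that s by simp
      qed
      then show "cball c ?t \<union> cball u ?t \<union> cball v ?t \<union> cball w ?t \<subseteq> ball c (3 / 2 * s)"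
        using uvw s by simp
    qed simp
    also have "\<dots> \<le> S * (3 / 2 * s)"
      using fS[of "3 / 2 * s"] s P by (simp add: f_def divide_le_eq)
    \<comment> \<open>Four balls contribute 4 * 47/100 = 1.88, more than the 1.5 allowed for the
      ball of radius 3 s / 2. Three balls would not exceed this bound, so the center c is counted as
      well.\<close>
    finally have "188 / 100 * (s * S) \<le> 150 / 100 * (s * S)" by simp
    then show False using s S by simp
  qed (use P in simp)
qed

text \<open>Bishop-Gromov gives all balls of one radius centered here a common positive lower bound
  \<beta> on their measure. Finiteness of M then bounds the size of e-separated sets, and a largest
  one is an e-net.\<close>

lemma compact_E_cball: "compact (E \<inter> cball p (R / 4))"
proof -
  have "\<exists>K. finite K \<and> E \<inter> cball p (R / 4) \<subseteq> (\<Union>x\<in>K. ball x e)" if "0 < e" for e :: real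
  proof -
  define s where "s = min (e / 3) (R / 4)"
  have s: "0 < s" "s < R / 2" "s \<le> e / 3" using \<open>0 < e\<close> R by (auto simp: s_def)
  define \<beta> where "\<beta> = s / (R / 2) * (99 / 100) * measure M (ball p (R / 4))"
  have \<beta>: "0 < \<beta>" using s R measure_ball_pos[OF p] by (simp add: \<beta>_def)
  have low: "\<beta> \<le> measure M (cball z s)" if z: "z \<in> E \<inter> cball p (R / 4)" for z
  proof -
    have "ball p (R / 4) \<subseteq> ball z (R / 2)"
    proof
      fix q assume "q \<in> ball p (R / 4)"
      then show "q \<in> ball z (R / 2)" using dist_triangle[of z q p] z by (simp add: dist_commute)
    qed
    then have "measure M (ball p (R / 4)) \<le> measure M (ball z (R / 2))" by (intro finite_measure_mono) auto
    then have "\<beta> \<le> s / (R / 2) * (99 / 100) * measure M (ball z (R / 2))"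
      unfolding \<beta>_def using s R by (intro mult_left_mono) auto
    also have "\<dots> \<le> measure M (cball z s)"
      by (rule bishop_gromov) (use z s R in auto)
    finally show ?thesis .
  qed
  define sepd where "sepd K \<longleftrightarrow> finite K \<and> K \<subseteq> E \<inter> cball p (R / 4) \<and> (\<forall>a\<in>K. \<forall>b\<in>K. a \<noteq> b \<longrightarrow> e \<le> dist a b)" for K
  have card: "card K \<le> nat \<lceil>measure M UNIV / \<beta>\<rceil>" if K: "sepd K" for K
  proof -
    have "disjoint_family_on (\<lambda>z. cball z s) K"
      unfolding disjoint_family_on_def
    proof (intro ballI impI, rule ccontr)
      fix a b assume ab: "a \<in> K" "b \<in> K" "a \<noteq> b" "cball a s \<inter> cball b s \<noteq> {}"
      then obtain q where "dist a q \<le> s" "dist b q \<le> s" by auto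
      moreover have "e \<le> dist a b" using ab K by (simp add: sepd_def)
      ultimately show False using dist_triangle[of a b q] s by (simp add: dist_commute)
    qed
    then have "(\<Sum>z\<in>K. measure M (cball z s)) = measure M (\<Union>z\<in>K. cball z s)"
      using K by (intro finite_measure_finite_Union[symmetric]) (auto simp: sepd_def borel_closed)
    also have "\<dots> \<le> measure M UNIV" by (intro finite_measure_mono) auto
    finally have "real (card K) * \<beta> \<le> measure M UNIV"
      using sum_mono[of K "\<lambda>_. \<beta>" "\<lambda>z. measure M (cball z s)"] low K unfolding sepd_def
      by (simp add: subset_iff)
    then have "real (card K) \<le> measure M UNIV / \<beta>" using \<beta> by (simp add: field_simps)
    then show ?thesis by linarith
  qed
  have "sepd {}" by (simp add: sepd_def)
  then obtain K where K: "sepd K" "\<And>K'. sepd K' \<Longrightarrow> card K' \<le> card K"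
    using ex_has_greatest_nat[of sepd "{}" card "Suc (nat \<lceil>measure M UNIV / \<beta>\<rceil>)"] card
    by (auto simp: less_Suc_eq_le)
  show "\<exists>K. finite K \<and> E \<inter> cball p (R / 4) \<subseteq> (\<Union>x\<in>K. ball x e)"
  proof (intro exI[of _ K] conjI subsetI)
    show "finite K" using K by (simp add: sepd_def)
    fix z assume z: "z \<in> E \<inter> cball p (R / 4)"
    show "z \<in> (\<Union>x\<in>K. ball x e)"
    proof (rule ccontr)
      assume nz: "z \<notin> (\<Union>x\<in>K. ball x e)"
      then have far: "e \<le> dist x z" if "x \<in> K" for x using that by auto
      have "z \<notin> K" using nz \<open>0 < e\<close> by auto
      have "sepd (insert z K)"
        using K(1) z far unfolding sepd_def by (auto simp: dist_commute)
      then have "card (insert z K) \<le> card K" by (rule K(2))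
      then show False using \<open>z \<notin> K\<close> \<open>finite K\<close> by simp
    qed
  qed
  qed
  then show ?thesis
    unfolding compact_eq_totally_bounded using closed_E by (simp add: complete_eq_closed closed_Int)
qed

text \<open>The contraction by 1/2 towards b of a small ball around a has positive measure and so
  meets the support. This yields approximate midpoints, and compactness yields an exact one.\<close>

lemma midpoint_exists:
  assumes a: "a \<in> E" "dist p a < R / 16" and b: "b \<in> E" "dist p b < R / 16"
  obtains z where "z \<in> E" "dist a z = dist a b / 2" "dist z b = dist a b / 2"
proof -
  define \<delta> where "\<delta> n = R / 64 / real (Suc n)" for n
  have \<delta>: "0 < \<delta> n" "\<delta> n \<le> R / 64" for n using R by (auto simp: \<delta>_def divide_le_eq algebra_simps)
  have \<delta>lim: "\<delta> \<longlonglongrightarrow> 0"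
    unfolding \<delta>_def by (intro real_tendsto_divide_at_top[OF tendsto_const] filterlim_compose[OF filterlim_real_sequentially filterlim_Suc])
  have "\<exists>z. z \<in> E \<and> \<bar>dist z b - dist a b / 2\<bar> \<le> 2 * \<delta> n \<and> \<bar>dist a z - dist a b / 2\<bar> \<le> 3 * \<delta> n" for n
  proof -
    have "1 / 2 * (99 / 100) * measure M (ball a (\<delta> n)) \<le> measure M (contr b (1 / 2) (ball a (\<delta> n)))"
      by (rule contraction_99) (use a b \<delta>[of n] R in \<open>auto intro!: closure_ball_subset\<close>)
    moreover have "0 < measure M (ball a (\<delta> n))" using a \<delta> by (intro measure_ball_pos)
    ultimately have "0 < measure M (contr b (1 / 2) (ball a (\<delta> n)))" by linarith
    then obtain z where z: "z \<in> contr b (1 / 2) (ball a (\<delta> n))" "z \<in> E" by (rule measure_pos_meets_E)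
    obtain x where x: "dist a x < \<delta> n" "\<bar>dist z b - 1 / 2 * dist x b\<bar> < \<delta> n" "\<bar>dist x z - (1 - 1 / 2) * dist x b\<bar> < \<delta> n"
      using z(1)[unfolded contr_def, THEN CollectD, rule_format, OF \<delta>(1)[of n]] by auto
    have "\<bar>dist x b - dist a b\<bar> \<le> \<delta> n" "\<bar>dist x z - dist a z\<bar> \<le> \<delta> n"
      using x(1) dist_triangle[of x b a] dist_triangle[of a b x] dist_triangle[of x z a] dist_triangle[of a z x]
      by (auto simp: dist_commute)
    then have "\<bar>dist z b - dist a b / 2\<bar> \<le> 2 * \<delta> n \<and> \<bar>dist a z - dist a b / 2\<bar> \<le> 3 * \<delta> n"
      using x(2,3) unfolding abs_le_iff abs_less_iff by (intro conjI) argo+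
    then show ?thesis using z by blast
  qed
  then obtain f where f: "\<And>n. f n \<in> E" "\<And>n. \<bar>dist (f n) b - dist a b / 2\<bar> \<le> 2 * \<delta> n"
    "\<And>n. \<bar>dist a (f n) - dist a b / 2\<bar> \<le> 3 * \<delta> n" by metis
  have "f n \<in> E \<inter> cball p (R / 4)" for n
    using f(1,3)[of n] \<delta>(2)[of n] a(2) b(2) dist_triangle[of p "f n" a] dist_triangle[of a b p] by (auto simp: dist_commute)
  then obtain z r where z: "z \<in> E \<inter> cball p (R / 4)" "strict_mono (r :: nat \<Rightarrow> nat)" "(f \<circ> r) \<longlonglongrightarrow> z"
    using compact_E_cball unfolding compact_def by metis
  have lim: "(\<lambda>n. \<delta> (r n)) \<longlonglongrightarrow> 0"
    using LIMSEQ_subseq_LIMSEQ[OF \<delta>lim z(2)] by (simp add: comp_def)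
  have "(\<lambda>n. \<bar>dist (f (r n)) b - dist a b / 2\<bar>) \<longlonglongrightarrow> 0"
    by (rule tendsto_sandwich[OF _ _ tendsto_const, of _ _ _ "\<lambda>n. 2 * \<delta> (r n)"])
      (use f(2) tendsto_mult_right_zero[OF lim, of 2] in auto)
  moreover have "(\<lambda>n. \<bar>dist (f (r n)) b - dist a b / 2\<bar>) \<longlonglongrightarrow> \<bar>dist z b - dist a b / 2\<bar>"
    using z(3) by (intro tendsto_intros) (simp_all add: comp_def)
  ultimately have 1: "\<bar>dist z b - dist a b / 2\<bar> = 0" using LIMSEQ_unique by blast
  have "(\<lambda>n. \<bar>dist a (f (r n)) - dist a b / 2\<bar>) \<longlonglongrightarrow> 0"
    by (rule tendsto_sandwich[OF _ _ tendsto_const, of _ _ _ "\<lambda>n. 3 * \<delta> (r n)"])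
      (use f(3) tendsto_mult_right_zero[OF lim, of 3] in auto)
  moreover have "(\<lambda>n. \<bar>dist a (f (r n)) - dist a b / 2\<bar>) \<longlonglongrightarrow> \<bar>dist a z - dist a b / 2\<bar>"
    using z(3) by (intro tendsto_intros) (simp_all add: comp_def)
  ultimately have "\<bar>dist a z - dist a b / 2\<bar> = 0" using LIMSEQ_unique by blast
  then show ?thesis using that[of z] z(1) 1 by simp
qed


text \<open>Zorn's lemma applied to the subsets between a and b on which the distance from a is an
  isometry into the line. A maximal one is compact, and a gap in its range of distances could be
  filled by the midpoint of the two points bounding the gap. This takes the place of dyadic
  subdivision and completion.\<close>

lemma geodesic_exists:
  assumes a: "a \<in> E" "dist p a < R / 64" and b: "b \<in> E" "dist p b < R / 64"
  shows "\<exists>\<sigma>. geodesic_in E (dist a b) \<sigma> \<and> \<sigma> 0 = a \<and> \<sigma> (dist a b) = b"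
proof -
  define L where "L = dist a b"
  have L: "L < R / 32" using dist_triangle[of a b p] a b by (simp add: L_def dist_commute)
  define \<A> where "\<A> = {S. a \<in> S \<and> b \<in> S \<and> S \<subseteq> E \<and> (\<forall>z\<in>S. dist a z + dist z b = L) \<and>
    (\<forall>z\<in>S. \<forall>w\<in>S. dist z w = \<bar>dist a z - dist a w\<bar>)}"
  have "{a, b} \<in> \<A>" using a b by (auto simp: \<A>_def L_def dist_commute)
  moreover have "\<Union>C \<in> \<A>" if C: "C \<noteq> {}" "subset.chain \<A> C" for C
  proof -
    have CA: "\<And>S. S \<in> C \<Longrightarrow> S \<in> \<A>" using C by (auto simp: subset.chain_def)
    have "dist z w = \<bar>dist a z - dist a w\<bar>" if zw: "z \<in> \<Union>C" "w \<in> \<Union>C" for z w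
    proof -
      obtain S T where "S \<in> C" "T \<in> C" "z \<in> S" "w \<in> T" using zw by blast
      moreover then have "S \<subseteq> T \<or> T \<subseteq> S" using C by (auto simp: subset.chain_def)
      ultimately obtain V where "V \<in> C" "z \<in> V" "w \<in> V" by blast
      then show ?thesis using CA[of V] unfolding \<A>_def by blast
    qed
    then show ?thesis using CA C(1) unfolding \<A>_def by blast
  qed
  ultimately obtain S where S: "S \<in> \<A>" and max: "\<And>X. X \<in> \<A> \<Longrightarrow> S \<subseteq> X \<Longrightarrow> X = S"
    using subset_Zorn_nonempty[of \<A>] by blast
  have Sab: "a \<in> S" "b \<in> S" "S \<subseteq> E" and SL: "\<And>z. z \<in> S \<Longrightarrow> dist a z + dist z b = L"
    and Siso: "\<And>z w. z \<in> S \<Longrightarrow> w \<in> S \<Longrightarrow> dist z w = \<bar>dist a z - dist a w\<bar>"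
    using S unfolding \<A>_def by blast+
  have "closure S \<in> \<A>"
  proof -
    have "closure S \<subseteq> E" using Sab closed_E by (intro closure_minimal)
    moreover have "closure S \<subseteq> {z. dist a z + dist z b = L}"
      using SL by (intro closure_minimal closed_Collect_eq continuous_intros) auto
    moreover have "closure (S \<times> S) \<subseteq> {q. dist (fst q) (snd q) = \<bar>dist a (fst q) - dist a (snd q)\<bar>}"
      using Siso by (intro closure_minimal closed_Collect_eq continuous_intros) auto
    ultimately show ?thesis using Sab closure_subset[of S] unfolding \<A>_def closure_Times by auto
  qed
  then have "closed S" using max[of "closure S"] closure_subset[of S] closed_closure[of S] by simp
  \<comment> \<open>Points between a and b stay within R/64 + R/32 of p, inside the ball of radius
    R/16 where midpoints exist.\<close>
  have Sp: "dist p z < R / 16" if "z \<in> S" for z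
    using SL[OF that] zero_le_dist[of z b] L a(2) dist_triangle[of p z a] R by linarith
  then have "S = S \<inter> (E \<inter> cball p (R / 4))" using Sab Sp R by fastforce
  then have cS: "compact S" using closed_Int_compact[OF \<open>closed S\<close> compact_E_cball] by simp
  have onto: "\<exists>z\<in>S. dist a z = s" if s: "0 \<le> s" "s \<le> L" for s
  proof (rule ccontr)
    assume no: "\<not> (\<exists>z\<in>S. dist a z = s)"
    have "compact (S \<inter> {z. dist a z \<le> s})" "compact (S \<inter> {z. s \<le> dist a z})"
      by (intro compact_Int_closed cS closed_Collect_le continuous_intros)+
    moreover have "a \<in> S \<inter> {z. dist a z \<le> s}" "b \<in> S \<inter> {z. s \<le> dist a z}"
      using Sab s by (auto simp: L_def)
    moreover have "continuous_on X (\<lambda>z. dist a z)" for X by (intro continuous_intros)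
    ultimately obtain z1 z2 where z1: "z1 \<in> S" "dist a z1 \<le> s" "\<And>z. z \<in> S \<Longrightarrow> dist a z \<le> s \<Longrightarrow> dist a z \<le> dist a z1"
      and z2: "z2 \<in> S" "s \<le> dist a z2" "\<And>z. z \<in> S \<Longrightarrow> s \<le> dist a z \<Longrightarrow> dist a z2 \<le> dist a z"
      using continuous_attains_sup[of "S \<inter> {z. dist a z \<le> s}" "\<lambda>z. dist a z"]
        continuous_attains_inf[of "S \<inter> {z. s \<le> dist a z}" "\<lambda>z. dist a z"] by blast
    have lt: "dist a z1 < s" "s < dist a z2" using no z1 z2 by (auto simp: less_le)
    define \<delta> where "\<delta> = dist z1 z2 / 2"
    have \<delta>: "2 * \<delta> = dist a z2 - dist a z1" using Siso[OF z1(1) z2(1)] lt by (simp add: \<delta>_def)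
    obtain w where w: "w \<in> E" "dist z1 w = \<delta>" "dist w z2 = \<delta>"
      using midpoint_exists[of z1 z2] Sab z1 z2 Sp unfolding \<delta>_def by blast
    have wu: "dist a w = dist a z1 + \<delta>" "dist w b = L - dist a z1 - \<delta>"
      using dist_triangle[of a w z1] dist_triangle[of w b z2] dist_triangle[of a b w] w \<delta> SL[OF z2(1)]
      by (auto simp: L_def)
    have "dist v w = \<bar>dist a v - dist a w\<bar>" if v: "v \<in> S" for v
    proof (cases "dist a v \<le> s")
      case True
      then have "dist a v \<le> dist a z1" using z1 v by blast
      then show ?thesis
        using Siso[OF v z1(1)] dist_triangle[of v w z1] dist_triangle[of a w v] w wu \<delta> lt by auto
    next
      case False
      then have "dist a z2 \<le> dist a v" using z2 v by auto
      then show ?thesis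
        using Siso[OF v z2(1)] dist_triangle[of v w z2] dist_triangle[of a v w] w wu \<delta> lt
        by (auto simp: dist_commute)
    qed
    then have wS: "dist v w = \<bar>dist a v - dist a w\<bar>" "dist w v = \<bar>dist a w - dist a v\<bar>" if "v \<in> S" for v
      using that by (simp_all add: dist_commute[of w] abs_minus_commute)
    have "insert w S \<in> \<A>"
      unfolding \<A>_def mem_Collect_eq
    proof (intro conjI ballI)
      show "dist a z + dist z b = L" if "z \<in> insert w S" for z using that SL wu by auto
      show "dist z z' = \<bar>dist a z - dist a z'\<bar>" if "z \<in> insert w S" "z' \<in> insert w S" for z z'
        using that Siso[of z z'] wS by (elim insertE) simp_all
    qed (use Sab w(1) in auto)
    then have "w \<in> S" using max[of "insert w S"] by blast
    then have "dist a w \<le> dist a z1 \<or> dist a z2 \<le> dist a w" using z1(3)[of w] z2(3)[of w] by linarith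
    then show False using wu \<delta> lt by auto
  qed
  then obtain \<sigma> where \<sigma>: "\<And>s. 0 \<le> s \<Longrightarrow> s \<le> L \<Longrightarrow> \<sigma> s \<in> S \<and> dist a (\<sigma> s) = s" by metis
  have L0: "0 \<le> L" by (simp add: L_def)
  have "geodesic_in E L \<sigma>"
    unfolding geodesic_in_def
  proof (intro conjI ballI L0)
    show "\<sigma> s \<in> E" if "s \<in> {0..L}" for s using \<sigma>[of s] that Sab by auto
    show "dist (\<sigma> s) (\<sigma> t) = \<bar>s - t\<bar>" if st: "s \<in> {0..L}" "t \<in> {0..L}" for s t
    proof -
      have "\<sigma> s \<in> S" "\<sigma> t \<in> S" "dist a (\<sigma> s) = s" "dist a (\<sigma> t) = t" using \<sigma>[of s] \<sigma>[of t] st by auto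
      then show ?thesis using Siso[of "\<sigma> s" "\<sigma> t"] by metis
    qed
  qed
  moreover have "\<sigma> 0 = a" using \<sigma>[of 0] L0 by auto
  moreover have "dist (\<sigma> L) b = 0" using \<sigma>[of L] SL[of "\<sigma> L"] L0 by auto
  ultimately show ?thesis unfolding L_def by auto
qed

end

text \<open>The bound makes the symmetric second derivative vanish everywhere; this is the theorem
  of Schwarz on continuous functions with that property.\<close>

lemma affine_if_second_difference_cubic:
  fixes G :: "real \<Rightarrow> real"
  assumes cont: "continuous_on {a..b} G" and "a < b" and "0 < \<epsilon>"
    and bound: "\<And>s h. 0 < h \<Longrightarrow> h < \<epsilon> \<Longrightarrow> a \<le> s - h \<Longrightarrow> s + h \<le> b \<Longrightarrow> \<bar>G (s + h) + G (s - h) - 2 * G s\<bar> \<le> C * h ^ 3"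
    and s: "s \<in> {a..b}"
  shows "G s = G a + (s - a) * ((G b - G a) / (b - a))"
proof -
  text \<open>Subtracting the chord and adding \<open>e s\<^sup>2\<close> makes the function strictly midpoint-convex at
    small scales, so it has no interior maximum.\<close>
  have max_principle: "H s \<le> 0"
    if cH: "continuous_on {a..b} H" and H0: "H a = 0" "H b = 0"
      and bH: "\<And>s h. 0 < h \<Longrightarrow> h < \<epsilon> \<Longrightarrow> a \<le> s - h \<Longrightarrow> s + h \<le> b \<Longrightarrow> - C * h ^ 3 \<le> H (s + h) + H (s - h) - 2 * H s"
      and s: "s \<in> {a..b}" for H :: "real \<Rightarrow> real" and s
  proof (rule field_le_epsilon)
    fix e' :: real assume "0 < e'"
    define e where "e = e' / (b - a)\<^sup>2"
    have e: "0 < e" using \<open>0 < e'\<close> \<open>a < b\<close> by (simp add: e_def)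
    define F where "F s = H s + e * ((s - a) * (s - b))" for s
    have cF: "continuous_on {a..b} F" unfolding F_def by (intro continuous_intros cH)
    obtain x where x: "x \<in> {a..b}" "\<And>z. z \<in> {a..b} \<Longrightarrow> F z \<le> F x"
      using continuous_attains_sup[OF _ _ cF] \<open>a < b\<close> by auto
    have "F x \<le> 0"
    proof (cases "x = a \<or> x = b")
      case True
      then show ?thesis using H0 by (auto simp: F_def)
    next
      case False
      then have xi: "a < x" "x < b" using x by auto
      \<comment> \<open>Small enough that the cubic error C * h^3 is beaten by the second difference
        2 e h^2 of the quadratic term.\<close>
      define h where "h = min (min \<epsilon> (e / (\<bar>C\<bar> + 1))) (min (x - a) (b - x)) / 2"
      have "0 < 2 * h" using xi e \<open>0 < \<epsilon>\<close> by (auto simp: h_def divide_pos_pos add_nonneg_pos)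
      moreover have "2 * h \<le> \<epsilon>" "2 * h \<le> e / (\<bar>C\<bar> + 1)" "2 * h \<le> x - a" "2 * h \<le> b - x"
        by (auto simp: h_def)
      ultimately have h: "0 < h" "h < \<epsilon>" "h < e / (\<bar>C\<bar> + 1)" "a \<le> x - h" "x + h \<le> b"
        by linarith+
      have "(\<bar>C\<bar> + 1) * h < e" using h by (simp add: field_simps)
      then have "(\<bar>C\<bar> + 1) * h * h\<^sup>2 < e * h\<^sup>2" using h by (intro mult_strict_right_mono) auto
      moreover have "C * h ^ 3 \<le> (\<bar>C\<bar> + 1) * h * h\<^sup>2"
      proof -
        have "C * h ^ 3 \<le> (\<bar>C\<bar> + 1) * h ^ 3" using h by (intro mult_right_mono) auto
        then show ?thesis by (simp add: power3_eq_cube power2_eq_square algebra_simps)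
      qed
      moreover have "F (x + h) + F (x - h) - 2 * F x = H (x + h) + H (x - h) - 2 * H x + 2 * e * h\<^sup>2"
        by (simp add: F_def power2_eq_square algebra_simps)
      moreover have "0 \<le> e * h\<^sup>2" using e by simp
      ultimately have "0 < F (x + h) + F (x - h) - 2 * F x" using bH[of h x] h by linarith
      moreover have "F (x + h) \<le> F x" "F (x - h) \<le> F x" using x(2) h by auto
      ultimately show ?thesis by linarith
    qed
    then have "F s \<le> 0" using x(2)[OF s] by linarith
    moreover have "- ((s - a) * (s - b)) \<le> (b - a)\<^sup>2"
    proof -
      have "(s - a) * (b - s) \<le> (b - a) * (b - a)" using s by (intro mult_mono) auto
      then show ?thesis by (simp add: power2_eq_square algebra_simps)
    qed
    then have "e * - ((s - a) * (s - b)) \<le> e * (b - a)\<^sup>2" using e by (intro mult_left_mono) auto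
    moreover have "e * (b - a)\<^sup>2 = e'" using \<open>a < b\<close> by (simp add: e_def)
    ultimately show "H s \<le> 0 + e'" unfolding F_def by simp
  qed
  define lin where "lin s = G a + (s - a) * ((G b - G a) / (b - a))" for s
  have lin: "lin (u + h) + lin (u - h) - 2 * lin u = 0" for u h
  proof -
    define k where "k = (G b - G a) / (b - a)"
    show ?thesis unfolding lin_def k_def[symmetric] by (simp add: algebra_simps)
  qed
  have clin: "continuous_on {a..b} lin" unfolding lin_def by (intro continuous_intros)
  have "G s - lin s \<le> 0"
  proof (rule max_principle[OF _ _ _ _ s])
    show "- C * h ^ 3 \<le> G (u + h) - lin (u + h) + (G (u - h) - lin (u - h)) - 2 * (G u - lin u)"
      if "0 < h" "h < \<epsilon>" "a \<le> u - h" "u + h \<le> b" for u h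
      using bound[OF that] lin[of u h] by (auto simp: abs_le_iff)
  qed (use \<open>a < b\<close> in \<open>auto simp: lin_def intro!: continuous_intros cont clin\<close>)
  moreover have "lin s - G s \<le> 0"
  proof (rule max_principle[OF _ _ _ _ s])
    show "- C * h ^ 3 \<le> lin (u + h) - G (u + h) + (lin (u - h) - G (u - h)) - 2 * (lin u - G u)"
      if "0 < h" "h < \<epsilon>" "a \<le> u - h" "u + h \<le> b" for u h
      using bound[OF that] lin[of u h] by (auto simp: abs_le_iff)
  qed (use \<open>a < b\<close> in \<open>auto simp: lin_def intro!: continuous_intros cont clin\<close>)
  ultimately show ?thesis by (simp add: lin_def)
qed


section \<open>The measure on the interval\<close>

lemma isometry_compact_image:
  fixes \<psi> :: "real \<Rightarrow> 'a::metric_space"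
  assumes "\<And>s t. s \<in> {\<alpha>..\<beta>} \<Longrightarrow> t \<in> {\<alpha>..\<beta>} \<Longrightarrow> dist (\<psi> s) (\<psi> t) = \<bar>s - t\<bar>" "\<alpha> \<le> s" "t \<le> \<beta>"
  shows "compact (\<psi> ` {s..t})"
proof -
  have "continuous_on {\<alpha>..\<beta>} \<psi>"
    unfolding continuous_on_iff dist_real_def using assms(1) by (auto intro!: exI)
  then have "continuous_on {s..t} \<psi>" by (rule continuous_on_subset) (use assms in auto)
  then show ?thesis by (rule compact_continuous_image) simp
qed

text \<open>On an isometric copy of an interval, contraction is multiplication by \<open>l\<close>.\<close>

lemma contr_interval:
  fixes \<psi> :: "real \<Rightarrow> 'a::metric_space"
  assumes iso: "\<And>s t. s \<in> {\<alpha>..\<beta>} \<Longrightarrow> t \<in> {\<alpha>..\<beta>} \<Longrightarrow> dist (\<psi> s) (\<psi> t) = \<bar>s - t\<bar>"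
    and img: "E \<inter> cball p \<beta> \<subseteq> \<psi> ` {\<alpha>..\<beta>}" and \<psi>0: "\<psi> 0 = p" and \<alpha>: "\<alpha> \<le> 0" "0 < \<beta>"
    and st: "\<alpha> \<le> s" "s \<le> t" "t \<le> \<beta> / 4" "- (\<beta> / 4) \<le> s" and b: "\<alpha> \<le> b" "b \<le> \<beta> / 4" "- (\<beta> / 4) \<le> b"
    and l: "0 < l" "l < 1"
  shows "E \<inter> contr (\<psi> b) l (\<psi> ` {s..t}) \<subseteq> \<psi> ` {l * s + (1 - l) * b..l * t + (1 - l) * b}"
proof
  fix z assume z: "z \<in> E \<inter> contr (\<psi> b) l (\<psi> ` {s..t})"
  then have zc: "\<exists>x\<in>{s..t}. \<bar>dist z (\<psi> b) - l * \<bar>x - b\<bar>\<bar> < e \<and> \<bar>dist (\<psi> x) z - (1 - l) * \<bar>x - b\<bar>\<bar> < e"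
    if "0 < e" for e
  proof -
    obtain x where x: "x \<in> {s..t}" "\<bar>dist z (\<psi> b) - l * dist (\<psi> x) (\<psi> b)\<bar> < e"
      "\<bar>dist (\<psi> x) z - (1 - l) * dist (\<psi> x) (\<psi> b)\<bar> < e"
      using z \<open>0 < e\<close> unfolding contr_def by blast
    moreover have "dist (\<psi> x) (\<psi> b) = \<bar>x - b\<bar>" using x(1) st b \<alpha> by (intro iso) auto
    ultimately show ?thesis by auto
  qed
  \<comment> \<open>First localisation of z, so that it has a coordinate: it is within \<beta>/2 +
    \<beta>/8 of \<open>\<psi> b\<close>, which is itself within \<beta>/4 of p. The restriction to
    a quarter of the interval is made for this.\<close>
  obtain x where x: "x \<in> {s..t}" "\<bar>dist z (\<psi> b) - l * \<bar>x - b\<bar>\<bar> < \<beta> / 8" using zc[of "\<beta> / 8"] \<alpha> by auto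
  have "l * \<bar>x - b\<bar> \<le> 1 * \<bar>x - b\<bar>" using l by (intro mult_right_mono) auto
  also have "\<dots> \<le> \<beta> / 2" using x(1) st b unfolding atLeastAtMost_iff abs_le_iff mult_1 by linarith
  finally have "l * \<bar>x - b\<bar> + \<beta> / 8 \<le> \<beta> / 2 + \<beta> / 8" by simp
  moreover have "dist z (\<psi> b) < l * \<bar>x - b\<bar> + \<beta> / 8" using x(2) unfolding abs_less_iff by linarith
  ultimately have "dist z (\<psi> b) < \<beta> / 2 + \<beta> / 8" by (rule less_le_trans[rotated])
  moreover have "dist p (\<psi> b) \<le> \<beta> / 4" using iso[of 0 b] \<psi>0 \<alpha> b by (simp add: abs_le_iff)
  moreover have "dist p z \<le> dist p (\<psi> b) + dist z (\<psi> b)" using dist_triangle[of p z "\<psi> b"] by (simp add: dist_commute)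
  ultimately have "dist p z \<le> \<beta>" using \<alpha>(2) by linarith
  then have "z \<in> \<psi> ` {\<alpha>..\<beta>}" using z img by auto
  then obtain r where r: "\<alpha> \<le> r" "r \<le> \<beta>" "z = \<psi> r" by auto
  have rb: "dist z (\<psi> b) = \<bar>r - b\<bar>" using r b \<alpha> iso[of r b] by auto
  \<comment> \<open>The distance to \<open>\<psi> b\<close> leaves two candidates, one on either
    side of b; the distance to \<open>\<psi> x\<close> excludes the one on the wrong side.\<close>
  have near: "\<exists>x\<in>{s..t}. \<bar>r - (l * x + (1 - l) * b)\<bar> \<le> 2 * e" if e: "0 < e" for e
  proof -
    obtain x where x: "x \<in> {s..t}" "\<bar>dist z (\<psi> b) - l * \<bar>x - b\<bar>\<bar> < e" "\<bar>dist (\<psi> x) z - (1 - l) * \<bar>x - b\<bar>\<bar> < e"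
      using zc[OF e] by blast
    have xr: "dist (\<psi> x) z = \<bar>x - r\<bar>" using r x(1) st \<alpha> iso[of x r] by auto
    define d where "d = l * (x - b)"
    have d1: "l * \<bar>x - b\<bar> = \<bar>d\<bar>" using l by (simp add: d_def abs_mult)
    then have d: "l * \<bar>x - b\<bar> = \<bar>d\<bar>" "(1 - l) * \<bar>x - b\<bar> = \<bar>x - b\<bar> - \<bar>d\<bar>" "r - (l * x + (1 - l) * b) = r - b - d"
      by (simp_all add: left_diff_distrib) (simp add: d_def algebra_simps)
    have sgn: "0 \<le> x - b \<Longrightarrow> 0 \<le> d" "x - b \<le> 0 \<Longrightarrow> d \<le> 0"
      using l by (auto simp: d_def mult_nonneg_nonpos)
    have "\<bar>r - b - d\<bar> \<le> 2 * e"
      using x(2,3) sgn unfolding rb xr d by (cases "0 \<le> x - b") arith+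
    then show ?thesis unfolding d(3)[symmetric] using x(1) by (rule bexI)
  qed
  have "l * s + (1 - l) * b \<le> r"
  proof (rule field_le_epsilon)
    fix e :: real assume "0 < e"
    then obtain x where x: "x \<in> {s..t}" "\<bar>r - (l * x + (1 - l) * b)\<bar> \<le> 2 * (e / 2)" using near[of "e / 2"] by auto
    have "l * s \<le> l * x" using x(1) l by auto
    then show "l * s + (1 - l) * b \<le> r + e" using x(2) by (simp add: abs_le_iff)
  qed
  moreover have "r \<le> l * t + (1 - l) * b"
  proof (rule field_le_epsilon)
    fix e :: real assume "0 < e"
    then obtain x where x: "x \<in> {s..t}" "\<bar>r - (l * x + (1 - l) * b)\<bar> \<le> 2 * (e / 2)" using near[of "e / 2"] by auto
    have "l * x \<le> l * t" using x(1) l by auto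
    then show "r \<le> l * t + (1 - l) * b + e" using x(2) by (simp add: abs_le_iff)
  qed
  ultimately show "z \<in> \<psi> ` {l * s + (1 - l) * b..l * t + (1 - l) * b}" using r(3) by auto
qed

context contracting
begin

lemma locally_interval:
  assumes y: "y \<in> E" "0 < dist p y" "dist p y < R / 64"
  obtains \<alpha> \<beta> \<psi> where "\<alpha> \<le> 0" "0 < \<beta>" "\<beta> = dist p y / 128" "\<And>s. s \<in> {\<alpha>..\<beta>} \<Longrightarrow> \<psi> s \<in> E"
    "\<And>s t. s \<in> {\<alpha>..\<beta>} \<Longrightarrow> t \<in> {\<alpha>..\<beta>} \<Longrightarrow> dist (\<psi> s) (\<psi> t) = \<bar>s - t\<bar>"
    "\<psi> ` {\<alpha>..\<beta>} = E \<inter> cball p \<beta>" "\<psi> 0 = p"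
proof -
  define L where "L = dist p y"
  have L: "0 < L" "L < R / 64" using y by (auto simp: L_def)
  obtain \<sigma> where \<sigma>: "geodesic_in E L \<sigma>" "\<sigma> 0 = p" "\<sigma> L = y"
    using geodesic_exists[OF p _ y(1)] y R unfolding L_def by auto
  have y2: "\<sigma> (L / 32) \<in> E" "dist p (\<sigma> (L / 32)) = L / 32"
    using geodesic_inD(2)[OF \<sigma>(1), of "L/32"] geodesic_inD(3)[OF \<sigma>(1), of 0 "L/32"] \<sigma>(2) L by auto
  \<comment> \<open>The radius L/4 is where \<open>no_tripod\<close> applies, and L/32 is an eighth
    of it, as the locale demands.\<close>
  interpret no_branching E p "\<sigma> (L / 32)" "L / 32" "L / 4"
  proof
    show "\<exists>\<sigma>. geodesic_in E (dist a b) \<sigma> \<and> \<sigma> 0 = a \<and> \<sigma> (dist a b) = b"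
      if "a \<in> E" "b \<in> E" "dist p a < L / 4" "dist p b < L / 4" for a b
      using that L by (intro geodesic_exists) auto
    show "\<exists>s0>0. \<forall>s u v w. 0 < s \<longrightarrow> s < s0 \<longrightarrow> u \<in> E \<longrightarrow> v \<in> E \<longrightarrow> w \<in> E \<longrightarrow>
        dist c u = s \<longrightarrow> dist c v = s \<longrightarrow> dist c w = s \<longrightarrow> s \<le> dist u v \<longrightarrow> s \<le> dist u w \<longrightarrow> s \<le> dist v w \<longrightarrow> False"
      if "c \<in> E" "dist p c < L / 4" for c
      by (rule no_tripod[OF y(1) L_def[symmetric]]) (use L R that in auto)
    have "E \<inter> cball p (L / 32 / 4) = (E \<inter> cball p (R / 4)) \<inter> cball p (L / 32 / 4)" using L by auto
    then show "compact (E \<inter> cball p (L / 32 / 4))"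
      using compact_Int_closed[OF compact_E_cball, of "cball p (L / 32 / 4)"] by simp
  qed (use p y2 L in auto)
  obtain \<alpha> \<psi> where "\<alpha> \<le> 0" "\<And>s. s \<in> {\<alpha>..L/32/4} \<Longrightarrow> \<psi> s \<in> E"
    "\<And>s t. s \<in> {\<alpha>..L/32/4} \<Longrightarrow> t \<in> {\<alpha>..L/32/4} \<Longrightarrow> dist (\<psi> s) (\<psi> t) = \<bar>s - t\<bar>"
    "\<psi> ` {\<alpha>..L/32/4} = E \<inter> cball p (L/32/4)" "\<psi> 0 = p"
    using interval by metis
  then show ?thesis using L by (intro that[of \<alpha> "L/32/4" \<psi>]) (simp_all add: L_def)
qed

text \<open>The orders of magnitude decide: each half of an interval of length 2 h carries half of
  its measure up to a relative error of order h^2, and the measure itself is of order h by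
  \<open>measure_ball_le\<close>. The resulting h^3 is small against h^2, which is what affinity of
  the distribution function requires. The same upper bound excludes atoms.\<close>

lemma uniform_on_interval:
  assumes y: "y \<in> E" "0 < dist p y" "dist p y < R / 64"
  obtains \<alpha> \<beta> \<psi> c where "\<alpha> \<le> 0" "0 < \<beta>" "\<beta> \<le> dist p y" "0 < c" "\<And>s. s \<in> {\<alpha>..\<beta>} \<Longrightarrow> \<psi> s \<in> E"
    "\<And>s t. s \<in> {\<alpha>..\<beta>} \<Longrightarrow> t \<in> {\<alpha>..\<beta>} \<Longrightarrow> dist (\<psi> s) (\<psi> t) = \<bar>s - t\<bar>"
    "\<psi> ` {\<alpha>..\<beta>} = E \<inter> cball p \<beta>" "\<psi> 0 = p"
    "\<And>s t. \<alpha> \<le> s \<Longrightarrow> s \<le> t \<Longrightarrow> t \<le> \<beta> \<Longrightarrow> measure M (\<psi> ` {s..t}) = c * (t - s)"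
    "\<And>b s t l. \<alpha> \<le> s \<Longrightarrow> s \<le> t \<Longrightarrow> t \<le> \<beta> \<Longrightarrow> \<alpha> \<le> b \<Longrightarrow> b \<le> \<beta> \<Longrightarrow> 0 < l \<Longrightarrow> l < 1 \<Longrightarrow>
      E \<inter> contr (\<psi> b) l (\<psi> ` {s..t}) \<subseteq> \<psi> ` {l * s + (1 - l) * b..l * t + (1 - l) * b}"
proof -
  obtain \<alpha>0 \<beta>0 \<psi> where \<alpha>0: "\<alpha>0 \<le> 0" "0 < \<beta>0" "\<beta>0 = dist p y / 128" and \<psi>E: "\<And>s. s \<in> {\<alpha>0..\<beta>0} \<Longrightarrow> \<psi> s \<in> E"
    and iso: "\<And>s t. s \<in> {\<alpha>0..\<beta>0} \<Longrightarrow> t \<in> {\<alpha>0..\<beta>0} \<Longrightarrow> dist (\<psi> s) (\<psi> t) = \<bar>s - t\<bar>"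
    and img: "\<psi> ` {\<alpha>0..\<beta>0} = E \<inter> cball p \<beta>0" and \<psi>0: "\<psi> 0 = p"
    by (rule locally_interval[OF y]) blast
  define \<alpha> where "\<alpha> = max \<alpha>0 (- (\<beta>0 / 4))"
  define \<beta> where "\<beta> = \<beta>0 / 4"
  have \<alpha>\<beta>: "\<alpha> \<le> 0" "0 < \<beta>" "\<alpha>0 \<le> \<alpha>" "- (\<beta>0 / 4) \<le> \<alpha>" "\<beta> \<le> \<beta>0" "\<alpha> < \<beta>" using \<alpha>0(1,2) by (auto simp: \<alpha>_def \<beta>_def)
  have pd: "dist p (\<psi> s) = \<bar>s\<bar>" if "s \<in> {\<alpha>0..\<beta>0}" for s
    using iso[of 0 s] that \<psi>0 \<alpha>0 by auto
  have iso': "dist (\<psi> s) (\<psi> t) = \<bar>s - t\<bar>" if "s \<in> {\<alpha>..\<beta>}" "t \<in> {\<alpha>..\<beta>}" for s t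
    using that \<alpha>\<beta> by (intro iso) auto
  have con: "E \<inter> contr (\<psi> b) l (\<psi> ` {s..t}) \<subseteq> \<psi> ` {l * s + (1 - l) * b..l * t + (1 - l) * b}"
    if "\<alpha> \<le> s" "s \<le> t" "t \<le> \<beta>" "\<alpha> \<le> b" "b \<le> \<beta>" "0 < l" "l < 1" for b s t l
    by (rule contr_interval[OF iso _ \<psi>0 \<alpha>0(1,2)]) (use that img \<alpha>\<beta> \<beta>_def in auto)
  have img': "\<psi> ` {\<alpha>..\<beta>} = E \<inter> cball p \<beta>"
  proof
    show "\<psi> ` {\<alpha>..\<beta>} \<subseteq> E \<inter> cball p \<beta>"
    proof
      fix z assume "z \<in> \<psi> ` {\<alpha>..\<beta>}"
      then obtain s where s: "\<alpha> \<le> s" "s \<le> \<beta>" "z = \<psi> s" by auto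
      then have "s \<in> {\<alpha>0..\<beta>0}" using \<alpha>\<beta> by auto
      then show "z \<in> E \<inter> cball p \<beta>" using \<psi>E[of s] pd[of s] s \<alpha>\<beta> by (auto simp: \<beta>_def)
    qed
    show "E \<inter> cball p \<beta> \<subseteq> \<psi> ` {\<alpha>..\<beta>}"
    proof
      fix z assume z: "z \<in> E \<inter> cball p \<beta>"
      then have "z \<in> \<psi> ` {\<alpha>0..\<beta>0}" unfolding img using \<alpha>\<beta> by auto
      then obtain s where s: "s \<in> {\<alpha>0..\<beta>0}" "z = \<psi> s" by auto
      then have "s \<in> {\<alpha>..\<beta>}" using pd[of s] z by (auto simp: \<alpha>_def \<beta>_def)
      then show "z \<in> \<psi> ` {\<alpha>..\<beta>}" using s by auto
    qed
  qed
  have mI: "\<psi> ` {s..t} \<in> sets M" if "\<alpha> \<le> s" "t \<le> \<beta>" for s t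
    using isometry_compact_image[OF iso' that] by (simp add: borel_compact)
  define L where "L = dist p y"
  have L: "0 < L" "L \<le> R / 4" "dist p y = L" "\<beta>0 = L / 128" "L < R" unfolding L_def using y R \<alpha>0 by argo+
  define C where "C = 100 * measure M UNIV / L"
  have C: "0 \<le> C" using L by (simp add: C_def)
  have up: "measure M (\<psi> ` {s..t}) \<le> C * (2 * (t - s))" if st: "\<alpha> \<le> s" "s < t" "t \<le> \<beta>" "2 * (t - s) \<le> L / 16" for s t
  proof -
    have "\<psi> ` {s..t} \<subseteq> ball (\<psi> s) (2 * (t - s))" using st iso' by auto
    then have "measure M (\<psi> ` {s..t}) \<le> measure M (ball (\<psi> s) (2 * (t - s)))" by (intro finite_measure_mono) auto
    also have "\<dots> \<le> C * (2 * (t - s))"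
      unfolding C_def by (rule measure_ball_le[OF y(1) L(3,1,2)]) (use pd[of s] st \<alpha>\<beta> L \<beta>_def in auto)
    finally show ?thesis .
  qed
  have atom: "measure M {\<psi> s} = 0" if s: "s \<in> {\<alpha>..\<beta>}" for s
  proof -
    have "measure M {\<psi> s} \<le> C * \<rho>" if "0 < \<rho>" "\<rho> \<le> L / 16" for \<rho>
    proof -
      have "measure M {\<psi> s} \<le> measure M (ball (\<psi> s) \<rho>)" using that by (intro finite_measure_mono) auto
      also have "\<dots> \<le> C * \<rho>"
        unfolding C_def by (rule measure_ball_le[OF y(1) L(3,1,2)]) (use pd[of s] s that \<alpha>\<beta> L \<beta>_def in auto)
      finally show ?thesis .
    qed
    then have "\<forall>\<^sub>F \<rho> in at_right 0. measure M {\<psi> s} \<le> C * \<rho>"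
      using L by (intro eventually_at_rightI[of 0 "L / 16"]) auto
    moreover have "((\<lambda>\<rho>. C * \<rho>) \<longlongrightarrow> C * 0) (at_right 0)" by (intro tendsto_intros)
    ultimately have "measure M {\<psi> s} \<le> C * 0" by (intro tendsto_lowerbound) auto
    then show ?thesis by (simp add: antisym)
  qed
  define G where "G s = measure M (\<psi> ` {\<alpha>..s})" for s
  have add: "measure M (\<psi> ` {r..t}) = measure M (\<psi> ` {r..s}) + measure M (\<psi> ` {s..t})"
    if rst: "\<alpha> \<le> r" "r \<le> s" "s \<le> t" "t \<le> \<beta>" for r s t
  proof -
    have "\<psi> ` {r..t} = \<psi> ` {r..s} \<union> \<psi> ` {s..t}"
      using rst by (simp add: ivl_disj_un flip: image_Un)
    moreover have "\<psi> ` {r..s} \<inter> \<psi> ` {s..t} \<subseteq> {\<psi> s}"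
    proof
      fix z assume "z \<in> \<psi> ` {r..s} \<inter> \<psi> ` {s..t}"
      then have "z \<in> \<psi> ` {r..s}" "z \<in> \<psi> ` {s..t}" by blast+
      then obtain a b where "z = \<psi> a" "a \<in> {r..s}" "z = \<psi> b" "b \<in> {s..t}" by blast
      then have ab: "z = \<psi> a" "z = \<psi> b" "r \<le> a" "a \<le> s" "s \<le> b" "b \<le> t" by simp_all
      then have "\<bar>a - b\<bar> = 0" using iso'[of a b] rst by auto
      then show "z \<in> {\<psi> s}" using ab by simp
    qed
    then have "measure M (\<psi> ` {r..s} \<inter> \<psi> ` {s..t}) \<le> measure M {\<psi> s}"
      by (intro finite_measure_mono) auto
    then have "measure M (\<psi> ` {r..s} \<inter> \<psi> ` {s..t}) = 0"
      using atom[of s] rst by (simp add: antisym)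
    ultimately show ?thesis
      using rst mI by (simp add: measure_Un3 fmeasurable_eq_sets)
  qed
  have Gd: "G t - G s = measure M (\<psi> ` {s..t})" if "\<alpha> \<le> s" "s \<le> t" "t \<le> \<beta>" for s t
    using add[of \<alpha> s t] that by (simp add: G_def)
  \<comment> \<open>With b at either end of the interval, contraction by 1/2 produces exactly the
    half adjacent to b.\<close>
  have half: "1 / 2 * (1 - k * (t - s)\<^sup>2) * measure M (\<psi> ` {s..t}) \<le> measure M (\<psi> ` {(s + b) / 2..(t + b) / 2})"
    if st: "\<alpha> \<le> s" "s < t" "t \<le> \<beta>" and b: "b = s \<or> b = t" for s t b
  proof -
    have inR: "\<psi> r \<in> ball p R" if "\<alpha> \<le> r" "r \<le> \<beta>" for r
      using pd[of r] that \<alpha>\<beta> L R \<beta>_def by auto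
    have cc: "closed (\<psi> ` {s..t})" using isometry_compact_image[OF iso' st(1,3)] by (rule compact_imp_closed)
    have "1 / 2 * (1 - k * (t - s)\<^sup>2) * measure M (\<psi> ` {s..t}) \<le> measure M (contr (\<psi> b) (1 / 2) (\<psi> ` {s..t}))"
    proof (rule contraction_le)
      show "\<psi> ` {s..t} \<in> sets borel" using cc by (rule borel_closed)
      show "closure (\<psi> ` {s..t}) \<subseteq> ball p R" unfolding closure_closed[OF cc] using inR st by auto
      show "\<psi> b \<in> E" "\<psi> b \<in> ball p R" using \<psi>E[of b] inR[of b] b st \<alpha>\<beta> by auto
      show "dist x (\<psi> b) \<le> t - s" if "x \<in> \<psi> ` {s..t}" for x using that iso' b st by auto
    qed (use st in auto)
    also have "\<dots> = measure M (E \<inter> contr (\<psi> b) (1 / 2) (\<psi> ` {s..t}))"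
    proof (rule finite_measure_eq_AE)
      show "AE x in M. (x \<in> contr (\<psi> b) (1 / 2) (\<psi> ` {s..t})) = (x \<in> E \<inter> contr (\<psi> b) (1 / 2) (\<psi> ` {s..t}))"
        using AE_msupport[OF sets_M] by eventually_elim auto
    qed (auto simp: closed_contr closed_E borel_closed closed_Int)
    also have "\<dots> \<le> measure M (\<psi> ` {(s + b) / 2..(t + b) / 2})"
      using con[of s t b "1/2"] st b by (intro finite_measure_mono mI) (auto simp: add_divide_distrib)
    finally show ?thesis .
  qed
  \<comment> \<open>The constant is k * (2 h)^2 from the contraction error times C * 4 h from the
    bound on the measure.\<close>
  have second: "\<bar>G (s + h) + G (s - h) - 2 * G s\<bar> \<le> (16 * k * C) * h ^ 3"
    if h: "0 < h" "h < L / 64" "\<alpha> \<le> s - h" "s + h \<le> \<beta>" for s h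
  proof -
    let ?\<mu> = "measure M (\<psi> ` {s - h..s + h})"
    let ?l = "measure M (\<psi> ` {s - h..s})" and ?r = "measure M (\<psi> ` {s..s + h})"
    have w: "(s + h - (s - h))\<^sup>2 = 4 * h\<^sup>2" by (simp add: power2_eq_square)
    have ends: "(s - h + (s - h)) / 2 = s - h" "(s + h + (s - h)) / 2 = s" "(s - h + (s + h)) / 2 = s" "(s + h + (s + h)) / 2 = s + h"
      by auto
    have "1 / 2 * (1 - k * (4 * h\<^sup>2)) * ?\<mu> \<le> ?l" "1 / 2 * (1 - k * (4 * h\<^sup>2)) * ?\<mu> \<le> ?r"
      using half[of "s - h" "s + h" "s - h"] half[of "s - h" "s + h" "s + h"] h unfolding w ends by simp_all
    moreover have "?\<mu> = ?l + ?r" using add[of "s - h" s "s + h"] h by simp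
    moreover have "G (s + h) + G (s - h) - 2 * G s = ?r - ?l"
      using Gd[of s "s + h"] Gd[of "s - h" s] h by simp
    ultimately have "\<bar>G (s + h) + G (s - h) - 2 * G s\<bar> \<le> k * (4 * h\<^sup>2) * ?\<mu>"
      by (simp add: abs_le_iff algebra_simps)
    also have "\<dots> \<le> k * (4 * h\<^sup>2) * (C * (2 * (s + h - (s - h))))"
      using up[of "s - h" "s + h"] h k(1) by (intro mult_left_mono) auto
    also have "\<dots> = (16 * k * C) * h ^ 3" by (simp add: power2_eq_square power3_eq_cube)
    finally show ?thesis .
  qed
  have cG: "continuous_on {\<alpha>..\<beta>} G"
    unfolding continuous_on_iff
  proof (intro ballI allI impI)
    fix s e :: real assume s: "s \<in> {\<alpha>..\<beta>}" and e: "0 < e"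
    define d where "d = min (L / 32) (e / (2 * C + 1))"
    have "(2 * C + 1) * d \<le> (2 * C + 1) * (e / (2 * C + 1))"
      using C by (intro mult_left_mono) (auto simp: d_def)
    then have "(2 * C + 1) * d \<le> e" using C by simp
    moreover have "d \<le> L / 32" unfolding d_def by (rule min.cobounded1)
    moreover have "0 < d" using L(1) e C by (simp add: d_def add_nonneg_pos)
    ultimately have d: "0 < d" "d \<le> L / 32" "(2 * C + 1) * d \<le> e" by blast+
    have *: "\<bar>G t - G u\<bar> < e" if tu: "t \<in> {\<alpha>..\<beta>}" "u \<in> {\<alpha>..\<beta>}" "u < t" "t - u < d" for t u
    proof -
      have "\<bar>G t - G u\<bar> = measure M (\<psi> ` {u..t})" using Gd[of u t] tu by simp
      also have "\<dots> \<le> C * (2 * (t - u))" using tu d by (intro up) auto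
      also have "\<dots> \<le> C * (2 * d)" using tu C by (intro mult_left_mono) auto
      also have "C * (2 * d) = 2 * C * d" by simp
      also have "\<dots> < (2 * C + 1) * d" using d by simp
      finally show ?thesis using d(3) by linarith
    qed
    show "\<exists>d>0. \<forall>x'\<in>{\<alpha>..\<beta>}. dist x' s < d \<longrightarrow> dist (G x') (G s) < e"
    proof (intro exI[of _ d] conjI ballI impI d(1))
      fix t assume t: "t \<in> {\<alpha>..\<beta>}" "dist t s < d"
      consider "t = s" | "t < s" | "s < t" by linarith
      then show "dist (G t) (G s) < e"
        using *[of s t] *[of t s] s t e by cases (auto simp: dist_real_def abs_minus_commute)
    qed
  qed
  define c where "c = (G \<beta> - G \<alpha>) / (\<beta> - \<alpha>)"
  have aff: "G s = G \<alpha> + (s - \<alpha>) * c" if "s \<in> {\<alpha>..\<beta>}" for s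
    unfolding c_def
    by (rule affine_if_second_difference_cubic[OF cG \<alpha>\<beta>(6) _ second that, where \<epsilon> = "L / 64"]) (use L(1) in auto)
  have meas: "measure M (\<psi> ` {s..t}) = c * (t - s)" if "\<alpha> \<le> s" "s \<le> t" "t \<le> \<beta>" for s t
    using Gd[OF that] aff[of s] aff[of t] that by (simp add: algebra_simps)
  have c0: "0 < c"
  proof -
    have "0 < measure M (ball p \<beta>)" using p \<alpha>\<beta> by (intro measure_ball_pos)
    also have "\<dots> = measure M (E \<inter> ball p \<beta>)"
    proof (rule finite_measure_eq_AE)
      show "AE x in M. (x \<in> ball p \<beta>) = (x \<in> E \<inter> ball p \<beta>)"
        using AE_msupport[OF sets_M] by eventually_elim auto
    qed (use closed_E in \<open>auto intro!: sets.Int borel_closed\<close>)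
    also have "\<dots> \<le> measure M (\<psi> ` {\<alpha>..\<beta>})"
      by (intro finite_measure_mono mI) (use img' in auto)
    also have "\<dots> = c * (\<beta> - \<alpha>)" using meas[of \<alpha> \<beta>] \<alpha>\<beta> by simp
    finally show ?thesis using \<alpha>\<beta> by (simp add: zero_less_mult_iff)
  qed
  have \<beta>y: "\<beta> \<le> dist p y" unfolding \<beta>_def using \<alpha>0(2,3) by linarith
  have \<psi>E': "\<psi> s \<in> E" if "s \<in> {\<alpha>..\<beta>}" for s using that \<psi>E[of s] \<alpha>\<beta> by auto
  show ?thesis
    by (rule that[OF \<alpha>\<beta>(1,2) \<beta>y c0 \<psi>E' iso' img' \<psi>0 meas con])
qed

end


section \<open>Optimal transport on the line\<close>

text \<open>Open sets are handled through their components, which are intervals, and Borel sets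
  through outer regularity of Lebesgue measure. No finiteness of \<kappa> is assumed.\<close>

lemma emeasure_le_lborel:
  fixes \<kappa> :: "real measure"
  assumes s: "sets \<kappa> = sets borel" and le: "\<And>c d. c \<le> d \<Longrightarrow> emeasure \<kappa> {c..d} \<le> ennreal (d - c)"
    and B: "B \<in> sets borel"
  shows "emeasure \<kappa> B \<le> emeasure lborel B"
proof -
  have opens: "emeasure \<kappa> U \<le> emeasure lborel U" if U: "open U" for U :: "real set"
  proof -
    have comp: "emeasure \<kappa> C \<le> emeasure lborel C" if C: "C \<in> components U" for C
    proof (cases "emeasure lborel C = \<infinity>")
      case False
      have oC: "open C" "C \<noteq> {}" "connected C"
        using open_components[OF U C] in_components_nonempty[OF C] in_components_connected[OF C] by auto
      have cc: "{x..y} \<subseteq> C" if "x \<in> C" "y \<in> C" for x y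
        using connected_contains_Icc[OF oC(3) that] .
      obtain x0 where x0: "x0 \<in> C" using oC by auto
      obtain L where L: "emeasure lborel C = ennreal L" "0 \<le> L" using False by (cases "emeasure lborel C") auto
      have len: "y - x \<le> L" if "x \<in> C" "y \<in> C" "x \<le> y" for x y
      proof -
        have "emeasure lborel {x..y} \<le> emeasure lborel C"
          using cc[OF that(1,2)] oC by (intro emeasure_mono) auto
        then show ?thesis using that L by simp
      qed
      have bd: "bdd_below C" "bdd_above C"
      proof -
        have "x0 - L \<le> y" if "y \<in> C" for y using len[of y x0] len[of x0 y] x0 that L by (cases "y \<le> x0") auto
        then show "bdd_below C" by (rule bdd_belowI)
        have "y \<le> x0 + L" if "y \<in> C" for y using len[of y x0] len[of x0 y] x0 that L by (cases "y \<le> x0") auto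
        then show "bdd_above C" by (rule bdd_aboveI)
      qed
      have IS: "Inf C \<le> Sup C" using bd x0 cInf_lower cSup_upper by (meson order_trans)
      have "C \<subseteq> {Inf C..Sup C}" using bd cInf_lower cSup_upper by fastforce
      then have "emeasure \<kappa> C \<le> emeasure \<kappa> {Inf C..Sup C}" using s by (intro emeasure_mono) auto
      also have "\<dots> \<le> ennreal (Sup C - Inf C)" using IS by (rule le)
      also have "\<dots> \<le> emeasure lborel {Inf C<..<Sup C}" using IS by simp
      also have "\<dots> \<le> emeasure lborel C"
      proof (rule emeasure_mono)
        show "{Inf C<..<Sup C} \<subseteq> C"
        proof
          fix z assume z: "z \<in> {Inf C<..<Sup C}"
          obtain x where "x \<in> C" "x < z" using z cInf_less_iff[OF oC(2) bd(1)] by auto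
          moreover obtain y where "y \<in> C" "z < y" using z less_cSup_iff[OF oC(2) bd(2)] by auto
          ultimately show "z \<in> C" using cc[of x y] by auto
        qed
      qed (use oC in auto)
      finally show ?thesis .
    qed simp
    have cnt: "countable (components U)"
      by (rule countable_disjoint_open_subsets)
        (auto simp: pairwise_def disjnt_def open_components[OF U] components_nonoverlap)
    have disj: "disjoint_family_on id (components U)"
      using components_nonoverlap unfolding disjoint_family_on_def by (metis id_apply)
    have bor: "C \<in> sets borel" if "C \<in> components U" for C
      using open_components[OF U that] by simp
    have "U = (\<Union>C\<in>components U. id C)" using Union_components[of U] by simp
    then have e: "emeasure M U = (\<integral>\<^sup>+ C. emeasure M C \<partial>count_space (components U))" if "sets M = sets borel" for M
      using emeasure_UN_countable[OF _ cnt disj, of M] bor that by auto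
    show ?thesis
      unfolding e[OF s] e[OF sets_lborel] by (intro nn_integral_mono) (simp add: comp)
  qed
  show ?thesis
  proof (rule ennreal_le_epsilon)
    fix e :: real assume "0 < e"
    obtain U where U: "open U" "B \<subseteq> U" "emeasure lborel (U - B) < ennreal e"
      using outer_regular_lborel[OF _ \<open>0 < e\<close>, of B] B by auto
    have "emeasure \<kappa> B \<le> emeasure \<kappa> U" using U s by (intro emeasure_mono) auto
    also have "\<dots> \<le> emeasure lborel U" by (rule opens[OF U(1)])
    also have "\<dots> = emeasure lborel B + emeasure lborel (U - B)"
      using U B by (subst plus_emeasure) (auto simp: Un_absorb1)
    also have "\<dots> \<le> emeasure lborel B + ennreal e" using U by (intro add_left_mono) simp
    finally show "emeasure \<kappa> B \<le> emeasure lborel B + ennreal e" .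
  qed
qed

text \<open>Each factor \<open>ennreal (x - a)\<close> is the positive part of x - a and equals the
  length of the set of s between a and x; Tonelli does the rest.\<close>

lemma nn_integral_mult_layer_cake:
  fixes \<xi> \<eta> :: "'b \<Rightarrow> real"
  assumes "prob_space P" and [measurable]: "\<xi> \<in> borel_measurable P" "\<eta> \<in> borel_measurable P"
  shows "(\<integral>\<^sup>+ w. ennreal (\<xi> w - a) * ennreal (\<eta> w - a) \<partial>P)
    = (\<integral>\<^sup>+ s. \<integral>\<^sup>+ u. emeasure P {w \<in> space P. a < s \<and> s < \<xi> w \<and> a < u \<and> u < \<eta> w} \<partial>lborel \<partial>lborel)"
proof -
  interpret P: prob_space P by fact
  interpret LP: pair_sigma_finite P lborel ..
  have L: "ennreal (x - a) = (\<integral>\<^sup>+ s. indicator {s. a < s \<and> s < x} s \<partial>lborel)" for x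
  proof -
    have "{s. a < s \<and> s < x} = {a<..<x}" by auto
    then show ?thesis by (cases "a \<le> x") (auto simp: ennreal_neg)
  qed
  have "(\<integral>\<^sup>+ w. ennreal (\<xi> w - a) * ennreal (\<eta> w - a) \<partial>P)
      = (\<integral>\<^sup>+ w. \<integral>\<^sup>+ s. indicator {s. a < s \<and> s < \<xi> w} s * ennreal (\<eta> w - a) \<partial>lborel \<partial>P)"
    by (intro nn_integral_cong) (simp add: L nn_integral_multc)
  also have "\<dots> = (\<integral>\<^sup>+ s. \<integral>\<^sup>+ w. indicator {s. a < s \<and> s < \<xi> w} s * ennreal (\<eta> w - a) \<partial>P \<partial>lborel)"
    by (rule LP.Fubini'[symmetric]) (simp add: indicator_def split_beta)
  also have "\<dots> = (\<integral>\<^sup>+ s. \<integral>\<^sup>+ u. emeasure P {w \<in> space P. a < s \<and> s < \<xi> w \<and> a < u \<and> u < \<eta> w} \<partial>lborel \<partial>lborel)"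
  proof (rule nn_integral_cong)
    fix s :: real
    have "(\<integral>\<^sup>+ w. indicator {s. a < s \<and> s < \<xi> w} s * ennreal (\<eta> w - a) \<partial>P)
        = (\<integral>\<^sup>+ w. \<integral>\<^sup>+ u. indicator {s. a < s \<and> s < \<xi> w} s * indicator {u. a < u \<and> u < \<eta> w} u \<partial>lborel \<partial>P)"
      by (intro nn_integral_cong) (simp add: L nn_integral_cmult)
    also have "\<dots> = (\<integral>\<^sup>+ u. \<integral>\<^sup>+ w. indicator {s. a < s \<and> s < \<xi> w} s * indicator {u. a < u \<and> u < \<eta> w} u \<partial>P \<partial>lborel)"
      by (rule LP.Fubini'[symmetric]) (simp add: indicator_def split_beta)
    also have "\<dots> = (\<integral>\<^sup>+ u. emeasure P {w \<in> space P. a < s \<and> s < \<xi> w \<and> a < u \<and> u < \<eta> w} \<partial>lborel)"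
    proof (rule nn_integral_cong)
      fix u :: real
      have "(\<integral>\<^sup>+ w. indicator {s. a < s \<and> s < \<xi> w} s * indicator {u. a < u \<and> u < \<eta> w} u \<partial>P)
        = (\<integral>\<^sup>+ w. indicator {w \<in> space P. a < s \<and> s < \<xi> w \<and> a < u \<and> u < \<eta> w} w \<partial>P)"
        by (intro nn_integral_cong) (auto simp: indicator_def)
      then show "(\<integral>\<^sup>+ w. indicator {s. a < s \<and> s < \<xi> w} s * indicator {u. a < u \<and> u < \<eta> w} u \<partial>P)
        = emeasure P {w \<in> space P. a < s \<and> s < \<xi> w \<and> a < u \<and> u < \<eta> w}" by simp
    qed
    finally show "(\<integral>\<^sup>+ w. indicator {s. a < s \<and> s < \<xi> w} s * ennreal (\<eta> w - a) \<partial>P)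
      = (\<integral>\<^sup>+ u. emeasure P {w \<in> space P. a < s \<and> s < \<xi> w \<and> a < u \<and> u < \<eta> w} \<partial>lborel)" .
  qed
  finally show ?thesis .
qed

section \<open>Monotone rearrangement over the unit interval\<close>

abbreviation unit_interval :: "real measure" where
  "unit_interval \<equiv> restrict_space lborel {0<..<1}"

lemma prob_space_unit_interval: "prob_space unit_interval"
  by (auto simp: space_restrict_space emeasure_restrict_space intro!: prob_spaceI)

lemma measurable_unit_interval: "f \<in> borel_measurable borel \<Longrightarrow> f \<in> borel_measurable unit_interval"
  by (rule measurable_restrict_space1) simp

text \<open>By Hoeffding's formula \<open>E \<xi>\<eta>\<close> is the integral of \<open>P(\<xi> > s, \<eta> > u)\<close>, and for comonotone
  variables this probability has the largest possible value \<open>min (P(\<xi> > s)) (P(\<eta> > u))\<close>.\<close>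

lemma comonotone_optimal:
  fixes X Y :: "real \<Rightarrow> real" and \<xi> \<eta> :: "'b \<Rightarrow> real"
  assumes P: "prob_space P" and [measurable]: "\<xi> \<in> borel_measurable P" "\<eta> \<in> borel_measurable P"
    and XY[measurable]: "X \<in> borel_measurable borel" "Y \<in> borel_measurable borel"
    and mono: "mono_on {0<..<1} X" "mono_on {0<..<1} Y"
    and range: "\<And>s. s \<in> {0<..<1} \<Longrightarrow> X s \<in> {a..b}" "\<And>s. s \<in> {0<..<1} \<Longrightarrow> Y s \<in> {a..b}"
    and law: "distr P borel \<xi> = distr unit_interval borel X" "distr P borel \<eta> = distr unit_interval borel Y"
  shows "(\<integral>\<^sup>+ s. ennreal ((X s - Y s)\<^sup>2) \<partial>unit_interval) \<le> (\<integral>\<^sup>+ w. ennreal ((\<xi> w - \<eta> w)\<^sup>2) \<partial>P)"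
proof -
  let ?\<Omega> = unit_interval
  interpret \<Omega>: prob_space ?\<Omega> by (rule prob_space_unit_interval)
  interpret P: prob_space P by fact
  have [measurable]: "X \<in> borel_measurable ?\<Omega>" "Y \<in> borel_measurable ?\<Omega>"
    by (intro measurable_unit_interval XY)+
  have sp: "space ?\<Omega> = {0<..<1}" by (simp add: space_restrict_space)
  have lawX: "emeasure P {w \<in> space P. \<xi> w \<in> B} = emeasure ?\<Omega> {w \<in> space ?\<Omega>. X w \<in> B}"
    and lawY: "emeasure P {w \<in> space P. \<eta> w \<in> B} = emeasure ?\<Omega> {w \<in> space ?\<Omega>. Y w \<in> B}"
    if [measurable]: "B \<in> sets borel" for B
    using arg_cong[OF law(1), of "\<lambda>M. emeasure M B"] arg_cong[OF law(2), of "\<lambda>M. emeasure M B"]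
    by (simp_all add: emeasure_distr vimage_def Int_def conj_commute)
  have lawX2: "(\<integral>\<^sup>+ w. f (\<xi> w) \<partial>P) = (\<integral>\<^sup>+ w. f (X w) \<partial>?\<Omega>)" and lawY2: "(\<integral>\<^sup>+ w. f (\<eta> w) \<partial>P) = (\<integral>\<^sup>+ w. f (Y w) \<partial>?\<Omega>)"
    if [measurable]: "f \<in> borel_measurable borel" for f :: "real \<Rightarrow> ennreal"
    using arg_cong[OF law(1), of "\<lambda>M. integral\<^sup>N M f"] arg_cong[OF law(2), of "\<lambda>M. integral\<^sup>N M f"]
    by (simp_all add: nn_integral_distr)
  have AE\<xi>: "AE w in P. \<xi> w \<in> {a..b}" and AE\<eta>: "AE w in P. \<eta> w \<in> {a..b}"
  proof -
    have "AE w in ?\<Omega>. X w \<in> {a..b}" "AE w in ?\<Omega>. Y w \<in> {a..b}" using range by (auto simp: sp intro!: AE_I2)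
    then have "AE x in distr P borel \<xi>. x \<in> {a..b}" "AE x in distr P borel \<eta>. x \<in> {a..b}"
      unfolding law by (simp_all add: AE_distr_iff)
    then show "AE w in P. \<xi> w \<in> {a..b}" "AE w in P. \<eta> w \<in> {a..b}" by (simp_all add: AE_distr_iff)
  qed
  have hoeffding: "(\<integral>\<^sup>+ w. ennreal (\<xi> w - a) * ennreal (\<eta> w - a) \<partial>P) \<le> (\<integral>\<^sup>+ w. ennreal (X w - a) * ennreal (Y w - a) \<partial>?\<Omega>)"
    unfolding nn_integral_mult_layer_cake[OF P \<open>\<xi> \<in> _\<close> \<open>\<eta> \<in> _\<close>]
      nn_integral_mult_layer_cake[OF \<Omega>.prob_space_axioms \<open>X \<in> borel_measurable ?\<Omega>\<close> \<open>Y \<in> borel_measurable ?\<Omega>\<close>]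
  proof (intro nn_integral_mono)
    fix s u :: real
    show "emeasure P {w \<in> space P. a < s \<and> s < \<xi> w \<and> a < u \<and> u < \<eta> w}
        \<le> emeasure ?\<Omega> {w \<in> space ?\<Omega>. a < s \<and> s < X w \<and> a < u \<and> u < Y w}"
    proof (cases "a < s \<and> a < u")
      case True
      \<comment> \<open>Superlevel sets of two increasing functions are nested, so their
        intersection is one of them and has the smaller of the two probabilities.\<close>
      have nest: "{w \<in> space ?\<Omega>. s < X w} \<subseteq> {w \<in> space ?\<Omega>. u < Y w} \<or> {w \<in> space ?\<Omega>. u < Y w} \<subseteq> {w \<in> space ?\<Omega>. s < X w}"
      proof (rule ccontr)
        assume "\<not> ?thesis"
        then obtain w w' where w: "w \<in> {0<..<1}" "s < X w" "\<not> u < Y w" "w' \<in> {0<..<1}" "u < Y w'" "\<not> s < X w'"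
          by (auto simp: sp)
        then show False
          using mono_onD[OF mono(1), of w w'] mono_onD[OF mono(2), of w' w] by (cases "w \<le> w'") auto
      qed
      have 1: "emeasure P {w \<in> space P. a < s \<and> s < \<xi> w \<and> a < u \<and> u < \<eta> w} \<le> emeasure P {w \<in> space P. \<xi> w \<in> {s<..}}"
        "emeasure P {w \<in> space P. a < s \<and> s < \<xi> w \<and> a < u \<and> u < \<eta> w} \<le> emeasure P {w \<in> space P. \<eta> w \<in> {u<..}}"
        by (intro emeasure_mono; auto)+
      have 2: "emeasure ?\<Omega> {w \<in> space ?\<Omega>. a < s \<and> s < X w \<and> a < u \<and> u < Y w} = emeasure ?\<Omega> {w \<in> space ?\<Omega>. X w \<in> {s<..}}
        \<or> emeasure ?\<Omega> {w \<in> space ?\<Omega>. a < s \<and> s < X w \<and> a < u \<and> u < Y w} = emeasure ?\<Omega> {w \<in> space ?\<Omega>. Y w \<in> {u<..}}"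
        using nest True by (elim disjE) (auto intro!: arg_cong[where f = "emeasure ?\<Omega>"] simp: subset_iff)
      show ?thesis using 1 2 lawX[of "{s<..}"] lawY[of "{u<..}"] by auto
    qed auto
  qed
  \<comment> \<open>Expansion of the square in additive form, as values in \<open>ennreal\<close>
    cannot be subtracted freely. The sum of the two squares depends on the laws alone, so comparing
    costs amounts to comparing mixed terms.\<close>
  have expand: "ennreal ((x - y)\<^sup>2) + 2 * (ennreal (x - a) * ennreal (y - a)) = ennreal ((x - a)\<^sup>2) + ennreal ((y - a)\<^sup>2)"
    if "x \<in> {a..b}" "y \<in> {a..b}" for x y
  proof -
    have "ennreal ((x - y)\<^sup>2) + 2 * (ennreal (x - a) * ennreal (y - a)) = ennreal ((x - y)\<^sup>2 + 2 * ((x - a) * (y - a)))"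
      using that by (simp add: ennreal_mult' ennreal_numeral[symmetric] del: ennreal_numeral)
    also have "(x - y)\<^sup>2 + 2 * ((x - a) * (y - a)) = (x - a)\<^sup>2 + (y - a)\<^sup>2"
      by (simp add: power2_eq_square algebra_simps)
    finally show ?thesis by simp
  qed
  have "(\<integral>\<^sup>+ s. ennreal ((X s - Y s)\<^sup>2) \<partial>?\<Omega>) + 2 * (\<integral>\<^sup>+ w. ennreal (X w - a) * ennreal (Y w - a) \<partial>?\<Omega>)
      = (\<integral>\<^sup>+ s. ennreal ((X s - Y s)\<^sup>2) + 2 * (ennreal (X s - a) * ennreal (Y s - a)) \<partial>?\<Omega>)"
    by (simp add: nn_integral_add nn_integral_cmult)
  also have "\<dots> = (\<integral>\<^sup>+ s. ennreal ((X s - a)\<^sup>2) + ennreal ((Y s - a)\<^sup>2) \<partial>?\<Omega>)"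
    by (intro nn_integral_cong expand range) (auto simp: sp)
  also have "\<dots> = (\<integral>\<^sup>+ s. ennreal ((X s - a)\<^sup>2) \<partial>?\<Omega>) + (\<integral>\<^sup>+ s. ennreal ((Y s - a)\<^sup>2) \<partial>?\<Omega>)"
    by (simp add: nn_integral_add)
  also have "\<dots> = (\<integral>\<^sup>+ w. ennreal ((\<xi> w - a)\<^sup>2) \<partial>P) + (\<integral>\<^sup>+ w. ennreal ((\<eta> w - a)\<^sup>2) \<partial>P)"
    using lawX2[of "\<lambda>x. ennreal ((x - a)\<^sup>2)"] lawY2[of "\<lambda>x. ennreal ((x - a)\<^sup>2)"] by simp
  also have "\<dots> = (\<integral>\<^sup>+ w. ennreal ((\<xi> w - a)\<^sup>2) + ennreal ((\<eta> w - a)\<^sup>2) \<partial>P)"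
    by (simp add: nn_integral_add)
  also have "\<dots> = (\<integral>\<^sup>+ w. ennreal ((\<xi> w - \<eta> w)\<^sup>2) + 2 * (ennreal (\<xi> w - a) * ennreal (\<eta> w - a)) \<partial>P)"
    by (intro nn_integral_cong_AE) (use AE\<xi> AE\<eta> in \<open>eventually_elim, simp only: expand\<close>)
  also have "\<dots> = (\<integral>\<^sup>+ w. ennreal ((\<xi> w - \<eta> w)\<^sup>2) \<partial>P) + 2 * (\<integral>\<^sup>+ w. ennreal (\<xi> w - a) * ennreal (\<eta> w - a) \<partial>P)"
    by (simp add: nn_integral_add nn_integral_cmult)
  also have "\<dots> \<le> (\<integral>\<^sup>+ w. ennreal ((\<xi> w - \<eta> w)\<^sup>2) \<partial>P) + 2 * (\<integral>\<^sup>+ w. ennreal (X w - a) * ennreal (Y w - a) \<partial>?\<Omega>)"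
    by (intro add_left_mono mult_left_mono hoeffding) auto
  finally have le: "2 * (\<integral>\<^sup>+ w. ennreal (X w - a) * ennreal (Y w - a) \<partial>?\<Omega>) + (\<integral>\<^sup>+ s. ennreal ((X s - Y s)\<^sup>2) \<partial>?\<Omega>)
     \<le> 2 * (\<integral>\<^sup>+ w. ennreal (X w - a) * ennreal (Y w - a) \<partial>?\<Omega>) + (\<integral>\<^sup>+ w. ennreal ((\<xi> w - \<eta> w)\<^sup>2) \<partial>P)"
    by (simp add: add.commute)
  \<comment> \<open>Boundedness of the ranges makes the mixed term finite, so it may be
    cancelled.\<close>
  have "(\<integral>\<^sup>+ w. ennreal (X w - a) * ennreal (Y w - a) \<partial>?\<Omega>) \<le> (\<integral>\<^sup>+ w. ennreal (b - a) * ennreal (b - a) \<partial>?\<Omega>)"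
    by (intro nn_integral_mono mult_mono ennreal_leI) (use range in \<open>auto simp: sp\<close>)
  also have "\<dots> < \<infinity>" using \<Omega>.emeasure_space_1 by (simp add: ennreal_mult_less_top)
  finally have "2 * (\<integral>\<^sup>+ w. ennreal (X w - a) * ennreal (Y w - a) \<partial>?\<Omega>) \<noteq> \<top>"
    by (simp add: ennreal_mult_eq_top_iff)
  then show ?thesis using le by (simp add: ennreal_add_left_cancel_le)
qed


text \<open>X0 and X1 are quantile functions of the densities g0 and g1. They are strictly
  increasing because absolutely continuous laws have no atoms.\<close>

locale monotone_pair =
  fixes a b :: real and X0 X1 g0 g1 :: "real \<Rightarrow> real"
  assumes borel [measurable]: "X0 \<in> borel_measurable borel" "X1 \<in> borel_measurable borel"
      "g0 \<in> borel_measurable borel" "g1 \<in> borel_measurable borel"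
    and strict: "strict_mono_on {0<..<1} X0" "strict_mono_on {0<..<1} X1"
    and range: "\<And>s. s \<in> {0<..<1} \<Longrightarrow> X0 s \<in> {a..b}" "\<And>s. s \<in> {0<..<1} \<Longrightarrow> X1 s \<in> {a..b}"
    and nonneg: "\<And>x. 0 \<le> g0 x" "\<And>x. 0 \<le> g1 x"
    and law: "distr unit_interval borel X0 = density lborel (\<lambda>x. ennreal (g0 x))"
      "distr unit_interval borel X1 = density lborel (\<lambda>x. ennreal (g1 x))"
begin

definition X :: "real \<Rightarrow> real \<Rightarrow> real" where "X t s = (1 - t) * X0 s + t * X1 s"

text \<open>Formally the derivative of \<open>X t\<close>, since a quantile function has derivative
  1 / g0 (X0 s). It is used only under integrals, where inequalities suffice and differentiability
  plays no part.\<close>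

definition v :: "real \<Rightarrow> real \<Rightarrow> real" where "v t s = (1 - t) / g0 (X0 s) + t / g1 (X1 s)"

lemma borel_X [measurable]: "X t \<in> borel_measurable borel"
  unfolding X_def[abs_def] by measurable

lemma borel_v [measurable]: "v t \<in> borel_measurable borel"
  unfolding v_def[abs_def] by measurable

lemma sp: "space unit_interval = {0<..<1}"
  by (simp add: space_restrict_space)

lemma X_strict: assumes "0 \<le> t" "t \<le> 1" shows "strict_mono_on {0<..<1} (X t)"
proof (rule strict_mono_onI)
  fix r s :: real assume rs: "r \<in> {0<..<1}" "s \<in> {0<..<1}" "r < s"
  then have "X0 r < X0 s" "X1 r < X1 s" using strict_mono_onD[OF strict(1)] strict_mono_onD[OF strict(2)] by blast+
  then show "X t r < X t s"
    using assms unfolding X_def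
    by (cases "t = 0") (auto intro!: add_le_less_mono mult_left_mono mult_strict_left_mono)
qed

lemma X_range: assumes "0 \<le> t" "t \<le> 1" "s \<in> {0<..<1}" shows "X t s \<in> {a..b}"
proof -
  have "(1 - t) * a + t * a \<le> X t s" "X t s \<le> (1 - t) * b + t * b"
    unfolding X_def using assms range[of s] by (auto intro!: add_mono mult_left_mono)
  then show ?thesis by (simp add: algebra_simps)
qed

lemma density_pos:
  assumes [measurable]: "g \<in> borel_measurable borel" "Y \<in> borel_measurable borel" and g: "\<And>x. 0 \<le> g x"
    and law: "distr unit_interval borel Y = density lborel (\<lambda>x. ennreal (g x))"
  shows "AE s in unit_interval. 0 < g (Y s)"
proof -
  have "AE x in density lborel (\<lambda>x. ennreal (g x)). 0 < g x"
    by (subst AE_density) auto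
  then have "AE x in distr unit_interval borel Y. 0 < g x" unfolding law .
  then show ?thesis by (simp add: AE_distr_iff measurable_unit_interval)
qed

lemma v_pos: assumes "0 \<le> t" "t \<le> 1" shows "AE s in unit_interval. 0 < v t s"
  using density_pos[OF borel(3,1) nonneg(1) law(1)] density_pos[OF borel(4,2) nonneg(2) law(2)]
proof eventually_elim
  case (elim s)
  then show ?case using assms unfolding v_def
    by (cases "t = 0") (auto intro!: add_nonneg_pos)
qed

text \<open>Change of variables: integrating 1/g against the density g leaves Lebesgue measure on
  the set where g is positive.\<close>

lemma integral_inverse_density:
  assumes [measurable]: "g \<in> borel_measurable borel" "Y \<in> borel_measurable borel" and g: "\<And>x. 0 \<le> g x"
    and law: "distr unit_interval borel Y = density lborel (\<lambda>x. ennreal (g x))"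
    and [measurable]: "B \<in> sets borel"
  shows "(\<integral>\<^sup>+ s. ennreal (1 / g (Y s)) * indicator B (Y s) \<partial>unit_interval) = emeasure lborel {x \<in> B. 0 < g x}"
proof -
  have "(\<integral>\<^sup>+ s. ennreal (1 / g (Y s)) * indicator B (Y s) \<partial>unit_interval)
      = (\<integral>\<^sup>+ x. ennreal (1 / g x) * indicator B x \<partial>distr unit_interval borel Y)"
    by (subst nn_integral_distr) (auto intro: measurable_unit_interval)
  also have "\<dots> = (\<integral>\<^sup>+ x. ennreal (g x) * (ennreal (1 / g x) * indicator B x) \<partial>lborel)"
    unfolding law by (subst nn_integral_density) auto
  also have "\<dots> = (\<integral>\<^sup>+ x. indicator {x \<in> B. 0 < g x} x \<partial>lborel)"
  proof (intro nn_integral_cong)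
    fix x show "ennreal (g x) * (ennreal (1 / g x) * indicator B x) = indicator {x \<in> B. 0 < g x} x"
      using g[of x] by (cases "g x = 0") (auto simp: indicator_def less_le ennreal_mult'[symmetric])
  qed
  also have "\<dots> = emeasure lborel {x \<in> B. 0 < g x}" by simp
  finally show ?thesis .
qed

lemma integral_inverse_density_Icc:
  assumes "g \<in> borel_measurable borel" "Y \<in> borel_measurable borel" "\<And>x. 0 \<le> g x"
    and "distr unit_interval borel Y = density lborel (\<lambda>x. ennreal (g x))"
    and Y: "strict_mono_on {0<..<1} Y" and s: "s1 \<in> {0<..<1}" "s2 \<in> {0<..<1}" "s1 \<le> s2"
  shows "(\<integral>\<^sup>+ s. ennreal (1 / g (Y s)) * indicator {s1..s2} s \<partial>unit_interval) \<le> ennreal (Y s2 - Y s1)"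
proof -
  have mono: "Y r \<le> Y r'" if "r \<in> {0<..<1}" "r' \<in> {0<..<1}" "r \<le> r'" for r r'
    using strict_mono_onD[OF Y, of r r'] that by (cases "r = r'") auto
  have "(\<integral>\<^sup>+ s. ennreal (1 / g (Y s)) * indicator {s1..s2} s \<partial>unit_interval)
    \<le> (\<integral>\<^sup>+ s. ennreal (1 / g (Y s)) * indicator {Y s1..Y s2} (Y s) \<partial>unit_interval)"
    by (intro nn_integral_mono mult_left_mono) (use mono s in \<open>auto simp: indicator_def sp\<close>)
  also have "\<dots> = emeasure lborel {x \<in> {Y s1..Y s2}. 0 < g x}"
    by (rule integral_inverse_density) (use assms in auto)
  also have "\<dots> \<le> emeasure lborel {Y s1..Y s2}" by (intro emeasure_mono) auto
  also have "\<dots> = ennreal (Y s2 - Y s1)" using mono[OF s] by simp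
  finally show ?thesis .
qed

lemma integral_v_Icc:
  assumes t: "0 \<le> t" "t \<le> 1" and s: "s1 \<in> {0<..<1}" "s2 \<in> {0<..<1}" "s1 \<le> s2"
  shows "(\<integral>\<^sup>+ s. ennreal (v t s) * indicator {s1..s2} s \<partial>unit_interval) \<le> ennreal (X t s2 - X t s1)"
proof -
  note [measurable] = measurable_unit_interval
  have m: "(\<lambda>s. ennreal (1 / g0 (X0 s)) * indicator {s1..s2} s) \<in> borel_measurable unit_interval"
    "(\<lambda>s. ennreal (1 / g1 (X1 s)) * indicator {s1..s2} s) \<in> borel_measurable unit_interval"
    by (intro measurable_unit_interval; measurable)+
  have mono: "X0 s1 \<le> X0 s2" "X1 s1 \<le> X1 s2"
    using strict_mono_onD[OF strict(1), of s1 s2] strict_mono_onD[OF strict(2), of s1 s2] s by (cases "s1 = s2"; auto)+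
  have "(\<integral>\<^sup>+ s. ennreal (v t s) * indicator {s1..s2} s \<partial>unit_interval)
     = (\<integral>\<^sup>+ s. ennreal (1 - t) * (ennreal (1 / g0 (X0 s)) * indicator {s1..s2} s)
         + ennreal t * (ennreal (1 / g1 (X1 s)) * indicator {s1..s2} s) \<partial>unit_interval)"
    using t nonneg by (intro nn_integral_cong)
      (auto simp: v_def indicator_def ennreal_mult'[symmetric] ennreal_plus[symmetric] simp del: ennreal_plus)
  also have "\<dots> = ennreal (1 - t) * (\<integral>\<^sup>+ s. ennreal (1 / g0 (X0 s)) * indicator {s1..s2} s \<partial>unit_interval)
      + ennreal t * (\<integral>\<^sup>+ s. ennreal (1 / g1 (X1 s)) * indicator {s1..s2} s \<partial>unit_interval)"
    using m by (simp add: nn_integral_add nn_integral_cmult)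
  also have "\<dots> \<le> ennreal (1 - t) * ennreal (X0 s2 - X0 s1) + ennreal t * ennreal (X1 s2 - X1 s1)"
    by (intro add_mono mult_left_mono integral_inverse_density_Icc borel nonneg law strict s) auto
  also have "\<dots> = ennreal ((1 - t) * (X0 s2 - X0 s1) + t * (X1 s2 - X1 s1))"
    using t mono by (simp add: ennreal_mult' ennreal_plus)
  also have "(1 - t) * (X0 s2 - X0 s1) + t * (X1 s2 - X1 s1) = X t s2 - X t s1"
    by (simp add: X_def algebra_simps)
  finally show ?thesis .
qed

text \<open>The preimage of [c,d] under an increasing function is an interval up to its two ends i
  and u. These may fall on 0 or 1, where \<open>X t\<close> is not controlled, so the open interval
  is exhausted by closed ones inside.\<close>

lemma integral_v_le_Icc:
  assumes t: "0 \<le> t" "t \<le> 1" and "c \<le> d"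
  shows "(\<integral>\<^sup>+ s. ennreal (v t s) * indicator {c..d} (X t s) \<partial>unit_interval) \<le> ennreal (d - c)"
proof (cases "\<exists>s\<in>{0<..<1}. X t s \<in> {c..d}")
  case False
  then have "(\<integral>\<^sup>+ s. ennreal (v t s) * indicator {c..d} (X t s) \<partial>unit_interval) = (\<integral>\<^sup>+ s. 0 \<partial>unit_interval)"
    by (intro nn_integral_cong) (auto simp: sp indicator_def)
  then show ?thesis by simp
next
  case True
  define S where "S = {s \<in> {0<..<1}. X t s \<in> {c..d}}"
  have S: "S \<noteq> {}" "bdd_below S" "bdd_above S"
    using True by (auto simp: S_def intro!: bdd_belowI[of _ 0] bdd_aboveI[of _ 1])
  define i u where "i = Inf S" and "u = Sup S"
  have iu: "\<And>s. s \<in> S \<Longrightarrow> i \<le> s" "\<And>s. s \<in> S \<Longrightarrow> s \<le> u" unfolding i_def u_def using S cInf_lower cSup_upper by auto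
  have mono: "X t r \<le> X t r'" if "r \<in> {0<..<1}" "r' \<in> {0<..<1}" "r \<le> r'" for r r'
    using strict_mono_onD[OF X_strict[OF t], of r r'] that by (cases "r = r'") auto
  have inner: "s \<in> S" if si: "i < s" "s < u" for s
  proof -
    obtain r where r: "r \<in> S" "r < s" using si cInf_less_iff[OF S(1,2), of s] by (auto simp: i_def)
    obtain r' where r': "r' \<in> S" "s < r'" using si less_cSup_iff[OF S(1,3), of s] by (auto simp: u_def)
    have "s \<in> {0<..<1}" using r r' by (auto simp: S_def)
    then show ?thesis using mono[of r s] mono[of s r'] r r' by (auto simp: S_def)
  qed
  define J where "J n = {i + 1 / real (Suc n)..u - 1 / real (Suc n)}" for n
  have incJ: "incseq J"
    unfolding J_def incseq_def by (auto intro!: order_trans[OF add_left_mono] order_trans[OF _ diff_left_mono] simp: frac_le)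
  have UJ: "(\<Union>n. J n) = {i<..<u}"
  proof
    show "(\<Union>n. J n) \<subseteq> {i<..<u}"
    proof
      fix s assume "s \<in> (\<Union>n. J n)"
      then obtain n where "i + 1 / real (Suc n) \<le> s" "s \<le> u - 1 / real (Suc n)" by (auto simp: J_def)
      moreover have "0 < 1 / real (Suc n)" by simp
      ultimately show "s \<in> {i<..<u}" unfolding greaterThanLessThan_iff by linarith
    qed
    show "{i<..<u} \<subseteq> (\<Union>n. J n)"
    proof
      fix s assume s: "s \<in> {i<..<u}"
      obtain n where "1 / real (Suc n) < min (s - i) (u - s)" using nat_approx_posE[of "min (s - i) (u - s)"] s by auto
      then have "s \<in> J n" by (auto simp: J_def)
      then show "s \<in> (\<Union>n. J n)" by blast
    qed
  qed
  let ?D = "density unit_interval (\<lambda>s. ennreal (v t s))"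
  have mv: "(\<lambda>s. ennreal (v t s)) \<in> borel_measurable unit_interval"
    by (intro measurable_unit_interval) measurable
  have sJ: "emeasure ?D (B \<inter> {0<..<1}) = (\<integral>\<^sup>+ s. ennreal (v t s) * indicator B s \<partial>unit_interval)"
    if "B \<in> sets borel" for B
    using that mv by (subst emeasure_density)
      (auto intro!: nn_integral_cong simp: sp indicator_def sets_restrict_space_iff)
  have "(\<integral>\<^sup>+ s. ennreal (v t s) * indicator {c..d} (X t s) \<partial>unit_interval)
      = (\<integral>\<^sup>+ s. ennreal (v t s) * indicator {i<..<u} s \<partial>unit_interval)"
  proof (rule nn_integral_cong_AE)
    have "AE s in lborel. s \<noteq> i \<and> s \<noteq> u" by (auto intro: AE_lborel_singleton)
    then have "AE s in unit_interval. s \<noteq> i \<and> s \<noteq> u" by (subst AE_restrict_space_iff) auto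
    then show "AE s in unit_interval. ennreal (v t s) * indicator {c..d} (X t s) = ennreal (v t s) * indicator {i<..<u} s"
      using AE_space
    proof eventually_elim
      case (elim s)
      have "X t s \<in> {c..d} \<longleftrightarrow> s \<in> S" using elim by (simp add: S_def sp)
      also have "\<dots> \<longleftrightarrow> s \<in> {i<..<u}" using elim iu[of s] inner[of s] by fastforce
      finally show ?case by (simp add: indicator_def)
    qed
  qed
  also have "\<dots> = emeasure ?D ({i<..<u} \<inter> {0<..<1})" by (rule sJ[symmetric]) simp
  also have "\<dots> = emeasure ?D (\<Union>n. J n \<inter> {0<..<1})" unfolding UJ[symmetric] by (simp only: UN_extend_simps)
  also have "\<dots> = (SUP n. emeasure ?D (J n \<inter> {0<..<1}))"
  proof (rule SUP_emeasure_incseq[symmetric])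
    show "range (\<lambda>n. J n \<inter> {0<..<1}) \<subseteq> sets ?D" by (auto simp: J_def sets_restrict_space_iff)
    show "incseq (\<lambda>n. J n \<inter> {0<..<1})" using incJ unfolding incseq_def by blast
  qed
  also have "\<dots> \<le> ennreal (d - c)"
  proof (rule SUP_least)
    fix n
    show "emeasure ?D (J n \<inter> {0<..<1}) \<le> ennreal (d - c)"
    proof (cases "i + 1 / real (Suc n) \<le> u - 1 / real (Suc n)")
      case True
      let ?s1 = "i + 1 / real (Suc n)" and ?s2 = "u - 1 / real (Suc n)"
      have pos: "0 < 1 / real (Suc n)" by simp
      have "?s1 \<in> S" "?s2 \<in> S" by (rule inner; use True pos in linarith)+
      then have s12: "?s1 \<in> {0<..<1}" "?s2 \<in> {0<..<1}" "X t ?s2 - X t ?s1 \<le> d - c" by (auto simp: S_def)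
      have "emeasure ?D (J n \<inter> {0<..<1}) \<le> ennreal (X t ?s2 - X t ?s1)"
        using integral_v_Icc[OF t s12(1,2) True] sJ[of "J n"] by (simp add: J_def)
      also have "\<dots> \<le> ennreal (d - c)" using s12(3) by (rule ennreal_leI)
      finally show ?thesis .
    qed (simp add: J_def)
  qed
  finally show ?thesis .
qed

text \<open>The image under \<open>X t\<close> of the measure with density \<open>v t\<close> is
  dominated by Lebesgue measure; intervals are enough to see this.\<close>

lemma integral_v_le:
  assumes t: "0 \<le> t" "t \<le> 1" and [measurable]: "B \<in> sets borel"
  shows "(\<integral>\<^sup>+ s. ennreal (v t s) * indicator B (X t s) \<partial>unit_interval) \<le> emeasure lborel B"
proof -
  define \<kappa> where "\<kappa> = distr (density unit_interval (\<lambda>s. ennreal (v t s))) borel (X t)"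
  have mX: "X t \<in> borel_measurable unit_interval" and mv: "(\<lambda>s. ennreal (v t s)) \<in> borel_measurable unit_interval"
    by (intro measurable_unit_interval; measurable)+
  have \<kappa>: "emeasure \<kappa> C = (\<integral>\<^sup>+ s. ennreal (v t s) * indicator C (X t s) \<partial>unit_interval)" if "C \<in> sets borel" for C
  proof -
    have "emeasure \<kappa> C = emeasure (density unit_interval (\<lambda>s. ennreal (v t s))) (X t -` C \<inter> space unit_interval)"
      using that mX unfolding \<kappa>_def by (subst emeasure_distr) auto
    also have "\<dots> = (\<integral>\<^sup>+ s. ennreal (v t s) * indicator (X t -` C \<inter> space unit_interval) s \<partial>unit_interval)"
      using mv measurable_sets[OF mX that] by (rule emeasure_density)
    also have "\<dots> = (\<integral>\<^sup>+ s. ennreal (v t s) * indicator C (X t s) \<partial>unit_interval)"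
      by (intro nn_integral_cong) (auto simp: indicator_def)
    finally show ?thesis .
  qed
  have "emeasure \<kappa> B \<le> emeasure lborel B"
    by (rule emeasure_le_lborel) (use \<kappa> integral_v_le_Icc[OF t] in \<open>auto simp: \<kappa>_def\<close>)
  then show ?thesis using \<kappa>[of B] by simp
qed

lemma X_absolutely_continuous:
  assumes t: "0 \<le> t" "t \<le> 1" and B: "B \<in> sets borel" "emeasure lborel B = 0"
  shows "emeasure (distr unit_interval borel (X t)) B = 0"
proof -
  note [measurable] = B(1)
  have mX: "X t \<in> borel_measurable unit_interval"
    by (intro measurable_unit_interval) measurable
  have "(\<lambda>s. ennreal (v t s) * indicator B (X t s)) \<in> borel_measurable unit_interval"
    by (intro measurable_unit_interval) measurable
  moreover have "(\<integral>\<^sup>+ s. ennreal (v t s) * indicator B (X t s) \<partial>unit_interval) = 0"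
    using integral_v_le[OF t B(1)] B(2) by simp
  ultimately have "AE s in unit_interval. ennreal (v t s) * indicator B (X t s) = 0"
    by (simp add: nn_integral_0_iff_AE)
  then have "AE s in unit_interval. X t s \<notin> B"
    using v_pos[OF t] by eventually_elim (auto simp: indicator_def split: if_splits)
  then have "AE x in distr unit_interval borel (X t). x \<notin> B"
    using B mX by (subst AE_distr_iff) auto
  then show ?thesis using B(1) by (subst (asm) AE_iff_measurable[of B]) auto
qed

text \<open>A monotone left inverse of \<open>X t\<close> transfers the integrated inequality to a pointwise one.\<close>

lemma inverse_density_ge:
  assumes t: "0 \<le> t" "t \<le> 1" and [measurable]: "g \<in> borel_measurable borel" and g: "\<And>x. 0 \<le> g x"
    and lawt: "distr unit_interval borel (X t) = density lborel (\<lambda>x. ennreal (g x))"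
  shows "AE s in unit_interval. v t s \<le> 1 / g (X t s)"
proof -
  have mX: "X t \<in> borel_measurable unit_interval"
    by (intro measurable_unit_interval) measurable
  interpret \<Omega>: prob_space unit_interval by (rule prob_space_unit_interval)
  \<comment> \<open>The distribution function of \<open>X t\<close>. It recovers s from the position
    \<open>X t s\<close> and so expresses v as a Borel function of the position.\<close>
  define F where "F x = measure unit_interval {s \<in> {0<..<1}. X t s \<le> x}" for x
  have sF: "{s \<in> {0<..<1}. X t s \<le> x} \<in> sets unit_interval" for x
    using measurable_sets[OF mX, of "{..x}"] by (simp add: sp vimage_def Int_def conj_commute)
  have "mono F"
    unfolding mono_def F_def using sF by (auto intro!: \<Omega>.finite_measure_mono)
  then have [measurable]: "F \<in> borel_measurable borel" by (rule borel_measurable_mono)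
  have FX: "F (X t s) = s" if s: "s \<in> {0<..<1}" for s
  proof -
    have "X t r \<le> X t s \<longleftrightarrow> r \<le> s" if "r \<in> {0<..<1}" for r
      using strict_mono_onD[OF X_strict[OF t], of r s] strict_mono_onD[OF X_strict[OF t], of s r] s that
      by (cases r s rule: linorder_cases) auto
    then have "{r \<in> {0<..<1}. X t r \<le> X t s} = {r \<in> {0<..<1}. r \<le> s}" by blast
    also have "\<dots> = {0<..s}" using s by auto
    finally have "{r \<in> {0<..<1}. X t r \<le> X t s} = {0<..s}" .
    then have "F (X t s) = measure unit_interval {0<..s}" by (simp only: F_def)
    moreover have sub: "{0<..s} \<subseteq> {0<..<1}" using s by auto
    ultimately have "F (X t s) = measure unit_interval {0<..s}" by blast
    also have "\<dots> = measure lborel {0<..s}"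
      by (rule measure_restrict_space) (use sub in simp_all)
    finally have "F (X t s) = measure lborel {0<..s}" .
    then show ?thesis using s by simp
  qed
  \<comment> \<open>The positions where the claim fails; restricting to {a..b} makes their Lebesgue
    measure finite, as needed to exclude strict inequality of the integrals.\<close>
  define B where "B = {x. 0 < g x \<and> 1 / g x < v t (F x) \<and> x \<in> {a..b}}"
  have [measurable]: "B \<in> sets borel" unfolding B_def by measurable
  define p q where "p s = ennreal (1 / g (X t s)) * indicator B (X t s)"
    and "q s = ennreal (v t s) * indicator B (X t s)" for s
  have mpq: "p \<in> borel_measurable unit_interval" "q \<in> borel_measurable unit_interval"
    unfolding p_def q_def by (intro measurable_unit_interval; measurable)+
  have ip: "(\<integral>\<^sup>+ s. p s \<partial>unit_interval) = emeasure lborel B"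
  proof -
    have "(\<integral>\<^sup>+ s. p s \<partial>unit_interval) = emeasure lborel {x \<in> B. 0 < g x}"
      unfolding p_def by (rule integral_inverse_density) (use g lawt in auto)
    also have "{x \<in> B. 0 < g x} = B" by (auto simp: B_def)
    finally show ?thesis .
  qed
  have fin: "emeasure lborel B < \<infinity>"
  proof -
    have "emeasure lborel B \<le> emeasure lborel {a..b}" by (intro emeasure_mono) (auto simp: B_def)
    also have "\<dots> < \<infinity>" by (cases "a \<le> b") auto
    finally show ?thesis .
  qed
  \<comment> \<open>On B the failure of the claim gives p <= q, while the integral of q is at most
    |B|, which is the integral of p. Hence p = q almost everywhere.\<close>
  have pq: "AE s in unit_interval. p s \<le> q s"
    using AE_space by eventually_elim (auto simp: p_def q_def indicator_def B_def sp FX intro!: ennreal_leI)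
  have "AE s in unit_interval. q s \<le> p s"
  proof (rule ccontr)
    assume "\<not> ?thesis"
    then have "(\<integral>\<^sup>+ s. p s \<partial>unit_interval) < (\<integral>\<^sup>+ s. q s \<partial>unit_interval)"
      using mpq pq ip fin by (intro nn_integral_less) auto
    moreover have "(\<integral>\<^sup>+ s. q s \<partial>unit_interval) \<le> emeasure lborel B"
      unfolding q_def by (rule integral_v_le[OF t]) measurable
    ultimately show False using ip by simp
  qed
  then show ?thesis
    using density_pos[OF \<open>g \<in> _\<close> borel_X g lawt] AE_space
  proof eventually_elim
    case (elim s)
    have s: "s \<in> {0<..<1}" using elim by (simp add: sp)
    show ?case
    proof (rule ccontr)
      assume lt: "\<not> v t s \<le> 1 / g (X t s)"
      then have "X t s \<in> B" using elim s FX[OF s] X_range[OF t s] by (simp add: B_def)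
      then have "ennreal (v t s) \<le> ennreal (1 / g (X t s))" using elim(1) by (simp add: p_def q_def)
      then show False using lt elim(2) by (simp add: ennreal_le_iff)
    qed
  qed
qed

end


text \<open>The generalised inverse of the distribution function. If it were constant on an interval
  (r,s), the law would have an atom of mass at least s - r. Outside the open unit interval the value
  is set to 0, which makes X Borel on the whole line.\<close>

lemma quantile_exists:
  fixes g :: "real \<Rightarrow> real"
  assumes [measurable]: "g \<in> borel_measurable borel" and P: "prob_space (density lborel (\<lambda>x. ennreal (g x)))"
    and supp: "\<And>x. x \<notin> {a..b} \<Longrightarrow> g x = 0"
  obtains X where "X \<in> borel_measurable borel" "strict_mono_on {0<..<1} X" "\<And>s. s \<in> {0<..<1} \<Longrightarrow> X s \<in> {a..b}"
    "distr unit_interval borel X = density lborel (\<lambda>x. ennreal (g x))"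
proof -
  define D where "D = density lborel (\<lambda>x. ennreal (g x))"
  interpret P: prob_space D using P by (simp add: D_def)
  have sD: "sets D = sets borel" by (simp add: D_def)
  interpret D: cdf_distribution D
    unfolding cdf_distribution_def real_distribution_def real_distribution_axioms_def
    using P.prob_space_axioms sD sets_eq_imp_space_eq[OF sD] by auto
  let ?I = "\<lambda>w. Inf {x. w \<le> cdf D x}"
  have pinv: "w \<le> cdf D x \<longleftrightarrow> ?I w \<le> x" if "w \<in> {0<..<1}" for w x
    using D.pseudoinverse[of w x] that by auto
  have null: "emeasure D B = 0" if "B \<in> sets borel" "emeasure lborel B = 0 \<or> B \<inter> {a..b} = {}" for B
  proof -
    have "emeasure D B = (\<integral>\<^sup>+ x. ennreal (g x) * indicator B x \<partial>lborel)"
      unfolding D_def using that by (subst emeasure_density) auto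
    also have "\<dots> = 0"
    proof (cases "B \<inter> {a..b} = {}")
      case True
      have "ennreal (g x) * indicator B x = 0" for x
      proof (cases "x \<in> B")
        case xB: True
        then have "x \<notin> {a..b}" using True by blast
        then show ?thesis using supp[of x] by simp
      qed simp
      then show ?thesis by (simp only: nn_integral_const mult_zero_left)
    next
      case False
      then have "AE x in lborel. x \<notin> B" using that by (intro AE_not_in null_setsI) auto
      then have "AE x in lborel. ennreal (g x) * indicator B x = 0" by eventually_elim simp
      then show ?thesis using nn_integral_0_iff_AE[of "\<lambda>x. ennreal (g x) * indicator B x" lborel] that(1) by simp
    qed
    finally show ?thesis .
  qed
  have range: "?I w \<in> {a..b}" if w: "w \<in> {0<..<1}" for w
  proof -
    have "emeasure D {b<..} = 0" by (rule null) auto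
    then have "measure D {b<..} = 0" by (simp add: measure_def)
    then have "measure D (- {b<..}) = 1"
      using P.prob_compl[of "{b<..}"] sD sets_eq_imp_space_eq[OF sD] by (simp add: Compl_eq_Diff_UNIV)
    moreover have "- {b<..} = {..b}" by auto
    ultimately have "cdf D b = 1" by (simp add: cdf_def)
    then have "?I w \<le> b" using pinv[OF w, of b] w by auto
    moreover have "a \<le> ?I w"
    proof (rule dense_le)
      fix x assume "x < a"
      have "emeasure D {..x} = 0" by (rule null) (use \<open>x < a\<close> in auto)
      then have "measure D {..x} = 0" by (simp add: measure_def)
      then have "\<not> ?I w \<le> x" using pinv[OF w, of x] w by (simp add: cdf_def)
      then show "x \<le> ?I w" by simp
    qed
    ultimately show ?thesis by simp
  qed
  have law: "distr unit_interval borel ?I = D" by (rule D.distr_I_eq_M)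
  have mI: "?I \<in> borel_measurable unit_interval"
  proof -
    have "sets unit_interval = sets (restrict_space borel {0<..<1::real})" by (simp add: sets_restrict_space)
    from measurable_cong_sets[OF this refl] show ?thesis using D.measurable_CI by blast
  qed
  define X where "X w = (if w \<in> {0<..<1} then ?I w else 0)" for w
  have mX: "X \<in> borel_measurable borel"
    using mI measurable_restrict_space_iff[of "{0<..<1}" lborel 0 borel ?I] unfolding X_def[abs_def] by simp
  have "distr unit_interval borel X = distr unit_interval borel ?I"
    by (intro distr_cong) (auto simp: X_def space_restrict_space)
  then have lawX: "distr unit_interval borel X = density lborel (\<lambda>x. ennreal (g x))" using law by (simp add: D_def)
  have strict: "strict_mono_on {0<..<1} X"
  proof (rule strict_mono_onI)
    fix r s :: real assume rs: "r \<in> {0<..<1}" "s \<in> {0<..<1}" "r < s"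
    have le: "?I w \<le> ?I w'" if "w \<in> {0<..<1}" "w' \<in> {0<..<1}" "w \<le> w'" for w w'
      using mono_onD[OF D.mono_I that] .
    have "?I r \<noteq> ?I s"
    proof
      assume eq: "?I r = ?I s"
      have "emeasure unit_interval {r<..<s} \<le> emeasure unit_interval (?I -` {?I r} \<inter> space unit_interval)"
      proof (rule emeasure_mono)
        show "{r<..<s} \<subseteq> ?I -` {?I r} \<inter> space unit_interval"
        proof
          fix w assume w: "w \<in> {r<..<s}"
          then have "w \<in> {0<..<1}" using rs by auto
          then show "w \<in> ?I -` {?I r} \<inter> space unit_interval"
            using le[of r w] le[of w s] w rs eq by (simp add: space_restrict_space)
        qed
        show "?I -` {?I r} \<inter> space unit_interval \<in> sets unit_interval" using mI by (rule measurable_sets) simp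
      qed
      also have "\<dots> = emeasure D {?I r}" by (rule emeasure_distr[OF mI, unfolded law, symmetric]) simp
      also have "\<dots> = 0" by (rule null) auto
      finally have "emeasure unit_interval {r<..<s} = 0" by simp
      moreover have "{r<..<s} \<subseteq> {0<..<1}" using rs by auto
      then have "emeasure unit_interval {r<..<s} = emeasure lborel {r<..<s}" by (intro emeasure_restrict_space) auto
      ultimately show False using rs by simp
    qed
    moreover have "?I r \<le> ?I s" using le[of r s] rs by simp
    ultimately show "X r < X s" using rs(1,2) unfolding X_def by simp
  qed
  have "X s \<in> {a..b}" if "s \<in> {0<..<1}" for s using range[OF that] that by (simp add: X_def)
  then show ?thesis by (rule that[OF mX strict _ lawX])
qed

text \<open>Concavity of the power 1/p, obtained from convexity of the power p at the points x powr
  (1/p) and y powr (1/p).\<close>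

lemma powr_concave:
  fixes x y t p :: real
  assumes t: "0 \<le> t" "t \<le> 1" and xy: "0 < x" "0 < y" and p: "1 \<le> p"
  shows "(1 - t) * x powr (1 / p) + t * y powr (1 / p) \<le> ((1 - t) * x + t * y) powr (1 / p)"
proof -
  let ?a = "x powr (1 / p)" and ?b = "y powr (1 / p)"
  have pos: "0 < (1 - t) * ?a + t * ?b"
    using t xy by (cases "t = 0") (auto intro!: add_nonneg_pos)
  have "((1 - t) * ?a + t * ?b) powr p \<le> (1 - t) * ?a powr p + t * ?b powr p"
    using convex_onD[OF powr_convex[OF p], of t ?a ?b] t xy by simp
  also have "\<dots> = (1 - t) * x + t * y" using p xy by (simp add: powr_powr)
  finally have "(((1 - t) * ?a + t * ?b) powr p) powr (1 / p) \<le> ((1 - t) * x + t * y) powr (1 / p)"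
    using p by (intro powr_mono2) auto
  then show ?thesis using pos p by (simp add: powr_powr)
qed


section \<open>Transport on an interval in the space\<close>

locale interval_space =
  fixes m :: "'a::polish_space measure" and \<alpha> \<beta> c :: real and \<psi> :: "real \<Rightarrow> 'a"
  assumes mm: "metric_measure_space m" and \<alpha>\<beta>: "\<alpha> \<le> \<beta>" and c: "0 < c"
    and iso: "\<And>s t. s \<in> {\<alpha>..\<beta>} \<Longrightarrow> t \<in> {\<alpha>..\<beta>} \<Longrightarrow> dist (\<psi> s) (\<psi> t) = \<bar>s - t\<bar>"
    and meas: "\<And>s t. \<alpha> \<le> s \<Longrightarrow> s \<le> t \<Longrightarrow> t \<le> \<beta> \<Longrightarrow> emeasure m (\<psi> ` {s..t}) = ennreal (c * (t - s))"
begin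

definition "W = \<psi> ` {\<alpha>..\<beta>}"
text \<open>Clamping the parameter extends the chart to a 1-Lipschitz map of the whole line, and its
  inverse is made constant off W. Both are then globally Borel and can be used in image
  measures.\<close>

definition e :: "real \<Rightarrow> 'a" where "e s = \<psi> (max \<alpha> (min \<beta> s))"
definition \<phi> :: "'a \<Rightarrow> real" where "\<phi> z = (if z \<in> W then inv_into {\<alpha>..\<beta>} \<psi> z else \<alpha>)"

lemma sm: "sets m = sets borel" by (rule metric_measure_space_sets[OF mm])

lemma space_m: "space m = UNIV" using sets_eq_imp_space_eq[OF sm] by simp

lemma compact_W: "compact W"
  unfolding W_def by (rule isometry_compact_image[OF iso]) auto

lemma borel_W [measurable]: "W \<in> sets borel" using compact_W by (rule borel_compact)

lemma inj: "inj_on \<psi> {\<alpha>..\<beta>}" by (rule inj_onI) (use iso in force)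

lemma e_eq: assumes "s \<in> {\<alpha>..\<beta>}" shows "e s = \<psi> s"
proof -
  have "max \<alpha> (min \<beta> s) = s" using assms by auto
  then show ?thesis by (simp add: e_def)
qed

lemma e_W: "e s \<in> W"
  using \<alpha>\<beta> by (auto simp: e_def W_def)

lemma \<phi>_range: "\<phi> z \<in> {\<alpha>..\<beta>}"
  using \<alpha>\<beta> inv_into_into[of z \<psi> "{\<alpha>..\<beta>}"] by (simp add: \<phi>_def W_def)

lemma \<phi>e: "s \<in> {\<alpha>..\<beta>} \<Longrightarrow> \<phi> (e s) = s"
  using inv_into_f_f[OF inj] e_W[of s] by (simp add: \<phi>_def e_eq)

lemma e\<phi>: "z \<in> W \<Longrightarrow> e (\<phi> z) = z"
  using \<phi>_range[of z] f_inv_into_f[of z \<psi> "{\<alpha>..\<beta>}"] by (simp add: e_eq \<phi>_def W_def)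

lemma dist_e: "s \<in> {\<alpha>..\<beta>} \<Longrightarrow> t \<in> {\<alpha>..\<beta>} \<Longrightarrow> dist (e s) (e t) = \<bar>s - t\<bar>"
  by (simp add: e_eq iso)

lemma dist_\<phi>: "z \<in> W \<Longrightarrow> w \<in> W \<Longrightarrow> dist z w = \<bar>\<phi> z - \<phi> w\<bar>"
  using dist_e[OF \<phi>_range[of z] \<phi>_range[of w]] by (simp add: e\<phi>)

lemma borel_e [measurable]: "e \<in> borel_measurable borel"
proof (rule borel_measurable_continuous_onI)
  have "dist (e s) (e t) \<le> \<bar>s - t\<bar>" for s t
    unfolding e_def using \<alpha>\<beta> by (subst iso) auto
  then show "continuous_on UNIV e"
    unfolding continuous_on_iff dist_real_def by (meson le_less_trans)
qed

lemma borel_\<phi> [measurable]: "\<phi> \<in> borel_measurable borel"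
  unfolding \<phi>_def[abs_def]
proof (rule borel_measurable_continuous_on_if)
  have "dist (inv_into {\<alpha>..\<beta>} \<psi> z) (inv_into {\<alpha>..\<beta>} \<psi> w) = dist z w" if "z \<in> W" "w \<in> W" for z w
    using dist_\<phi>[OF that] that by (simp add: \<phi>_def dist_real_def)
  then show "continuous_on W (inv_into {\<alpha>..\<beta>} \<psi>)"
    unfolding continuous_on_iff by metis
qed auto

text \<open>Half-lines determine the measure, and on them the hypothesis about images of closed
  intervals applies after removal of a null point.\<close>

lemma distr_\<phi>: "distr (density m (indicator W)) borel \<phi> = density lborel (\<lambda>s. ennreal (c * indicator {\<alpha>..\<beta>} s))"
proof (rule measure_eqI_lessThan)
  have [measurable_cong]: "sets m = sets borel" by (rule sm)
  have [measurable]: "\<phi> \<in> density m (indicator W) \<rightarrow>\<^sub>M borel" by measurable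
  have L: "emeasure (distr (density m (indicator W)) borel \<phi>) {x<..} = emeasure m (\<psi> ` ({x<..} \<inter> {\<alpha>..\<beta>}))" for x
  proof -
    have "emeasure (distr (density m (indicator W)) borel \<phi>) {x<..} = emeasure (density m (indicator W)) (\<phi> -` {x<..})"
      by (subst emeasure_distr) (auto simp: space_m)
    also have "\<dots> = emeasure m (W \<inter> \<phi> -` {x<..})"
    proof -
      have "\<phi> -` {x<..} \<in> sets borel" using measurable_sets[OF borel_\<phi>, of "{x<..}"] by simp
      then show ?thesis
        using sm by (subst emeasure_density) (auto simp: indicator_inter_arith[symmetric] sets.Int)
    qed
    also have "W \<inter> \<phi> -` {x<..} = \<psi> ` ({x<..} \<inter> {\<alpha>..\<beta>})"
    proof
      show "W \<inter> \<phi> -` {x<..} \<subseteq> \<psi> ` ({x<..} \<inter> {\<alpha>..\<beta>})"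
      proof
        fix z assume z: "z \<in> W \<inter> \<phi> -` {x<..}"
        then have "z = \<psi> (\<phi> z)" using e\<phi>[of z] e_eq[OF \<phi>_range] by auto
        then show "z \<in> \<psi> ` ({x<..} \<inter> {\<alpha>..\<beta>})" using z \<phi>_range[of z] by auto
      qed
      show "\<psi> ` ({x<..} \<inter> {\<alpha>..\<beta>}) \<subseteq> W \<inter> \<phi> -` {x<..}"
        using \<phi>e e_eq by (auto simp: W_def)
    qed
    finally show ?thesis .
  qed
  have R: "emeasure (density lborel (\<lambda>s. ennreal (c * indicator {\<alpha>..\<beta>} s))) {x<..} = ennreal c * emeasure lborel ({x<..} \<inter> {\<alpha>..\<beta>})" for x
  proof -
    have "emeasure (density lborel (\<lambda>s. ennreal (c * indicator {\<alpha>..\<beta>} s))) {x<..}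
        = (\<integral>\<^sup>+ s. ennreal c * indicator ({x<..} \<inter> {\<alpha>..\<beta>}) s \<partial>lborel)"
      by (subst emeasure_density) (auto intro!: nn_integral_cong simp: indicator_def)
    then show ?thesis by (simp add: nn_integral_cmult)
  qed
  show eq: "emeasure (distr (density m (indicator W)) borel \<phi>) {x<..}
      = emeasure (density lborel (\<lambda>s. ennreal (c * indicator {\<alpha>..\<beta>} s))) {x<..}" for x
  proof -
    consider "x < \<alpha>" | "\<alpha> \<le> x" "x \<le> \<beta>" | "\<beta> < x" by linarith
    then show ?thesis
    proof cases
      case 1
      then have "{x<..} \<inter> {\<alpha>..\<beta>} = {\<alpha>..\<beta>}" by auto
      then show ?thesis unfolding L R using meas[of \<alpha> \<beta>] \<alpha>\<beta> c by (simp add: ennreal_mult')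
    next
      case 2
      then have i: "{x<..} \<inter> {\<alpha>..\<beta>} = {x<..\<beta>}" by auto
      have "\<psi> ` {x<..\<beta>} = \<psi> ` {x..\<beta>} - \<psi> ` {x..x}"
      proof -
        have "{x<..\<beta>} = {x..\<beta>} - {x..x}" by auto
        then show ?thesis using inj 2 by (auto simp: inj_on_def)
      qed
      moreover have "emeasure m (\<psi> ` {x..\<beta>} - \<psi> ` {x..x}) = emeasure m (\<psi> ` {x..\<beta>})"
      proof (rule emeasure_Diff_null_set)
        have "compact (\<psi> ` {x..x})" "compact (\<psi> ` {x..\<beta>})" by (rule isometry_compact_image[OF iso]; use 2 in auto)+
        then have "\<psi> ` {x..x} \<in> sets m" "\<psi> ` {x..\<beta>} \<in> sets m" unfolding sm by (auto intro: borel_compact)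
        then show "\<psi> ` {x..x} \<in> null_sets m" "\<psi> ` {x..\<beta>} \<in> sets m" using meas[of x x] 2 by (auto intro: null_setsI)
      qed
      ultimately show ?thesis unfolding L R i using meas[of x \<beta>] 2 c by (simp add: ennreal_mult')
    next
      case 3
      then have "{x<..} \<inter> {\<alpha>..\<beta>} = {}" by auto
      then show ?thesis unfolding L R by simp
    qed
  qed
  show "emeasure (distr (density m (indicator W)) borel \<phi>) {x<..} < \<infinity>" for x
  proof -
    have "emeasure lborel ({x<..} \<inter> {\<alpha>..\<beta>}) \<le> emeasure lborel {\<alpha>..\<beta>}" by (intro emeasure_mono) auto
    also have "\<dots> < \<infinity>" using \<alpha>\<beta> by simp
    finally show ?thesis unfolding eq R by (simp add: ennreal_mult_less_top)
  qed
qed auto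

text \<open>The Lebesgue density of the image of \<nu> under the chart coordinate; the factor c
  converts m into length.\<close>

definition g :: "'a measure \<Rightarrow> real \<Rightarrow> real" where
  "g \<nu> s = c * indicator {\<alpha>..\<beta>} s * dens m \<nu> (e s)"

context
  fixes \<nu> assumes \<nu>: "\<nu> \<in> Pinf m" "AE z in \<nu>. z \<in> W"
begin

lemma borel_dens [measurable]: "dens m \<nu> \<in> borel_measurable borel"
  by (rule Pinf_density[OF mm \<nu>(1)])

lemma borel_g [measurable]: "g \<nu> \<in> borel_measurable borel"
  unfolding g_def[abs_def] by measurable

lemma g_nonneg: "0 \<le> g \<nu> s"
  using c by (simp add: g_def dens_nonneg)

lemma distr_density_g: "distr \<nu> borel \<phi> = density lborel (\<lambda>s. ennreal (g \<nu> s))"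
proof (rule measure_eqI)
  have s\<nu>: "sets \<nu> = sets borel" by (rule Pinf_sets[OF \<nu>(1)])
  have [measurable_cong]: "sets m = sets borel" "sets \<nu> = sets borel" by (fact sm s\<nu>)+
  have [measurable]: "\<phi> \<in> density m (indicator W) \<rightarrow>\<^sub>M borel" "\<phi> \<in> \<nu> \<rightarrow>\<^sub>M borel" by measurable
  fix B assume "B \<in> sets (distr \<nu> borel \<phi>)"
  then have [measurable]: "B \<in> sets borel" by simp
  have "emeasure (distr \<nu> borel \<phi>) B = (\<integral>\<^sup>+ z. indicator B (\<phi> z) \<partial>\<nu>)"
    by (subst nn_integral_indicator[symmetric], simp, subst nn_integral_distr) auto
  also have "\<dots> = (\<integral>\<^sup>+ z. indicator W z * indicator B (\<phi> z) \<partial>\<nu>)"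
    by (intro nn_integral_cong_AE) (use \<nu>(2) in \<open>eventually_elim, simp\<close>)
  also have "\<dots> = (\<integral>\<^sup>+ z. indicator W z * indicator B (\<phi> z) \<partial>density m (\<lambda>z. ennreal (dens m \<nu> z)))"
    unfolding Pinf_density(1)[OF mm \<nu>(1)] ..
  also have "\<dots> = (\<integral>\<^sup>+ z. ennreal (dens m \<nu> z) * (indicator W z * indicator B (\<phi> z)) \<partial>m)"
    by (subst nn_integral_density) auto
  also have "\<dots> = (\<integral>\<^sup>+ z. indicator W z * (ennreal (dens m \<nu> (e (\<phi> z))) * indicator B (\<phi> z)) \<partial>m)"
    by (intro nn_integral_cong) (auto simp: indicator_def e\<phi>)
  also have "\<dots> = (\<integral>\<^sup>+ z. ennreal (dens m \<nu> (e (\<phi> z))) * indicator B (\<phi> z) \<partial>density m (indicator W))"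
    by (subst nn_integral_density) auto
  also have "\<dots> = (\<integral>\<^sup>+ s. ennreal (dens m \<nu> (e s)) * indicator B s \<partial>distr (density m (indicator W)) borel \<phi>)"
    by (subst nn_integral_distr) auto
  also have "\<dots> = (\<integral>\<^sup>+ s. ennreal (c * indicator {\<alpha>..\<beta>} s) * (ennreal (dens m \<nu> (e s)) * indicator B s) \<partial>lborel)"
    unfolding distr_\<phi> by (subst nn_integral_density) auto
  also have "\<dots> = (\<integral>\<^sup>+ s. ennreal (g \<nu> s) * indicator B s \<partial>lborel)"
    using c by (intro nn_integral_cong) (auto simp: g_def indicator_def ennreal_mult')
  also have "\<dots> = emeasure (density lborel (\<lambda>s. ennreal (g \<nu> s))) B"
    by (subst emeasure_density) auto
  finally show "emeasure (distr \<nu> borel \<phi>) B = emeasure (density lborel (\<lambda>s. ennreal (g \<nu> s))) B" .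
qed auto

lemma quantile:
  obtains X where "X \<in> borel_measurable borel" "strict_mono_on {0<..<1} X" "\<And>s. s \<in> {0<..<1} \<Longrightarrow> X s \<in> {\<alpha>..\<beta>}"
    "distr unit_interval borel X = density lborel (\<lambda>s. ennreal (g \<nu> s))" "distr unit_interval borel (\<lambda>s. e (X s)) = \<nu>"
proof -
  have s\<nu>: "sets \<nu> = sets borel" by (rule Pinf_sets[OF \<nu>(1)])
  have [measurable_cong]: "sets \<nu> = sets borel" by (fact s\<nu>)
  have [measurable]: "\<phi> \<in> \<nu> \<rightarrow>\<^sub>M borel" by measurable
  have P: "prob_space (density lborel (\<lambda>s. ennreal (g \<nu> s)))"
    unfolding distr_density_g[symmetric] by (rule prob_space.prob_space_distr[OF Pinf_prob_space[OF \<nu>(1)]]) simp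
  obtain X where X: "X \<in> borel_measurable borel" "strict_mono_on {0<..<1} X" "\<And>s. s \<in> {0<..<1} \<Longrightarrow> X s \<in> {\<alpha>..\<beta>}"
    "distr unit_interval borel X = density lborel (\<lambda>s. ennreal (g \<nu> s))"
    using quantile_exists[OF borel_g P, of \<alpha> \<beta>] by (auto simp: g_def)
  have mX: "X \<in> borel_measurable unit_interval" by (rule measurable_unit_interval[OF X(1)])
  have "distr unit_interval borel (\<lambda>s. e (X s)) = distr (distr unit_interval borel X) borel e"
    using mX by (subst distr_distr) (auto simp: comp_def)
  also have "\<dots> = distr \<nu> borel (\<lambda>z. e (\<phi> z))"
    unfolding X(4) distr_density_g[symmetric] by (subst distr_distr) (auto simp: comp_def)
  also have "\<dots> = distr \<nu> borel (\<lambda>z. z)"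
    by (rule distr_cong_AE) (use \<nu>(2) in \<open>auto simp: e\<phi> s\<nu>\<close>)
  also have "\<dots> = \<nu>" using s\<nu> by (simp add: distr_id2)
  finally show ?thesis using that X by blast
qed

end


text \<open>Everything is parametrised by s in the unit interval: \<Gamma> t is the law of
  \<open>e (X t s)\<close>, and the coupling of two times uses the same s. The entropy of \<Gamma> t
  is minus the integral over s of its inverse density to the power 1/N';
  \<open>inverse_density_ge\<close> bounds this inverse density below by the interpolation of those
  at the ends, and concavity of the power finishes.\<close>

lemma CD_pair_interval:
  assumes \<nu>0: "\<nu>0 \<in> Pinf m" "AE z in \<nu>0. z \<in> W" and \<nu>1: "\<nu>1 \<in> Pinf m" "AE z in \<nu>1. z \<in> W"
  shows "CD_pair (\<lambda>K N t \<theta>. ennreal t) m K 1 \<nu>0 \<nu>1"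
proof -
  let ?\<Omega> = unit_interval
  interpret \<Omega>: prob_space ?\<Omega> by (rule prob_space_unit_interval)
  obtain X0 where X0: "X0 \<in> borel_measurable borel" "strict_mono_on {0<..<1} X0" "\<And>s. s \<in> {0<..<1} \<Longrightarrow> X0 s \<in> {\<alpha>..\<beta>}"
    "distr ?\<Omega> borel X0 = density lborel (\<lambda>s. ennreal (g \<nu>0 s))" "distr ?\<Omega> borel (\<lambda>s. e (X0 s)) = \<nu>0"
    by (rule quantile[OF \<nu>0]) blast
  obtain X1 where X1: "X1 \<in> borel_measurable borel" "strict_mono_on {0<..<1} X1" "\<And>s. s \<in> {0<..<1} \<Longrightarrow> X1 s \<in> {\<alpha>..\<beta>}"
    "distr ?\<Omega> borel X1 = density lborel (\<lambda>s. ennreal (g \<nu>1 s))" "distr ?\<Omega> borel (\<lambda>s. e (X1 s)) = \<nu>1"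
    by (rule quantile[OF \<nu>1]) blast
  interpret monotone_pair \<alpha> \<beta> X0 X1 "g \<nu>0" "g \<nu>1"
    by unfold_locales (fact X0 X1 borel_g[OF \<nu>0] borel_g[OF \<nu>1] g_nonneg[OF \<nu>0] g_nonneg[OF \<nu>1])+
  define \<Gamma> where "\<Gamma> t = distr ?\<Omega> borel (\<lambda>s. e (X t s))" for t
  have mX: "X t \<in> borel_measurable ?\<Omega>" for t by (intro measurable_unit_interval) measurable
  have meX: "(\<lambda>s. e (X t s)) \<in> borel_measurable ?\<Omega>" for t by (intro measurable_unit_interval) measurable
  have X01: "X 0 = X0" "X 1 = X1" by (auto simp: X_def)
  have \<Gamma>01: "\<Gamma> 0 = \<nu>0" "\<Gamma> 1 = \<nu>1" using X0(5) X1(5) by (simp_all add: \<Gamma>_def X01)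
  have \<Gamma>s: "sets (\<Gamma> t) = sets borel" for t by (simp add: \<Gamma>_def)
  have \<Gamma>P: "prob_space (\<Gamma> t)" for t unfolding \<Gamma>_def by (rule \<Omega>.prob_space_distr[OF meX])
  have \<Gamma>W: "AE z in \<Gamma> t. z \<in> W" for t
    unfolding \<Gamma>_def by (subst AE_distr_iff[OF meX]) (auto simp: e_W)
  have distr\<Gamma>: "distr (\<Gamma> t) borel \<phi> = distr ?\<Omega> borel (X t)" if t: "0 \<le> t" "t \<le> 1" for t
  proof -
    have "distr (\<Gamma> t) borel \<phi> = distr ?\<Omega> borel (\<lambda>s. \<phi> (e (X t s)))"
      unfolding \<Gamma>_def using meX by (subst distr_distr) (auto simp: comp_def)
    also have "\<dots> = distr ?\<Omega> borel (X t)"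
      by (intro distr_cong refl) (use \<phi>e X_range[OF t] sp in auto)
    finally show ?thesis .
  qed
  have \<Gamma>Pinf: "\<Gamma> t \<in> Pinf m" if t: "0 \<le> t" "t \<le> 1" for t
  proof -
    have "bounded W" using compact_W by (rule compact_imp_bounded)
    then obtain x0 r where r: "\<And>z. z \<in> W \<Longrightarrow> dist x0 z \<le> r" unfolding bounded_def by blast
    have "(\<integral>\<^sup>+ z. ennreal ((dist x0 z)\<^sup>2) \<partial>\<Gamma> t) \<le> (\<integral>\<^sup>+ z. ennreal (r\<^sup>2) \<partial>\<Gamma> t)"
      by (rule nn_integral_mono_AE) (use \<Gamma>W[of t] in \<open>eventually_elim, auto intro!: ennreal_leI power_mono r\<close>)
    also have "\<dots> < \<infinity>" using prob_space.emeasure_space_1[OF \<Gamma>P[of t]] by simp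
    finally have P2: "\<Gamma> t \<in> P2" unfolding P2_def using \<Gamma>s \<Gamma>P by auto
    have "AE z in \<Gamma> t. z \<notin> - W" using \<Gamma>W[of t] by eventually_elim simp
    then have "emeasure (\<Gamma> t) (- W) = 0"
      by (subst (asm) AE_iff_measurable[of "- W"]) (auto simp: \<Gamma>s sets_eq_imp_space_eq[OF \<Gamma>s])
    then have "msupport (\<Gamma> t) \<subseteq> W"
      by (intro msupport_subset_closed[OF \<Gamma>s] compact_imp_closed compact_W)
    then have b: "bounded (msupport (\<Gamma> t))" using \<open>bounded W\<close> bounded_subset by blast
    have "absolutely_continuous m (\<Gamma> t)"
      unfolding absolutely_continuous_def
    proof
      fix B assume "B \<in> null_sets m"
      then have B[measurable]: "B \<in> sets borel" and mB: "emeasure m B = 0" using sm by auto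
      \<comment> \<open>The null set is carried to the line by the chart, where
        \<open>X_absolutely_continuous\<close> applies.\<close>
      define B' where "B' = {s \<in> {\<alpha>..\<beta>}. e s \<in> B}"
      have [measurable]: "B' \<in> sets borel" unfolding B'_def by measurable
      have [measurable_cong]: "sets m = sets borel" by (rule sm)
      have "ennreal c * emeasure lborel B' = emeasure (density lborel (\<lambda>s. ennreal (c * indicator {\<alpha>..\<beta>} s))) B'"
      proof -
        have "emeasure (density lborel (\<lambda>s. ennreal (c * indicator {\<alpha>..\<beta>} s))) B' = (\<integral>\<^sup>+ s. ennreal c * indicator B' s \<partial>lborel)"
          by (subst emeasure_density) (auto intro!: nn_integral_cong simp: indicator_def B'_def)
        then show ?thesis by (simp add: nn_integral_cmult)
      qed
      also have "\<dots> = (\<integral>\<^sup>+ s. indicator B' s \<partial>distr (density m (indicator W)) borel \<phi>)"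
        unfolding distr_\<phi> by simp
      also have "\<dots> = (\<integral>\<^sup>+ z. indicator W z * indicator B' (\<phi> z) \<partial>m)"
      proof -
        have [measurable]: "\<phi> \<in> density m (indicator W) \<rightarrow>\<^sub>M borel" by measurable
        show ?thesis by (subst nn_integral_distr, simp, simp, subst nn_integral_density) auto
      qed
      also have "\<dots> \<le> (\<integral>\<^sup>+ z. indicator B z \<partial>m)"
        by (intro nn_integral_mono) (auto simp: indicator_def B'_def e\<phi>)
      also have "\<dots> = 0" using mB by simp
      finally have "emeasure lborel B' = 0" using c by (simp add: mult_le_0_iff)
      then have "emeasure (distr ?\<Omega> borel (X t)) B' = 0" by (intro X_absolutely_continuous[OF t]) auto
      moreover have "emeasure (distr ?\<Omega> borel (X t)) B' = emeasure (\<Gamma> t) B"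
        unfolding \<Gamma>_def using mX meX X_range[OF t]
        by (subst (1 2) emeasure_distr) (auto simp: B'_def sp intro!: arg_cong[where f = "emeasure ?\<Omega>"])
      ultimately show "B \<in> null_sets (\<Gamma> t)" using \<Gamma>s by (intro null_setsI) auto
    qed
    with P2 b show ?thesis by (simp add: Pinf_def)
  qed
  define Q where "Q r t = distr ?\<Omega> borel (\<lambda>s. (e (X r s), e (X t s)))" for r t
  have mQ: "(\<lambda>s. (e (X r s), e (X t s))) \<in> ?\<Omega> \<rightarrow>\<^sub>M borel" for r t
    unfolding borel_prod[symmetric] using meX by (intro measurable_Pair)
  have Qc: "Q r t \<in> couplings (\<Gamma> r) (\<Gamma> t)" for r t
    unfolding couplings_def Q_def \<Gamma>_def using mQ by (auto simp: distr_distr comp_def)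
  have cost: "transport_cost (Q r t) = (\<integral>\<^sup>+ s. ennreal ((X r s - X t s)\<^sup>2) \<partial>?\<Omega>)"
    if rt: "0 \<le> r" "r \<le> 1" "0 \<le> t" "t \<le> 1" for r t
  proof -
    have "transport_cost (Q r t) = (\<integral>\<^sup>+ s. ennreal ((dist (e (X r s)) (e (X t s)))\<^sup>2) \<partial>?\<Omega>)"
      unfolding transport_cost_def Q_def using mQ by (subst nn_integral_distr) auto
    also have "\<dots> = (\<integral>\<^sup>+ s. ennreal ((X r s - X t s)\<^sup>2) \<partial>?\<Omega>)"
      by (intro nn_integral_cong) (use dist_e X_range rt sp in auto)
    finally show ?thesis .
  qed
  \<comment> \<open>The coordinate is an isometry on W, so every coupling projects to a coupling on
    the line with the same cost; there comonotone couplings are optimal. Optimality for all pairs of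
    times yields the geodesic property.\<close>
  have opt: "transport_cost (Q r t) \<le> transport_cost q"
    if q: "q \<in> couplings (\<Gamma> r) (\<Gamma> t)" and rt: "0 \<le> r" "r \<le> 1" "0 \<le> t" "t \<le> 1" for q r t
  proof -
    have m\<phi>: "(\<lambda>p. \<phi> (fst p)) \<in> borel_measurable q" "(\<lambda>p. \<phi> (snd p)) \<in> borel_measurable q"
      by (rule couplings_measurable[OF q]; measurable)+
    have mf: "fst \<in> borel_measurable q" "snd \<in> borel_measurable q"
      by (intro couplings_measurable[OF q] fst_snd_borel_measurable)+
    have d: "distr q borel fst = \<Gamma> r" "distr q borel snd = \<Gamma> t" using q by (auto simp: couplings_def)
    have "(\<integral>\<^sup>+ s. ennreal ((X r s - X t s)\<^sup>2) \<partial>?\<Omega>) \<le> (\<integral>\<^sup>+ p. ennreal ((\<phi> (fst p) - \<phi> (snd p))\<^sup>2) \<partial>q)"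
    proof (rule comonotone_optimal[OF couplings_prob_space[OF q \<Gamma>P] m\<phi> borel_X borel_X])
      show "mono_on {0<..<1} (X r)" "mono_on {0<..<1} (X t)"
        using X_strict rt by (auto intro: strict_mono_on_imp_mono_on)
      show "X r s \<in> {\<alpha>..\<beta>}" "X t s \<in> {\<alpha>..\<beta>}" if "s \<in> {0<..<1}" for s using X_range that rt by auto
      have "distr q borel (\<lambda>p. \<phi> (fst p)) = distr (\<Gamma> r) borel \<phi>"
        unfolding d(1)[symmetric] using mf by (subst distr_distr) (auto simp: comp_def)
      then show "distr q borel (\<lambda>p. \<phi> (fst p)) = distr ?\<Omega> borel (X r)" using distr\<Gamma> rt by simp
      have "distr q borel (\<lambda>p. \<phi> (snd p)) = distr (\<Gamma> t) borel \<phi>"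
        unfolding d(2)[symmetric] using mf by (subst distr_distr) (auto simp: comp_def)
      then show "distr q borel (\<lambda>p. \<phi> (snd p)) = distr ?\<Omega> borel (X t)" using distr\<Gamma> rt by simp
    qed
    also have "\<dots> = transport_cost q"
      unfolding transport_cost_def
    proof (rule nn_integral_cong_AE)
      show "AE p in q. ennreal ((\<phi> (fst p) - \<phi> (snd p))\<^sup>2) = ennreal ((dist (fst p) (snd p))\<^sup>2)"
        using couplings_AE(1)[OF q \<Gamma>W] couplings_AE(2)[OF q \<Gamma>W]
        by eventually_elim (simp add: dist_\<phi>)
    qed
    finally show ?thesis using cost rt by simp
  qed
  have wass: "wasserstein (\<Gamma> r) (\<Gamma> t) = ennreal_powr (transport_cost (Q r t)) (1/2)"
    if rt: "0 \<le> r" "r \<le> 1" "0 \<le> t" "t \<le> 1" for r t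
    unfolding wasserstein_def
  proof (rule antisym)
    show "(INF q\<in>couplings (\<Gamma> r) (\<Gamma> t). ennreal_powr (transport_cost q) (1/2)) \<le> ennreal_powr (transport_cost (Q r t)) (1/2)"
      by (rule INF_lower[OF Qc])
    show "ennreal_powr (transport_cost (Q r t)) (1/2) \<le> (INF q\<in>couplings (\<Gamma> r) (\<Gamma> t). ennreal_powr (transport_cost q) (1/2))"
      by (rule INF_greatest) (intro ennreal_powr_mono opt rt; simp)
  qed
  have geo: "wasserstein (\<Gamma> r) (\<Gamma> t) = ennreal \<bar>r - t\<bar> * wasserstein (\<Gamma> 0) (\<Gamma> 1)"
    if rt: "0 \<le> r" "r \<le> 1" "0 \<le> t" "t \<le> 1" for r t
  proof -
    define C where "C = (\<integral>\<^sup>+ s. ennreal ((X0 s - X1 s)\<^sup>2) \<partial>?\<Omega>)"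
    have mC: "(\<lambda>s. ennreal ((X0 s - X1 s)\<^sup>2)) \<in> borel_measurable ?\<Omega>" by (intro measurable_unit_interval) measurable
    have "C \<le> (\<integral>\<^sup>+ s. ennreal ((\<beta> - \<alpha>)\<^sup>2) \<partial>?\<Omega>)"
      unfolding C_def
    proof (intro nn_integral_mono ennreal_leI)
      fix s assume "s \<in> space ?\<Omega>"
      then have "\<bar>X0 s - X1 s\<bar> \<le> \<beta> - \<alpha>" using X0(3)[of s] X1(3)[of s] by (auto simp: sp)
      then show "(X0 s - X1 s)\<^sup>2 \<le> (\<beta> - \<alpha>)\<^sup>2" using abs_le_square_iff[of "X0 s - X1 s" "\<beta> - \<alpha>"] by simp
    qed
    also have "\<dots> < \<infinity>" using \<Omega>.emeasure_space_1 by simp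
    finally obtain C' where C': "C = ennreal C'" "0 \<le> C'" by (cases C) auto
    have "transport_cost (Q r t) = (\<integral>\<^sup>+ s. ennreal ((r - t)\<^sup>2) * ennreal ((X0 s - X1 s)\<^sup>2) \<partial>?\<Omega>)"
      unfolding cost[OF rt]
      by (intro nn_integral_cong) (simp add: X_def ennreal_mult[symmetric] power_mult_distrib[symmetric] power2_commute algebra_simps)
    also have "\<dots> = ennreal ((r - t)\<^sup>2 * C')" using mC C' by (simp add: nn_integral_cmult C_def[symmetric] ennreal_mult)
    finally have 1: "wasserstein (\<Gamma> r) (\<Gamma> t) = ennreal (sqrt ((r - t)\<^sup>2 * C'))"
      using C' by (simp add: wass[OF rt] ennreal_powr_def powr_half_sqrt)
    have "transport_cost (Q 0 1) = ennreal C'" using cost[of 0 1] by (simp add: X01 C_def[symmetric] C')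
    then have "wasserstein (\<Gamma> 0) (\<Gamma> 1) = ennreal (sqrt C')"
      using C' wass[of 0 1] by (simp add: ennreal_powr_def powr_half_sqrt)
    then show ?thesis using 1 C' by (simp add: real_sqrt_mult ennreal_mult)
  qed
  have entropy: "renyi_entropy N' (\<Gamma> t) m \<le> - enn2ereal (\<integral>\<^sup>+ (x0, x1).
        (ennreal (1 - t) * ennreal (dens m \<nu>0 x0 powr (- 1/N')) + ennreal t * ennreal (dens m \<nu>1 x1 powr (- 1/N'))) \<partial>Q 0 1)"
    if t: "0 \<le> t" "t \<le> 1" and N': "1 \<le> N'" for t N'
  proof -
    note \<Gamma>t = \<Gamma>Pinf[OF t] \<Gamma>W[of t]
    note [measurable] = borel_dens[OF \<nu>0] borel_dens[OF \<nu>1] borel_dens[OF \<Gamma>t]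
    have [measurable_cong]: "sets m = sets borel" by (rule sm)
    have lawt: "distr ?\<Omega> borel (X t) = density lborel (\<lambda>s. ennreal (g (\<Gamma> t) s))"
      using distr_density_g[OF \<Gamma>t] distr\<Gamma>[OF t] by simp
    have AE: "AE s in ?\<Omega>. v t s \<le> 1 / g (\<Gamma> t) (X t s)"
      by (rule inverse_density_ge[OF t borel_g[OF \<Gamma>t] g_nonneg[OF \<Gamma>t] lawt])
    have pos: "AE s in ?\<Omega>. 0 < g (\<Gamma> t) (X t s)" "AE s in ?\<Omega>. 0 < g \<nu>0 (X0 s)" "AE s in ?\<Omega>. 0 < g \<nu>1 (X1 s)"
      by (rule density_pos[OF borel_g[OF \<Gamma>t] borel_X g_nonneg[OF \<Gamma>t] lawt]
        density_pos[OF borel_g[OF \<nu>0] X0(1) g_nonneg[OF \<nu>0] X0(4)]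
        density_pos[OF borel_g[OF \<nu>1] X1(1) g_nonneg[OF \<nu>1] X1(4)])+
    have "(\<integral>\<^sup>+ (x0, x1). (ennreal (1 - t) * ennreal (dens m \<nu>0 x0 powr (- 1/N')) + ennreal t * ennreal (dens m \<nu>1 x1 powr (- 1/N'))) \<partial>Q 0 1)
       = (\<integral>\<^sup>+ s. ennreal (1 - t) * ennreal (dens m \<nu>0 (e (X0 s)) powr (- 1/N')) + ennreal t * ennreal (dens m \<nu>1 (e (X1 s)) powr (- 1/N')) \<partial>?\<Omega>)"
    proof -
      have "(\<lambda>p. ennreal (1 - t) * ennreal (dens m \<nu>0 (fst p) powr (- 1/N')) + ennreal t * ennreal (dens m \<nu>1 (snd p) powr (- 1/N')))
          \<in> borel_measurable borel" by measurable
      then show ?thesis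
        unfolding Q_def case_prod_beta X01 using mQ[of 0 1, unfolded X01] by (subst nn_integral_distr) auto
    qed
    also have "\<dots> \<le> (\<integral>\<^sup>+ s. ennreal (dens m (\<Gamma> t) (e (X t s)) powr (- 1/N')) \<partial>?\<Omega>)"
    proof (rule nn_integral_mono_AE)
      show "AE s in ?\<Omega>. ennreal (1 - t) * ennreal (dens m \<nu>0 (e (X0 s)) powr (- 1/N')) + ennreal t * ennreal (dens m \<nu>1 (e (X1 s)) powr (- 1/N'))
          \<le> ennreal (dens m (\<Gamma> t) (e (X t s)) powr (- 1/N'))"
        using AE pos AE_space
      proof eventually_elim
        case (elim s)
        have s: "s \<in> {0<..<1}" using elim by (simp add: sp)
        define w0 w1 wt where "w0 = 1 / dens m \<nu>0 (e (X0 s))" "w1 = 1 / dens m \<nu>1 (e (X1 s))" "wt = 1 / dens m (\<Gamma> t) (e (X t s))"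
        have g: "g \<nu>0 (X0 s) = c * dens m \<nu>0 (e (X0 s))" "g \<nu>1 (X1 s) = c * dens m \<nu>1 (e (X1 s))"
          "g (\<Gamma> t) (X t s) = c * dens m (\<Gamma> t) (e (X t s))"
          using X0(3)[OF s] X1(3)[OF s] X_range[OF t s] by (simp_all add: g_def)
        have d: "0 < dens m \<nu>0 (e (X0 s))" "0 < dens m \<nu>1 (e (X1 s))" "0 < dens m (\<Gamma> t) (e (X t s))"
          using elim(2-4) c unfolding g by (simp_all add: zero_less_mult_iff)
        then have w: "0 < w0" "0 < w1" "0 < wt" by (simp_all add: w0_w1_wt_def)
        have "((1 - t) * w0 + t * w1) / c \<le> wt / c"
          using elim(1) unfolding v_def g w0_w1_wt_def by (simp add: add_divide_distrib mult.commute)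
        then have le: "(1 - t) * w0 + t * w1 \<le> wt" using c by (simp add: divide_le_cancel)
        have pw: "dens m \<nu>0 (e (X0 s)) powr (- 1/N') = w0 powr (1/N')" "dens m \<nu>1 (e (X1 s)) powr (- 1/N') = w1 powr (1/N')"
          "dens m (\<Gamma> t) (e (X t s)) powr (- 1/N') = wt powr (1/N')"
          using d by (simp_all add: w0_w1_wt_def powr_divide powr_minus_divide)
        have "(1 - t) * w0 powr (1/N') + t * w1 powr (1/N') \<le> ((1 - t) * w0 + t * w1) powr (1/N')"
          by (rule powr_concave[OF t w(1,2) N'])
        also have "\<dots> \<le> wt powr (1/N')" using le t w N' by (intro powr_mono2) auto
        finally show ?case unfolding pw using t by (simp add: ennreal_mult[symmetric] ennreal_plus[symmetric] del: ennreal_plus)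
      qed
    qed
    also have "\<dots> = (\<integral>\<^sup>+ z. ennreal (dens m (\<Gamma> t) z powr (- 1/N')) \<partial>\<Gamma> t)"
      unfolding \<Gamma>_def[of t, symmetric] by (subst (2) \<Gamma>_def, subst nn_integral_distr[OF meX]) (auto)
    also have "\<dots> = (\<integral>\<^sup>+ z. ennreal (dens m (\<Gamma> t) z powr (- 1/N')) \<partial>density m (\<lambda>z. ennreal (dens m (\<Gamma> t) z)))"
      unfolding Pinf_density(1)[OF mm \<Gamma>t(1)] ..
    also have "\<dots> = (\<integral>\<^sup>+ z. ennreal (dens m (\<Gamma> t) z) * ennreal (dens m (\<Gamma> t) z powr (- 1/N')) \<partial>m)"
      by (subst nn_integral_density) auto
    also have "\<dots> = (\<integral>\<^sup>+ z. ennreal (dens m (\<Gamma> t) z powr (1 - 1/N')) \<partial>m)"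
    proof (rule nn_integral_cong)
      fix z
      \<comment> \<open>At x = 0 both sides are 0, for N' = 1 by the convention 0 powr 0 =
        0.\<close>
      have "x * x powr (- 1/N') = x powr (1 - 1/N')" if "0 \<le> x" for x
        using that powr_add[of x 1 "- 1/N'"] by simp
      then show "ennreal (dens m (\<Gamma> t) z) * ennreal (dens m (\<Gamma> t) z powr (- 1/N')) = ennreal (dens m (\<Gamma> t) z powr (1 - 1/N'))"
        by (simp add: ennreal_mult[symmetric] dens_nonneg)
    qed
    finally show ?thesis unfolding renyi_entropy_def by (simp add: less_eq_ennreal.rep_eq)
  qed
  show ?thesis
    unfolding CD_pair_def
  proof (intro exI conjI ballI allI impI)
    show "optimal_coupling \<nu>0 \<nu>1 (Q 0 1)"
      unfolding optimal_coupling_def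
    proof (intro conjI ballI)
      show "Q 0 1 \<in> couplings \<nu>0 \<nu>1" using Qc[of 0 1] unfolding \<Gamma>01 .
      show "transport_cost (Q 0 1) \<le> transport_cost q" if "q \<in> couplings \<nu>0 \<nu>1" for q
      proof (rule opt)
        show "q \<in> couplings (\<Gamma> 0) (\<Gamma> 1)" using that unfolding \<Gamma>01 .
      qed simp_all
    qed
    show "Pinf_geodesic m \<Gamma>"
      unfolding Pinf_geodesic_def
    proof (intro conjI ballI)
      show "\<Gamma> t \<in> Pinf m" if "t \<in> {0..1}" for t using \<Gamma>Pinf[of t] that by simp
      show "wasserstein (\<Gamma> s) (\<Gamma> t) = ennreal \<bar>s - t\<bar> * wasserstein (\<Gamma> 0) (\<Gamma> 1)"
        if "s \<in> {0..1}" "t \<in> {0..1}" for s t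
        by (rule geo) (use that in simp_all)
    qed
    fix t :: real and N' :: real assume "t \<in> {0..1}" "1 \<le> N'"
    then show "renyi_entropy N' (\<Gamma> t) m \<le> - enn2ereal (\<integral>\<^sup>+ (x0, x1).
        (ennreal (1 - t) * ennreal (dens m \<nu>0 x0 powr (- 1/N')) + ennreal t * ennreal (dens m \<nu>1 x1 powr (- 1/N'))) \<partial>Q 0 1)"
      by (intro entropy) auto
  qed (rule \<Gamma>01)+
qed

end


section \<open>The equivalence\<close>

lemma contr_subset_ball:
  assumes "A \<subseteq> ball p R" "b \<in> ball p R" "0 < l" "l < 1"
  shows "contr b l A \<subseteq> ball p (6 * R)"
proof
  fix z assume z: "z \<in> contr b l A"
  have "dist p b < R" using assms(2) by simp
  with zero_le_dist[of p b] have R: "0 < R" by linarith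
  obtain x where x: "x \<in> A" "\<bar>dist z b - l * dist x b\<bar> < R"
    using z R unfolding contr_def by blast
  have "dist x b < 2 * R"
    using dist_triangle[of x b p] x(1) assms by (auto simp: dist_commute subset_eq)
  moreover have "l * dist x b \<le> 1 * dist x b" using assms by (intro mult_right_mono) auto
  ultimately have "dist z b < 3 * R" using x(2) unfolding abs_less_iff by linarith
  then show "z \<in> ball p (6 * R)"
    using dist_triangle[of p z b] assms(2) R by (simp add: dist_commute)
qed

text \<open>Accumulation of the support at p supplies the second point needed for a nondegenerate
  interval. If K were positive, contracting the image of [\<beta>/2, \<beta>] towards p by 1/2 would
  have to keep strictly more than half of its measure, but the result lies in the image of
  [\<beta>/4, \<beta>/2], which carries exactly half.\<close>

lemma locally_uniform_interval:
  fixes m :: "'a::polish_space measure"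
  assumes mm: "metric_measure_space m" and r: "0 < r"
    and CD: "\<And>\<nu>0 \<nu>1. \<nu>0 \<in> Pinf m \<Longrightarrow> \<nu>1 \<in> Pinf m \<Longrightarrow>
      msupport \<nu>0 \<subseteq> ball p r \<Longrightarrow> msupport \<nu>1 \<subseteq> ball p r \<Longrightarrow> CD_pair sigma_coeff m K 1 \<nu>0 \<nu>1"
    and acc: "\<And>\<rho>. 0 < \<rho> \<Longrightarrow> \<exists>y\<in>msupport m. y \<noteq> p \<and> dist p y < \<rho>"
  obtains \<alpha> \<beta> \<psi> c where "K \<le> 0" "\<alpha> \<le> 0" "0 < \<beta>" "0 < c"
    "\<And>s t. s \<in> {\<alpha>..\<beta>} \<Longrightarrow> t \<in> {\<alpha>..\<beta>} \<Longrightarrow> dist (\<psi> s) (\<psi> t) = \<bar>s - t\<bar>"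
    "\<psi> ` {\<alpha>..\<beta>} = msupport m \<inter> cball p \<beta>"
    "\<And>s t. \<alpha> \<le> s \<Longrightarrow> s \<le> t \<Longrightarrow> t \<le> \<beta> \<Longrightarrow> emeasure m (\<psi> ` {s..t}) = ennreal (c * (t - s))"
proof -
  have sm: "sets m = sets borel" by (rule metric_measure_space_sets[OF mm])
  define k where "k = max 0 (- K)"
  have k0: "0 \<le> k" by (simp add: k_def)
  obtain r0 where r0: "0 < r0" "r0 < r" "emeasure m (ball p r0) < \<infinity>"
    using metric_measure_space_finite_ball[OF mm r] by blast
  obtain r1 where r1: "0 < r1" "\<And>x. 0 \<le> x \<Longrightarrow> x \<le> r1 \<Longrightarrow> k * x\<^sup>2 \<le> 1 / 100"
    using small_square[of "1 / 100" k] by auto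
  define R where "R = min (r0 / 6) (r1 / 2)"
  have R: "0 < R" "6 * R \<le> r0" "2 * R \<le> r1" "R \<le> r"
    using r0 r1 by (auto simp: R_def)
  define V where "V = ball p (6 * R)"
  have VR: "ball p R \<subseteq> V" unfolding V_def using R by (intro subset_ball) simp
  have finV: "emeasure m V < \<infinity>"
  proof -
    have "emeasure m V \<le> emeasure m (ball p r0)" unfolding V_def using R sm by (intro emeasure_mono subset_ball) auto
    then show ?thesis using r0(3) by (rule le_less_trans)
  qed
  define M where "M = density m (indicator V)"
  have sM: "sets M = sets borel" by (simp add: M_def sm)
  have eM: "emeasure M A = emeasure m (V \<inter> A)" if "A \<in> sets borel" for A
  proof -
    have [measurable]: "V \<in> sets m" "A \<in> sets m" using that sm by (simp_all add: V_def)
    show ?thesis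
      unfolding M_def by (subst emeasure_density) (auto simp: indicator_inter_arith[symmetric])
  qed
  have eMV: "emeasure M A = emeasure m A" if "A \<in> sets borel" "A \<subseteq> V" for A
    using eM[OF that(1)] that(2) by (simp add: Int_absorb1)
  have finM: "finite_measure M"
  proof (rule finite_measureI)
    have "emeasure M (space M) = emeasure m (V \<inter> UNIV)"
      unfolding sets_eq_imp_space_eq[OF sM] space_borel by (rule eM) simp
    then show "emeasure M (space M) \<noteq> \<infinity>" using finV by simp
  qed
  have E: "z \<in> msupport M \<longleftrightarrow> z \<in> msupport m" if z: "z \<in> V" for z
  proof
    assume "z \<in> msupport M"
    then show "z \<in> msupport m"
      unfolding msupport_def using eM[of "ball z _"] emeasure_mono[of "V \<inter> ball z _" "ball z _" m] sm
      by (auto intro: less_le_trans)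
  next
    assume zm: "z \<in> msupport m"
    obtain d where d: "0 < d" "ball z d \<subseteq> V" using z by (metis V_def open_ball open_contains_ball)
    show "z \<in> msupport M"
      unfolding msupport_def mem_Collect_eq
    proof (intro allI impI)
      fix s :: real assume "0 < s"
      then have "0 < emeasure m (ball z (min s d))" using zm d by (auto simp: msupport_def)
      also have "\<dots> = emeasure M (ball z (min s d))"
        using d by (intro eMV[symmetric]) auto
      also have "\<dots> \<le> emeasure M (ball z s)" using sM by (intro emeasure_mono) auto
      finally show "0 < emeasure M (ball z s)" .
    qed
  qed
  have pE: "p \<in> msupport m"
  proof -
    have "p \<in> closure (msupport m)"
      unfolding closure_approachable using acc by (auto simp: dist_commute)
    then show ?thesis using closed_msupport[OF sm] by simp
  qed
  have pV: "p \<in> V" using R by (simp add: V_def)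
  have contract: "C * emeasure m A \<le> emeasure m (contr b l A)"
    if "A \<in> sets borel" "closure A \<subseteq> ball p R" "b \<in> msupport m" "b \<in> ball p R" "0 < l" "l < 1" "0 < d"
      "\<And>x y. x \<in> A \<Longrightarrow> y \<in> ball b d \<Longrightarrow> C \<le> sigma_coeff K 1 l (dist x y)" for A b l d C
  proof (rule contraction[OF mm _ _ that(1-7)])
    have sub: "ball p R \<subseteq> ball p r" using R by (intro subset_ball) simp
    show "CD_pair sigma_coeff m K 1 \<nu>0 \<nu>1"
      if "\<nu>0 \<in> Pinf m" "\<nu>1 \<in> Pinf m" "msupport \<nu>0 \<subseteq> ball p R" "msupport \<nu>1 \<subseteq> ball p R" for \<nu>0 \<nu>1
      using that sub by (intro CD) blast+
    show "emeasure m (ball p (6 * R)) < \<infinity>" using finV by (simp add: V_def)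
  qed (rule that(8))
  interpret finite_measure M by (rule finM)
  interpret contracting M p R k
  proof
    show "0 \<le> k" by (simp add: k_def)
    show "k * (2 * R)\<^sup>2 \<le> 1 / 100" by (rule r1(2)) (use R in auto)
    show "p \<in> msupport M" using E[OF pV] pE by simp
    fix A b and l D :: real
    assume A: "A \<in> sets borel" "closure A \<subseteq> ball p R" and b: "b \<in> msupport M" "b \<in> ball p R"
      and l: "0 < l" "l < 1" and D: "0 < D" "\<And>x. x \<in> A \<Longrightarrow> dist x b \<le> D"
    have AR: "A \<subseteq> ball p R" using A closure_subset by blast
    have "ennreal (l * (1 - k * D\<^sup>2)) * emeasure m A \<le> emeasure m (contr b l A)"
    proof (rule contract[OF A _ b(2) l D(1)])
      show "b \<in> msupport m" using E[of b] b VR by blast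
      fix x y assume xy: "x \<in> A" "y \<in> ball b D"
      let ?\<theta> = "dist x y"
      have \<theta>: "?\<theta> \<le> 2 * D" using dist_triangle[of x y b] D(2)[OF xy(1)] xy(2) by simp
      \<comment> \<open>Points y range over a ball of radius D around b, so distances may reach 2 D.
        The exponent then loses at most 4 k D^2 / 6, which is below k D^2.\<close>
      have "K * ?\<theta>\<^sup>2 * (1 - l\<^sup>2) \<ge> - (k * (2 * D)\<^sup>2 * 1)"
      proof -
        have "- K * ?\<theta>\<^sup>2 * (1 - l\<^sup>2) \<le> k * ?\<theta>\<^sup>2 * (1 - l\<^sup>2)"
          using l by (intro mult_right_mono) (auto simp: k_def power_le_one)
        also have "\<dots> \<le> k * (2 * D)\<^sup>2 * 1"
          using l \<theta> by (intro mult_mono mult_left_mono power_mono) (auto simp: k_def power_le_one)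
        finally show ?thesis by simp
      qed
      then have "1 - k * D\<^sup>2 \<le> 1 + K / 1 * ?\<theta>\<^sup>2 * (1 - l\<^sup>2) / 6"
        using mult_nonneg_nonneg[OF k0, of "D\<^sup>2"] by (simp add: power_mult_distrib)
      also have "\<dots> \<le> exp (K / 1 * ?\<theta>\<^sup>2 * (1 - l\<^sup>2) / 6)" by (rule exp_ge_add_one_self)
      finally have "l * (1 - k * D\<^sup>2) \<le> l * exp (K / 1 * ?\<theta>\<^sup>2 * (1 - l\<^sup>2) / 6)"
        using l by (intro mult_left_mono) auto
      then have "ennreal (l * (1 - k * D\<^sup>2)) \<le> ennreal (l * exp (K / 1 * ?\<theta>\<^sup>2 * (1 - l\<^sup>2) / 6))"
        by (rule ennreal_leI)
      also have "\<dots> \<le> sigma_coeff K 1 l ?\<theta>" using l by (intro sigma_coeff_ge) auto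
      finally show "ennreal (l * (1 - k * D\<^sup>2)) \<le> sigma_coeff K 1 l ?\<theta>" .
    qed
    moreover have "emeasure m A = ennreal (measure M A)"
      using eMV[OF A(1)] AR VR emeasure_eq_measure[of A] by auto
    moreover have "emeasure m (contr b l A) = ennreal (measure M (contr b l A))"
      using eMV[OF borel_closed[OF closed_contr]] contr_subset_ball[OF AR b(2) l] emeasure_eq_measure V_def by simp
    ultimately have "ennreal (l * (1 - k * D\<^sup>2)) * ennreal (measure M A) \<le> ennreal (measure M (contr b l A))"
      by simp
    then have "ennreal (l * (1 - k * D\<^sup>2) * measure M A) \<le> ennreal (measure M (contr b l A))"
      by (simp add: ennreal_mult'')
    then show "l * (1 - k * D\<^sup>2) * measure M A \<le> measure M (contr b l A)"
      by simp
  qed (use sM R in auto)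
  obtain y where y: "y \<in> msupport m" "y \<noteq> p" "dist p y < R / 64" using acc[of "R / 64"] R by auto
  then have y': "y \<in> msupport M" "0 < dist p y" "dist p y < R / 64"
    using E[of y] R by (auto simp: V_def)
  obtain \<alpha> \<beta> \<psi> c where \<alpha>\<beta>: "\<alpha> \<le> 0" "0 < \<beta>" "\<beta> \<le> dist p y" and c: "0 < c"
    and iso: "\<And>s t. s \<in> {\<alpha>..\<beta>} \<Longrightarrow> t \<in> {\<alpha>..\<beta>} \<Longrightarrow> dist (\<psi> s) (\<psi> t) = \<bar>s - t\<bar>"
    and img: "\<psi> ` {\<alpha>..\<beta>} = msupport M \<inter> cball p \<beta>" and \<psi>0: "\<psi> 0 = p"
    and meas: "\<And>s t. \<alpha> \<le> s \<Longrightarrow> s \<le> t \<Longrightarrow> t \<le> \<beta> \<Longrightarrow> measure M (\<psi> ` {s..t}) = c * (t - s)"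
    and con: "\<And>b s t l. \<alpha> \<le> s \<Longrightarrow> s \<le> t \<Longrightarrow> t \<le> \<beta> \<Longrightarrow> \<alpha> \<le> b \<Longrightarrow> b \<le> \<beta> \<Longrightarrow> 0 < l \<Longrightarrow> l < 1 \<Longrightarrow>
      msupport M \<inter> contr (\<psi> b) l (\<psi> ` {s..t}) \<subseteq> \<psi> ` {l * s + (1 - l) * b..l * t + (1 - l) * b}"
    by (rule uniform_on_interval[OF y']) blast
  have \<beta>R: "\<beta> < R" using \<alpha>\<beta> y(3) R by linarith
  have cR: "cball p \<beta> \<subseteq> ball p R" using \<beta>R by auto
  have img': "\<psi> ` {\<alpha>..\<beta>} = msupport m \<inter> cball p \<beta>"
    unfolding img using E cR VR by blast
  have \<psi>R: "\<psi> ` {s..t} \<subseteq> ball p R" if "\<alpha> \<le> s" "t \<le> \<beta>" for s t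
  proof -
    have "\<psi> ` {s..t} \<subseteq> \<psi> ` {\<alpha>..\<beta>}" using that by (intro image_mono) auto
    then show ?thesis unfolding img using cR by blast
  qed
  have \<psi>c: "closed (\<psi> ` {s..t})" if "\<alpha> \<le> s" "t \<le> \<beta>" for s t
    using isometry_compact_image[OF iso that] by (rule compact_imp_closed)
  have meas': "emeasure m (\<psi> ` {s..t}) = ennreal (c * (t - s))" if "\<alpha> \<le> s" "s \<le> t" "t \<le> \<beta>" for s t
    using eMV[OF borel_closed[OF \<psi>c[OF that(1,3)]]] \<psi>R[OF that(1,3)] VR emeasure_eq_measure[of "\<psi> ` {s..t}"] meas[OF that]
    by auto
  have "K \<le> 0"
  proof (rule ccontr)
    assume "\<not> K \<le> 0"
    then have K: "0 < K" by simp
    define A where "A = \<psi> ` {\<beta> / 2..\<beta>}"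
    \<comment> \<open>The guaranteed gain in the exponent at distance \<beta>/4, the least distance
      between A and the ball of radius \<beta>/4 around p.\<close>
    define \<kappa> where "\<kappa> = K / 1 * (\<beta> / 4)\<^sup>2 * (1 - (1 / 2)\<^sup>2) / 6"
    have \<kappa>: "0 < \<kappa>" using K \<alpha>\<beta> by (simp add: \<kappa>_def power2_eq_square)
    have ab: "\<alpha> \<le> \<beta> / 2" "\<beta> \<le> \<beta>" using \<alpha>\<beta> by auto
    have cA: "closed A" "A \<subseteq> ball p R" unfolding A_def by (rule \<psi>c[OF ab], rule \<psi>R[OF ab])
    have "ennreal (1 / 2 * exp \<kappa>) * emeasure m A \<le> emeasure m (contr p (1 / 2) A)"
    proof (rule contract)
      show "0 < \<beta> / 4" using \<alpha>\<beta> by simp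
      fix x y assume x: "x \<in> A" and y: "y \<in> ball p (\<beta> / 4)"
      have "\<beta> / 2 \<le> dist p x" using x iso[of 0] \<psi>0 \<alpha>\<beta> by (auto simp: A_def)
      then have "\<beta> / 4 \<le> dist x y" using dist_triangle[of p x y] y by (simp add: dist_commute)
      then have "(\<beta> / 4)\<^sup>2 \<le> (dist x y)\<^sup>2" using \<alpha>\<beta> by (intro power_mono) auto
      then have "\<kappa> \<le> K / 1 * (dist x y)\<^sup>2 * (1 - (1 / 2)\<^sup>2) / 6"
        unfolding \<kappa>_def using K by (intro divide_right_mono mult_right_mono mult_left_mono) (auto simp: power2_eq_square)
      then have "ennreal (1 / 2 * exp \<kappa>) \<le> ennreal (1 / 2 * exp (K / 1 * (dist x y)\<^sup>2 * (1 - (1 / 2)\<^sup>2) / 6))"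
        by (intro ennreal_leI mult_left_mono) auto
      also have "\<dots> \<le> sigma_coeff K 1 (1 / 2) (dist x y)" by (intro sigma_coeff_ge) auto
      finally show "ennreal (1 / 2 * exp \<kappa>) \<le> sigma_coeff K 1 (1 / 2) (dist x y)" .
    qed (use cA pE R in \<open>auto simp: borel_closed closure_closed\<close>)
    also have "\<dots> = emeasure M (contr p (1 / 2) A)"
      using contr_subset_ball[OF cA(2), of p "1/2"] R by (intro eMV[symmetric] borel_closed closed_contr) (auto simp: V_def)
    also have "\<dots> = emeasure M (msupport M \<inter> contr p (1 / 2) A)"
    proof (rule emeasure_eq_AE)
      show "AE z in M. (z \<in> contr p (1 / 2) A) = (z \<in> msupport M \<inter> contr p (1 / 2) A)"
        using AE_msupport[OF sM] by eventually_elim auto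
    qed (auto simp: sM closed_contr closed_E borel_closed closed_Int)
    also have "\<dots> \<le> emeasure M (\<psi> ` {\<beta> / 4..\<beta> / 2})"
    proof (rule emeasure_mono)
      show "msupport M \<inter> contr p (1 / 2) A \<subseteq> \<psi> ` {\<beta> / 4..\<beta> / 2}"
        using con[of "\<beta>/2" \<beta> 0 "1/2"] \<alpha>\<beta> \<psi>0 by (simp add: A_def)
      show "\<psi> ` {\<beta> / 4..\<beta> / 2} \<in> sets M" unfolding sM using \<alpha>\<beta> by (intro borel_closed \<psi>c) auto
    qed
    also have "\<dots> = ennreal (c * (\<beta> / 2 - \<beta> / 4))"
      unfolding emeasure_eq_measure by (subst meas) (use \<alpha>\<beta> in auto)
    finally have "ennreal (1 / 2 * exp \<kappa>) * ennreal (c * (\<beta> - \<beta> / 2)) \<le> ennreal (c * (\<beta> / 2 - \<beta> / 4))"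
      using meas'[of "\<beta> / 2" \<beta>] \<alpha>\<beta> by (simp add: A_def)
    then have "1 / 2 * exp \<kappa> * (c * (\<beta> - \<beta> / 2)) \<le> c * (\<beta> / 2 - \<beta> / 4)"
      using c \<alpha>\<beta> by (subst (asm) ennreal_mult[symmetric], simp, simp, subst (asm) ennreal_le_iff) auto
    then have "exp \<kappa> * (c * \<beta>) \<le> 1 * (c * \<beta>)" by simp
    then have "exp \<kappa> \<le> 1" using c \<alpha>\<beta> by (subst (asm) mult_le_cancel_right) auto
    then show False using \<kappa> by simp
  qed
  then show ?thesis by (rule that[OF _ \<alpha>\<beta>(1,2) c iso img' meas'])
qed

lemma CD_star_one_imp_CD_one:
  fixes m :: "'a::polish_space measure"
  assumes mm: "metric_measure_space m" and star: "\<And>K'. K' < K \<Longrightarrow> CD_loc_with sigma_coeff m K' 1" and K': "K' < K"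
  shows "CD_loc_with tau_coeff m K' 1"
proof (rule CD_loc_withI)
  fix p :: 'a
  have sm: "sets m = sets borel" by (rule metric_measure_space_sets[OF mm])
  have supp: "msupport \<nu> \<subseteq> msupport m" if "\<nu> \<in> Pinf m" for \<nu>
    using that Pinf_sets[OF that] by (intro msupport_absolutely_continuous[OF sm]) (auto simp: Pinf_def)
  \<comment> \<open>For K > 0 a positive value below K is taken, even if K' is negative: it excludes
    intervals, so only isolated points remain. Otherwise K1 = K' is negative and the linear
    coefficient dominates \<tau>.\<close>
  define K1 where "K1 = (if 0 < K then K / 2 else K')"
  have K1: "K1 < K" "K1 \<le> 0 \<Longrightarrow> K1 = K'" using K' by (auto simp: K1_def)
  obtain r where r: "0 < r" and CD: "\<And>\<nu>0 \<nu>1. \<nu>0 \<in> Pinf m \<Longrightarrow> \<nu>1 \<in> Pinf m \<Longrightarrow>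
      msupport \<nu>0 \<subseteq> ball p r \<Longrightarrow> msupport \<nu>1 \<subseteq> ball p r \<Longrightarrow> CD_pair sigma_coeff m K1 1 \<nu>0 \<nu>1"
    using CD_loc_withD[OF star[OF K1(1)], of p] by metis
  show "\<exists>r>0. \<forall>\<nu>0\<in>Pinf m. \<forall>\<nu>1\<in>Pinf m. msupport \<nu>0 \<subseteq> ball p r \<longrightarrow> msupport \<nu>1 \<subseteq> ball p r \<longrightarrow>
      CD_pair tau_coeff m K' 1 \<nu>0 \<nu>1"
  proof (cases "\<exists>\<rho>>0. \<forall>y\<in>msupport m. dist p y < \<rho> \<longrightarrow> y = p")
    case True
    then obtain \<rho> where \<rho>: "0 < \<rho>" "\<And>y. y \<in> msupport m \<Longrightarrow> dist p y < \<rho> \<Longrightarrow> y = p" by blast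
    show ?thesis
    proof (intro exI[of _ "min r \<rho>"] conjI ballI impI)
      fix \<nu>0 \<nu>1 assume \<nu>: "\<nu>0 \<in> Pinf m" "\<nu>1 \<in> Pinf m"
        "msupport \<nu>0 \<subseteq> ball p (min r \<rho>)" "msupport \<nu>1 \<subseteq> ball p (min r \<rho>)"
      have "ball p (min r \<rho>) \<subseteq> ball p r" by (intro subset_ball) simp
      then have "CD_pair sigma_coeff m K1 1 \<nu>0 \<nu>1" using \<nu> by (intro CD) blast+
      then show "CD_pair tau_coeff m K' 1 \<nu>0 \<nu>1"
      proof (rule CD_pair_mono[OF \<nu>(1,2)])
        fix x0 x1 and t N' :: real
        assume x: "x0 \<in> msupport \<nu>0" "x1 \<in> msupport \<nu>1" and t: "0 \<le> t" "1 \<le> N'"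
        have "x0 \<in> ball p (min r \<rho>)" "x1 \<in> ball p (min r \<rho>)" using x \<nu>(3,4) by blast+
        moreover have "x0 \<in> msupport m" "x1 \<in> msupport m" using x supp \<nu>(1,2) by blast+
        \<comment> \<open>All transport takes place at distance 0, where both coefficients equal t
          whatever the curvature bounds are. The case that p lies outside the support is
          included.\<close>
        ultimately have "x0 = p" "x1 = p" using \<rho>(2) by simp_all
        then show "tau_coeff K' N' t (dist x0 x1) \<le> sigma_coeff K1 N' t (dist x0 x1)"
          using t by (simp add: tau_coeff_zero sigma_coeff_zero)
      qed
    qed (use r \<rho> in auto)
  next
    case False
    then have acc: "\<exists>y\<in>msupport m. y \<noteq> p \<and> dist p y < \<rho>" if "0 < \<rho>" for \<rho> using that by blast
    obtain \<alpha> \<beta> \<psi> c where K1': "K1 \<le> 0" and \<alpha>\<beta>: "\<alpha> \<le> 0" "0 < \<beta>" and c: "0 < c"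
      and iso: "\<And>s t. s \<in> {\<alpha>..\<beta>} \<Longrightarrow> t \<in> {\<alpha>..\<beta>} \<Longrightarrow> dist (\<psi> s) (\<psi> t) = \<bar>s - t\<bar>"
      and img: "\<psi> ` {\<alpha>..\<beta>} = msupport m \<inter> cball p \<beta>"
      and meas: "\<And>s t. \<alpha> \<le> s \<Longrightarrow> s \<le> t \<Longrightarrow> t \<le> \<beta> \<Longrightarrow> emeasure m (\<psi> ` {s..t}) = ennreal (c * (t - s))"
      by (rule locally_uniform_interval[OF mm r CD acc]) blast+
    interpret I: interval_space m \<alpha> \<beta> c \<psi>
      by unfold_locales (use mm \<alpha>\<beta> c iso meas in auto)
    show ?thesis
    proof (intro exI[of _ \<beta>] conjI ballI impI)
      fix \<nu>0 \<nu>1 assume \<nu>: "\<nu>0 \<in> Pinf m" "\<nu>1 \<in> Pinf m" "msupport \<nu>0 \<subseteq> ball p \<beta>" "msupport \<nu>1 \<subseteq> ball p \<beta>"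
      have W: "AE z in \<nu>. z \<in> I.W" if "\<nu> \<in> Pinf m" "msupport \<nu> \<subseteq> ball p \<beta>" for \<nu>
        using AE_msupport[OF Pinf_sets[OF that(1)]]
      proof eventually_elim
        case (elim z)
        then have "z \<in> msupport m \<inter> cball p \<beta>" using supp[OF that(1)] that(2) by auto
        then show ?case unfolding I.W_def img .
      qed
      have "CD_pair (\<lambda>K N t \<theta>. ennreal t) m K' 1 \<nu>0 \<nu>1"
        using I.CD_pair_interval[OF \<nu>(1) W[OF \<nu>(1,3)] \<nu>(2) W[OF \<nu>(2,4)]] .
      then show "CD_pair tau_coeff m K' 1 \<nu>0 \<nu>1"
        using K1' K1(2) by (rule_tac CD_pair_mono[OF \<nu>(1,2)]) (auto intro!: tau_coeff_le_nonpos)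
    qed (rule \<alpha>\<beta>)
  qed
qed

theorem proposition5p5:
  fixes m :: "'a::polish_space measure" and K N :: real
  assumes "metric_measure_space m" and "N \<ge> 1"
  shows "(\<forall>K'<K. CD_star_loc m K' N) \<longleftrightarrow> (\<forall>K'<K. CD_loc m K' N)"
proof (intro iffI allI impI)
  fix K' assume star: "\<forall>K'<K. CD_star_loc m K' N" and K': "K' < K"
  show "CD_loc m K' N"
  proof (cases "N = 1")
    case True
    then show ?thesis
      using CD_star_one_imp_CD_one[OF assms(1) _ K'] star by (simp add: CD_star_loc_def CD_loc_def)
  next
    case False
    \<comment> \<open>The slack between K' and K is split: the step from K' to K1 pays for the
      change of coefficients, and K1 < K makes the hypothesis available.\<close>
    define K1 where "K1 = (K' + K) / 2"
    have K1: "K' < K1" "K1 < K" using K' by (auto simp: K1_def)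
    obtain \<theta>0 where \<theta>0: "0 < \<theta>0" "\<And>\<theta> N' t. 0 \<le> \<theta> \<Longrightarrow> \<theta> \<le> \<theta>0 \<Longrightarrow> N \<le> N' \<Longrightarrow> 0 \<le> t \<Longrightarrow> t \<le> 1 \<Longrightarrow>
        tau_coeff K' N' t \<theta> \<le> sigma_coeff K1 N' t \<theta>"
      using tau_coeff_le_sigma_coeff[OF K1(1), of N] False assms(2) by auto
    have "CD_loc_with sigma_coeff m K1 N" using star K1 by (simp add: CD_star_loc_def)
    then show ?thesis
      unfolding CD_loc_def by (rule CD_loc_with_mono[OF _ \<theta>0(1)]) (rule \<theta>0(2))
  qed
next
  fix K' assume CD: "\<forall>K'<K. CD_loc m K' N" and K': "K' < K"
  define K1 where "K1 = (K' + K) / 2"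
  have K1: "K' < K1" "K1 < K" using K' by (auto simp: K1_def)
  obtain \<theta>0 where \<theta>0: "0 < \<theta>0" "\<And>\<theta> N' t. 0 \<le> \<theta> \<Longrightarrow> \<theta> \<le> \<theta>0 \<Longrightarrow> 1 \<le> N' \<Longrightarrow> 0 \<le> t \<Longrightarrow> t \<le> 1 \<Longrightarrow>
      sigma_coeff K' N' t \<theta> \<le> tau_coeff K1 N' t \<theta>"
    using sigma_coeff_le_tau_coeff[OF K1(1)] by blast
  have "CD_loc_with tau_coeff m K1 N" using CD K1 by (simp add: CD_loc_def)
  then show "CD_star_loc m K' N"
    unfolding CD_star_loc_def
  proof (rule CD_loc_with_mono[OF _ \<theta>0(1)])
    fix N' t \<theta> :: real assume "N \<le> N'" "0 \<le> t" "t \<le> 1" "0 \<le> \<theta>" "\<theta> \<le> \<theta>0"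
    then show "sigma_coeff K' N' t \<theta> \<le> tau_coeff K1 N' t \<theta>"
      using assms(2) by (intro \<theta>0(2)) auto
  qed
qed

end
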